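(* Let $t_1,\ldots,t_s\in\mathbb{C}\setminus C_{\exp}$, write $\mathbf{t}=(t_1,\ldots,t_s)$, and suppose that $$\mathrm{tr.deg.}_{C_{\exp}}C_{\exp}(\mathbf{t},\exp(\mathbf{t}))=\mathrm{l.dim}_{\mathbb{Q}}(\mathbf{t}|C_{\exp})+\dim^e(\mathbf{t}).$$ Set $F:=C_{\exp}(\mathbf{t},\exp(\mathbf{t}))$. Put $E_0=L_0=\overline{F}$, and for every integer $n\geq 1$ put $$E_n:=\overline{E_{n-1}(\{\exp(x)\mid x\in E_{n-1}\})},\qquad L_n:=\overline{L_{n-1}(\{x\in\mathbb{C}\mid \exp(x)\in L_{n-1}\})}.$$ Let $E:=\bigcup_{n\geq 1}E_n$ and $L:=\bigcup_{n\geq 1}L_n$. Then $E$ is linearly disjoint from $L$ over $\overline{F}$.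
   Context: All fields are subfields of $\mathbb{C}$, $\overline{K}$ denotes the algebraic closure of $K$ in $\mathbb{C}$, and $\exp(z)=e^z$ is the complex exponential. For a tuple $\mathbf{x}=(x_1,\ldots,x_n)$, $\exp(\mathbf{x})=(\exp(x_1),\ldots,\exp(x_n))$. A derivation of $\mathbb{C}$ is a map $\partial:\mathbb{C}\to\mathbb{C}$ with $\partial(a+b)=\partial(a)+\partial(b)$ and $\partial(ab)=a\partial(b)+b\partial(a)$. It is an exponential derivation if moreover $\partial(\exp(z))=\exp(z)\partial(z)$ for all $z\in\mathbb{C}$. $C_{\exp}$ is the intersection of the kernels of all exponential derivations; it is an algebraically closed subfield of $\mathbb{C}$. For $A\subseteq\mathbb{C}$, $e\mathrm{cl}(A)$ is the set of $x\in\mathbb{C}$ such that $\partial(x)=0$ for every exponential derivation $\partial$ with $A\subseteq\ker\partial$. The operator $e\mathrm{cl}$ is a pregeometry, with associated dimension $\dim^e$: for $A,B\subseteq\mathbb{C}$ and an integer $n\geq 0$, $\dim^e(A|B)\geq n$ if and only if there exist $a_1,\ldots,a_n\in e\mathrm{cl}(A)$ and exponential derivations $\partial_1,\ldots,\partial_n$ with $B\subseteq\ker\partial_i$ for all $i$, such that $\partial_i(a_i)=1$ and $\partial_i(a_k)=0$ for $i\neq k$. Write $\dim^e(A)=\dim^e(A|\emptyset)$; for a tuple, use the set of its entries. For a tuple (or finite set) $A$ and a set $B\subseteq\mathbb{C}$, $\mathrm{l.dim}_{\mathbb{Q}}(A|B)$ is the dimension of the image of $\mathrm{Span}_{\mathbb{Q}}(A)$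 in the $\mathbb{Q}$-vector space $\mathbb{C}/\mathrm{Span}_{\mathbb{Q}}(B)$. For fields $K\subseteq M\cap N$, $M$ is linearly disjoint from $N$ over $K$ if every finite tuple of elements of $N$ that is $K$-linearly independent is also $M$-linearly independent. *)

theory Defs
  imports
    Complex_Main
    "HOL-Library.Extended_Nat"
    "HOL-Library.Multiset"
    "HOL-Library.Poly_Mapping"
    "HOL-Algebra.Generated_Fields"
    "HOL-Algebra.Algebraic_Closure_Type"
begin

text \<open>The field of complex numbers as a ring record, so that the notions of HOL-Algebra for
  subfields (generated subfields, algebraic elements, linear independence over a subfield)
  apply. It is a field by \<open>field_from_type_algebra\<close>.\<close>

abbreviation \<CC> :: "complex ring" where
  "\<CC> \<equiv> ring_of_type_algebra"

definition cx_alg_closure :: "complex set \<Rightarrow> complex set" where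
  "cx_alg_closure K = {x. \<not> ring.transcendental \<CC> K x}"

subsection \<open>Exponential derivations\<close>

definition derivation :: "(complex \<Rightarrow> complex) \<Rightarrow> bool" where
  "derivation D \<longleftrightarrow> (\<forall>a b. D (a + b) = D a + D b) \<and> (\<forall>a b. D (a * b) = a * D b + b * D a)"

definition exp_derivation :: "(complex \<Rightarrow> complex) \<Rightarrow> bool" where
  "exp_derivation D \<longleftrightarrow> derivation D \<and> (\<forall>z. D (exp z) = exp z * D z)"

definition C_exp :: "complex set" where
  "C_exp = (\<Inter>D \<in> {D. exp_derivation D}. {z. D z = 0})"

definition ecl :: "complex set \<Rightarrow> complex set" where
  "ecl A = {x. \<forall>D. exp_derivation D \<and> (\<forall>a\<in>A. D a = 0) \<longrightarrow> D x = 0}"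

definition edim_at_least :: "nat \<Rightarrow> complex set \<Rightarrow> complex set \<Rightarrow> bool" where
  "edim_at_least n A B \<longleftrightarrow>
     (\<exists>(a :: nat \<Rightarrow> complex) (D :: nat \<Rightarrow> complex \<Rightarrow> complex).
        (\<forall>i\<in>{1..n}. a i \<in> ecl A \<and> exp_derivation (D i) \<and> (\<forall>b\<in>B. D i b = 0)) \<and>
        (\<forall>i\<in>{1..n}. D i (a i) = 1) \<and>
        (\<forall>i\<in>{1..n}. \<forall>k\<in>{1..n}. i \<noteq> k \<longrightarrow> D i (a k) = 0))"

text \<open>\<open>edim_at_least\<close> is downward closed in \<open>n\<close> and holds for \<open>n = 0\<close>, so this is the unique
  extended natural number that is \<open>\<ge> n\<close> exactly when \<open>edim_at_least n A B\<close>.\<close>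

definition edim :: "complex set \<Rightarrow> complex set \<Rightarrow> enat" where
  "edim A B = (SUP n \<in> {n. edim_at_least n A B}. enat n)"

subsection \<open>Rational linear dimension modulo a set\<close>

abbreviation span_rat :: "complex set \<Rightarrow> complex set" where
  "span_rat \<equiv> module.span (\<lambda>(q::rat) (z::complex). of_rat q * z)"

text \<open>The residue classes of the elements of \<open>S\<close> are pairwise distinct and linearly independent
  in the quotient of the rational vector space of complex numbers by the subspace \<open>W\<close>: a linear
  combination of classes vanishes iff the same combination of representatives lies in \<open>W\<close>.\<close>

definition rat_independent_mod :: "complex set \<Rightarrow> complex set \<Rightarrow> bool" where
  "rat_independent_mod W S \<longleftrightarrow>
     (\<forall>c :: complex \<Rightarrow> rat. (\<Sum>x\<in>S. of_rat (c x) * x) \<in> W \<longrightarrow> (\<forall>x\<in>S. c x = 0))"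

text \<open>The dimension of the image of \<open>span_rat A\<close> in the quotient by \<open>span_rat B\<close>. Independent
  finite subsets of that image are given by representatives in \<open>span_rat A\<close>.\<close>

definition ldim_rat :: "complex set \<Rightarrow> complex set \<Rightarrow> enat" where
  "ldim_rat A B =
     (SUP S \<in> {S. finite S \<and> S \<subseteq> span_rat A \<and> rat_independent_mod (span_rat B) S}. enat (card S))"

subsection \<open>Transcendence degree\<close>

text \<open>Polynomials in variables indexed by complex numbers: a monomial is the multiset of its
  variables. \<open>eval_self\<close> substitutes for each variable the complex number that indexes it.\<close>

definition eval_self :: "(complex multiset \<Rightarrow>\<^sub>0 complex) \<Rightarrow> complex" where
  "eval_self p = (\<Sum>m\<in>Poly_Mapping.keys p. Poly_Mapping.lookup p m * prod_mset m)"

definition alg_independent :: "complex set \<Rightarrow> complex set \<Rightarrow> bool" where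
  "alg_independent K S \<longleftrightarrow>
     (\<forall>p. (\<forall>m. Poly_Mapping.lookup p m \<in> K) \<and> (\<forall>m\<in>Poly_Mapping.keys p. set_mset m \<subseteq> S)
          \<and> eval_self p = 0 \<longrightarrow> p = 0)"

definition trdeg :: "complex set \<Rightarrow> complex set \<Rightarrow> enat" where
  "trdeg K M = (SUP S \<in> {S. finite S \<and> S \<subseteq> M \<and> alg_independent K S}. enat (card S))"

subsection \<open>Linear disjointness\<close>

definition linearly_disjoint :: "complex set \<Rightarrow> complex set \<Rightarrow> complex set \<Rightarrow> bool" where
  "linearly_disjoint K M N \<longleftrightarrow>
     subfield K \<CC> \<and> subfield M \<CC> \<and> subfield N \<CC> \<and> K \<subseteq> M \<inter> N \<and>
     (\<forall>xs. set xs \<subseteq> N \<and> ring.independent \<CC> K xs \<longrightarrow> ring.independent \<CC> M xs)"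

subsection \<open>The towers of exponentials and of logarithms\<close>

primrec E_tower :: "complex set \<Rightarrow> nat \<Rightarrow> complex set" where
  "E_tower F 0 = cx_alg_closure F"
| "E_tower F (Suc n) = cx_alg_closure (generate_field \<CC> (E_tower F n \<union> {exp x | x. x \<in> E_tower F n}))"

primrec L_tower :: "complex set \<Rightarrow> nat \<Rightarrow> complex set" where
  "L_tower F 0 = cx_alg_closure F"
| "L_tower F (Suc n) = cx_alg_closure (generate_field \<CC> (L_tower F n \<union> {x. exp x \<in> L_tower F n}))"

end

theory Submission
  imports Defs "HOL-Computational_Algebra.Formal_Laurent_Series"
begin

text \<open>Everything is expressed through derivations: in characteristic zero the algebraic closure of a
  field \<open>K\<close> is the common kernel \<open>dcl K\<close> of the derivations of \<open>\<C>\<close> over \<open>K\<close>, and transcendence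
  degrees are dimensions of spaces of derivations. For a derivation \<open>\<delta>\<close> over \<open>C_exp\<close> put
  \<open>\<omega>\<^sub>z(\<delta>) = \<delta>(exp z) / exp z - \<delta> z\<close>. If \<open>D\<close> is exponential, then \<open>\<omega>\<^sub>z([D, \<delta>]) = D(\<omega>\<^sub>z(\<delta>))\<close>, so a
  shortest linear relation between the \<open>\<omega>\<^sub>z\<close> has coefficients in \<open>C_exp\<close>; comparing residues then gives
  Ax's theorem, that the \<open>\<omega>\<^sub>z\<close> are independent when the \<open>z\<close> are rationally independent modulo \<open>C_exp\<close>.
  The hypothesis on \<open>t\<close> says that Ax's inequality is sharp at \<open>t\<close>, which upgrades it to independence
  over \<open>F\<close> of the \<open>\<omega>\<^sub>z\<close> with \<open>z\<close> independent modulo the span of \<open>C_exp\<close> and \<open>t\<close>.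

  Let \<open>a\<^sub>1, \<dots>, a\<^sub>i\<close> and \<open>b\<^sub>1, \<dots>, b\<^sub>j\<close> be built up so that each \<open>a\<close> is algebraic over the preceding
  \<open>exp a\<close>, and each \<open>exp b\<close> over the preceding \<open>b\<close>. By induction on \<open>i + j\<close> the \<open>exp a\<close> and \<open>b\<close> are
  independent over \<open>F\<close>: otherwise some \<open>x\<close> outside the span of \<open>C_exp\<close> and \<open>t\<close> is at once a combination
  of the \<open>a\<close> and, modulo that span, of the \<open>b\<close>. The cases \<open>(i - 1, j)\<close> and \<open>(i, j - 1)\<close> put \<open>x\<close> and
  \<open>exp x\<close> into \<open>dcl F\<close>, which contradicts independence of \<open>\<omega>\<^sub>x\<close>. The derivations dual to the \<open>exp a\<close>
  that kill the \<open>b\<close> turn a shortest linear relation into one over \<open>dcl F\<close>.\<close>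

hide_const (open) UnivPoly.coeff UnivPoly.monom Module.smult

section \<open>Derivations and the closures they define\<close>

text \<open>Residues of logarithmic derivatives are integers, so they refute a relation only if its
  constant coefficients are rationally independent; hence the regrouping of a relation along a
  rational basis of its coefficients. Residues also live in Laurent series, while the complex field
  is only algebraic over a rational function field \<open>k(t)\<close>; hence norms and traces. The
  upgrade from \<open>C_exp\<close> to \<open>F\<close> is a dimension count. Restricted to
  \<open>F\<close>, the derivations over \<open>C_exp\<close> form a space whose dimension is the
  transcendence degree. Derivations dual to a basis of the span of \<open>t\<close> modulo
  \<open>C_exp\<close>, together with as many exponential ones as the exponential dimension allows,
  already fill it. So a derivation over \<open>C_exp\<close> without defect on that basis agrees on
  \<open>F\<close> with an exponential one, and a relation over \<open>F\<close> can be completed to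
  a relation over \<open>C_exp\<close>. The two chains are staggered. A combination of the a's is
  algebraic over all exp a but the last, while its exponential needs the last one too; a combination
  of the b's needs the last b, its exponential does not. This shift by one lets the two smaller
  cases treat x and exp x separately.\<close>

lemma derivation_add: "derivation D \<Longrightarrow> D (a + b) = D a + D b"
  and derivation_mult: "derivation D \<Longrightarrow> D (a * b) = a * D b + b * D a"
  unfolding derivation_def by auto

lemma derivation_0 [simp]: "derivation D \<Longrightarrow> D 0 = 0"
  using derivation_add[of D 0 0] by simp

lemma derivation_1 [simp]: "derivation D \<Longrightarrow> D 1 = 0"
  using derivation_mult[of D 1 1] by simp

lemma derivation_minus: "derivation D \<Longrightarrow> D (- a) = - D a"
  using derivation_add[of D a "- a"] by (simp add: eq_neg_iff_add_eq_0 add.commute)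

lemma derivation_diff: "derivation D \<Longrightarrow> D (a - b) = D a - D b"
  using derivation_add[of D a "- b"] derivation_minus[of D b] by simp

lemma derivation_sum: "derivation D \<Longrightarrow> D (\<Sum>i\<in>I. f i) = (\<Sum>i\<in>I. D (f i))"
  by (induction I rule: infinite_finite_induct) (auto simp: derivation_add)

lemma derivation_inverse:
  assumes "derivation D"
  shows "D (inverse a) = - D a / a\<^sup>2"
proof (cases "a = 0")
  case False
  have "a * D (inverse a) + inverse a * D a = 0"
    using derivation_mult[OF assms, of a "inverse a"] False assms by simp
  then have "a * D (inverse a) = - (D a / a)"
    by (simp add: field_simps eq_neg_iff_add_eq_0)
  then show ?thesis using False by (simp add: field_simps power2_eq_square)
qed (use assms in simp)

lemma derivation_prod:
  assumes "derivation D" "finite I" "\<And>i. i \<in> I \<Longrightarrow> f i \<noteq> 0"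
  shows "D (\<Prod>i\<in>I. f i) / (\<Prod>i\<in>I. f i) = (\<Sum>i\<in>I. D (f i) / f i)"
  using assms(2,3)
proof (induction I)
  case (insert x I)
  then have "(\<Prod>i\<in>I. f i) \<noteq> 0" "f x \<noteq> 0" by auto
  with insert show ?case
    by (simp add: derivation_mult[OF assms(1)] add_divide_distrib)
qed (use assms(1) in simp)

lemma derivation_of_nat: "derivation D \<Longrightarrow> D (of_nat n) = 0"
  by (induction n) (auto simp: derivation_add)

lemma derivation_of_int: "derivation D \<Longrightarrow> D (of_int n) = 0"
  by (cases n) (auto simp: derivation_of_nat derivation_diff derivation_minus simp del: of_nat_Suc)

lemma derivation_of_rat: "derivation D \<Longrightarrow> D (of_rat q) = 0"
  by (cases q) (simp add: of_rat_rat divide_inverse derivation_mult derivation_inverse derivation_of_int)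

lemma derivation_zero [simp]: "derivation (\<lambda>x. 0)"
  by (simp add: derivation_def)

lemma derivation_plus: "derivation D \<Longrightarrow> derivation D' \<Longrightarrow> derivation (\<lambda>x. D x + D' x)"
  by (simp add: derivation_def algebra_simps)

lemma derivation_scale: "derivation D \<Longrightarrow> derivation (\<lambda>x. c * D x)"
  by (simp add: derivation_def algebra_simps)

lemma derivation_subtract: "derivation D \<Longrightarrow> derivation D' \<Longrightarrow> derivation (\<lambda>x. D x - D' x)"
  by (simp add: derivation_def algebra_simps)

lemma derivation_lincomb:
  assumes "\<And>i. i \<in> I \<Longrightarrow> derivation (D i)"
  shows "derivation (\<lambda>x. \<Sum>i\<in>I. c i * D i x)"
  using assms
  by (induction I rule: infinite_finite_induct) (auto intro!: derivation_plus derivation_scale)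

lemma derivation_bracket:
  assumes "derivation D" "derivation D'"
  shows "derivation (\<lambda>x. D (D' x) - D' (D x))"
  unfolding derivation_def using assms
  by (auto simp: derivation_add derivation_mult algebra_simps)

lemma derivation_poly:
  assumes "derivation D"
  shows "D (poly p x) = poly (map_poly D p) x + poly (pderiv p) x * D x"
proof (induction p)
  case (pCons a p)
  then show ?case using assms
    by (simp add: derivation_add derivation_mult pderiv_pCons map_poly_pCons algebra_simps)
qed (use assms in simp)

text \<open>Taken for arbitrary sets: it is the algebraic closure of the field generated by
  \<open>S\<close>, but in this form the closure laws are immediate and involve no
  polynomials.\<close>

definition dcl :: "complex set \<Rightarrow> complex set" where
  "dcl S = {x. \<forall>D. derivation D \<and> (\<forall>s\<in>S. D s = 0) \<longrightarrow> D x = 0}"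

lemma dclI: "(\<And>D. derivation D \<Longrightarrow> (\<And>s. s \<in> S \<Longrightarrow> D s = 0) \<Longrightarrow> D x = 0) \<Longrightarrow> x \<in> dcl S"
  unfolding dcl_def by blast

lemma dclD: "x \<in> dcl S \<Longrightarrow> derivation D \<Longrightarrow> (\<And>s. s \<in> S \<Longrightarrow> D s = 0) \<Longrightarrow> D x = 0"
  unfolding dcl_def by blast

lemma dcl_superset: "S \<subseteq> dcl S"
  by (auto intro: dclI)

lemma dcl_least: "S \<subseteq> dcl T \<Longrightarrow> dcl S \<subseteq> dcl T"
  by (auto intro!: dclI elim!: dclD dest: subsetD)

lemma dcl_mono: "S \<subseteq> T \<Longrightarrow> dcl S \<subseteq> dcl T"
  by (meson dcl_least dcl_superset order_trans)

lemma dcl_idem: "dcl (dcl S) = dcl S"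
  by (simp add: dcl_least dcl_superset subset_antisym)

text \<open>The ring-record notion restated with type-class operations; as
  \<open>inverse 0 = 0\<close>, closure under inverses needs no side condition.\<close>

definition is_subfield :: "complex set \<Rightarrow> bool" where
  "is_subfield K \<longleftrightarrow> 1 \<in> K \<and> (\<forall>a\<in>K. \<forall>b\<in>K. a + b \<in> K \<and> a * b \<in> K) \<and>
     (\<forall>a\<in>K. - a \<in> K \<and> inverse a \<in> K)"

lemma
  assumes "is_subfield K"
  shows is_subfield_1: "1 \<in> K"
    and is_subfield_add: "a \<in> K \<Longrightarrow> b \<in> K \<Longrightarrow> a + b \<in> K"
    and is_subfield_mult: "a \<in> K \<Longrightarrow> b \<in> K \<Longrightarrow> a * b \<in> K"
    and is_subfield_minus: "a \<in> K \<Longrightarrow> - a \<in> K"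
    and is_subfield_inverse: "a \<in> K \<Longrightarrow> inverse a \<in> K"
  using assms unfolding is_subfield_def by auto

lemma is_subfield_0: "is_subfield K \<Longrightarrow> 0 \<in> K"
  using is_subfield_add[of K 1 "- 1"] is_subfield_1[of K] is_subfield_minus[of K 1] by simp

lemma is_subfield_diff: "is_subfield K \<Longrightarrow> a \<in> K \<Longrightarrow> b \<in> K \<Longrightarrow> a - b \<in> K"
  using is_subfield_add[of K a "- b"] is_subfield_minus[of K b] by simp

lemma is_subfield_divide: "is_subfield K \<Longrightarrow> a \<in> K \<Longrightarrow> b \<in> K \<Longrightarrow> a / b \<in> K"
  unfolding divide_inverse by (intro is_subfield_mult is_subfield_inverse)

lemma is_subfield_sum: "is_subfield K \<Longrightarrow> (\<And>i. i \<in> I \<Longrightarrow> f i \<in> K) \<Longrightarrow> (\<Sum>i\<in>I. f i) \<in> K"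
  by (induction I rule: infinite_finite_induct) (auto intro: is_subfield_0 is_subfield_add)

lemma is_subfield_power: "is_subfield K \<Longrightarrow> a \<in> K \<Longrightarrow> a ^ n \<in> K"
  by (induction n) (auto intro: is_subfield_1 is_subfield_mult)

lemma is_subfield_of_nat: "is_subfield K \<Longrightarrow> of_nat n \<in> K"
  by (induction n) (auto intro: is_subfield_0 is_subfield_1 is_subfield_add)

lemma is_subfield_of_int: "is_subfield K \<Longrightarrow> of_int n \<in> K"
  by (cases n) (auto intro: is_subfield_of_nat is_subfield_minus is_subfield_diff is_subfield_1
      simp del: of_nat_Suc)

lemma is_subfield_of_rat: "is_subfield K \<Longrightarrow> of_rat q \<in> K"
  by (cases q) (auto simp: of_rat_rat intro: is_subfield_of_int is_subfield_divide)

lemmas is_subfield_intros = is_subfield_0 is_subfield_1 is_subfield_add is_subfield_mult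
  is_subfield_minus is_subfield_inverse is_subfield_diff is_subfield_divide is_subfield_sum
  is_subfield_power is_subfield_of_nat is_subfield_of_int is_subfield_of_rat

lemma is_subfield_kernel: "derivation D \<Longrightarrow> is_subfield {x. D x = 0}"
  unfolding is_subfield_def
  by (auto simp: derivation_add derivation_mult derivation_minus derivation_inverse)

lemma is_subfield_Inter: "(\<And>K. K \<in> \<K> \<Longrightarrow> is_subfield K) \<Longrightarrow> is_subfield (\<Inter>\<K>)"
  unfolding is_subfield_def by blast

lemma is_subfield_dcl: "is_subfield (dcl S)"
proof -
  have "dcl S = (\<Inter>D\<in>{D. derivation D \<and> (\<forall>s\<in>S. D s = 0)}. {x. D x = 0})"
    unfolding dcl_def by auto
  then show ?thesis
    by (auto intro!: is_subfield_Inter is_subfield_kernel)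
qed

section \<open>Comparison with subfields of the ring record, generated fields\<close>

lemma is_subfield_iff: "is_subfield K \<longleftrightarrow> subfield K \<CC>"
proof -
  interpret field \<CC> by (rule field_from_type_algebra)
  have carr: "carrier \<CC> = UNIV" and add: "(\<oplus>\<^bsub>\<CC>\<^esub>) = (+)" and mult: "(\<otimes>\<^bsub>\<CC>\<^esub>) = (*)"
    and one: "\<one>\<^bsub>\<CC>\<^esub> = 1" and zero: "\<zero>\<^bsub>\<CC>\<^esub> = 0"
    by (auto simp: ring_of_type_algebra_def)
  have am: "a_inv \<CC> x = - x" for x
    by (rule sum_zero_eq_neg[symmetric]) (auto simp: carr add zero)
  have mi: "inv\<^bsub>\<CC>\<^esub> x = inverse x" if "x \<noteq> 0" for x
    by (rule comm_inv_char) (use that in \<open>auto simp: carr mult one\<close>)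
  show ?thesis
  proof
    assume K: "is_subfield K"
    show "subfield K \<CC>"
    proof (rule subfieldI')
      show "subring K \<CC>"
        by (rule subringI, unfold carr am add mult one) (use K[unfolded is_subfield_def] in simp_all)
      show "inv\<^bsub>\<CC>\<^esub> k \<in> K" if "k \<in> K - {\<zero>\<^bsub>\<CC>\<^esub>}" for k
        using that mi[of k] K[unfolded is_subfield_def] by (simp add: zero)
    qed
  next
    assume K: "subfield K \<CC>"
    note R = subfieldE(1)[OF K]
    have "inverse a \<in> K" if "a \<in> K" for a
      using subfield_m_inv(1)[OF K, of a] mi[of a] that subringE(2)[OF R]
      by (cases "a = 0") (simp_all add: zero)
    then show "is_subfield K"
      using subringE(3,5,6,7)[OF R] unfolding is_subfield_def am add mult one by simp
  qed
qed

lemma generate_field_least: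
  assumes "is_subfield K" "S \<subseteq> K"
  shows "generate_field \<CC> S \<subseteq> K"
proof -
  interpret field \<CC> by (rule field_from_type_algebra)
  show ?thesis using assms
    by (intro generate_field_min_subfield1) (auto simp: is_subfield_iff ring_of_type_algebra_def)
qed

lemma is_subfield_generate_field: "is_subfield (generate_field \<CC> S)"
proof -
  interpret field \<CC> by (rule field_from_type_algebra)
  show ?thesis unfolding is_subfield_iff
    by (rule generate_field_is_subfield) (simp add: ring_of_type_algebra_def)
qed

lemma dcl_generate_field: "dcl (generate_field \<CC> S) = dcl S"
proof (rule subset_antisym)
  show "dcl (generate_field \<CC> S) \<subseteq> dcl S"
    by (intro dcl_least generate_field_least is_subfield_dcl dcl_superset)
  show "dcl S \<subseteq> dcl (generate_field \<CC> S)"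
    by (intro dcl_mono) (auto intro: generate_field.incl)
qed

text \<open>An element of the generated field is a finite expression in \<open>S\<close>. The
  finiteness passes on to \<open>dcl\<close>, where Zorn's lemma and the passage from towers to
  finite chains depend on it.\<close>

lemma generate_field_finite_character:
  assumes "x \<in> generate_field \<CC> S"
  shows "\<exists>T\<subseteq>S. finite T \<and> x \<in> generate_field \<CC> T"
proof -
  interpret field \<CC> by (rule field_from_type_algebra)
  have mono: "generate_field \<CC> A \<subseteq> generate_field \<CC> B" if "A \<subseteq> B" for A B
    using that generate_field_least[OF is_subfield_generate_field, of A B]
      generate_field.incl[of _ B "\<CC>"] by blast
  have un: "\<exists>T\<subseteq>S. finite T \<and> A \<union> B \<subseteq> generate_field \<CC> T"
    if A: "\<exists>T\<subseteq>S. finite T \<and> A \<subseteq> generate_field \<CC> T" and B: "\<exists>T\<subseteq>S. finite T \<and> B \<subseteq> generate_field \<CC> T" for A B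
  proof -
    obtain T1 where "T1 \<subseteq> S" "finite T1" "A \<subseteq> generate_field \<CC> T1" using A by blast
    moreover obtain T2 where "T2 \<subseteq> S" "finite T2" "B \<subseteq> generate_field \<CC> T2" using B by blast
    ultimately show ?thesis using mono[of T1 "T1 \<union> T2"] mono[of T2 "T1 \<union> T2"]
      by (intro exI[of _ "T1 \<union> T2"]) auto
  qed
  show ?thesis using assms
  proof (induction rule: generate_field.induct)
    case one
    then show ?case by (intro exI[of _ "{}"]) (auto intro: generate_field.one)
  next
    case (incl h)
    then show ?case by (intro exI[of _ "{h}"]) (auto intro: generate_field.incl)
  next
    case (a_inv h)
    then show ?case by (blast intro: generate_field.a_inv)
  next
    case (m_inv h)
    then show ?case by (blast intro: generate_field.m_inv)
  next
    case (eng_add h1 h2)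
    then show ?case using un[of "{h1}" "{h2}"] by (blast intro: generate_field.eng_add)
  next
    case (eng_mult h1 h2)
    then show ?case using un[of "{h1}" "{h2}"] by (blast intro: generate_field.eng_mult)
  qed
qed

section \<open>Polynomials over subfields\<close>

definition polys_over :: "complex set \<Rightarrow> complex poly set" where
  "polys_over K = {p. \<forall>i. coeff p i \<in> K}"

lemma polys_overD: "p \<in> polys_over K \<Longrightarrow> coeff p i \<in> K"
  unfolding polys_over_def by blast

context
  fixes K :: "complex set"
  assumes K: "is_subfield K"
begin

lemma polys_over_0: "0 \<in> polys_over K"
  and polys_over_add: "p \<in> polys_over K \<Longrightarrow> q \<in> polys_over K \<Longrightarrow> p + q \<in> polys_over K"
  and polys_over_diff: "p \<in> polys_over K \<Longrightarrow> q \<in> polys_over K \<Longrightarrow> p - q \<in> polys_over K"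
  and polys_over_smult: "c \<in> K \<Longrightarrow> p \<in> polys_over K \<Longrightarrow> smult c p \<in> polys_over K"
  and polys_over_pCons: "c \<in> K \<Longrightarrow> p \<in> polys_over K \<Longrightarrow> pCons c p \<in> polys_over K"
  and polys_over_monom: "c \<in> K \<Longrightarrow> monom c n \<in> polys_over K"
  and polys_over_pderiv: "p \<in> polys_over K \<Longrightarrow> pderiv p \<in> polys_over K"
  using K unfolding polys_over_def
  by (auto intro: is_subfield_intros simp: coeff_pCons coeff_pderiv simp del: of_nat_Suc split: nat.split)

lemma polys_over_1: "1 \<in> polys_over K"
  using polys_over_pCons[OF is_subfield_1[OF K] polys_over_0] by (simp add: one_pCons)

lemma polys_over_mult:
  assumes "p \<in> polys_over K" "q \<in> polys_over K"
  shows "p * q \<in> polys_over K"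
proof -
  have "(\<Sum>i\<le>n. coeff p i * coeff q (n - i)) \<in> K" for n
    using assms by (intro is_subfield_sum[OF K] is_subfield_mult[OF K] polys_overD)
  then show ?thesis by (simp add: polys_over_def coeff_mult)
qed

lemmas polys_over_intros = polys_over_0 polys_over_1 polys_over_add polys_over_diff polys_over_mult
  polys_over_smult polys_over_pCons polys_over_monom polys_over_pderiv

lemma poly_polys_over:
  assumes "p \<in> polys_over K" "x \<in> K"
  shows "poly p x \<in> K"
  unfolding poly_altdef using assms
  by (intro is_subfield_sum[OF K] is_subfield_mult[OF K] is_subfield_power[OF K] polys_overD)

text \<open>Each step divides only by the leading coefficient of \<open>q\<close>, so quotient and
  remainder keep their coefficients in \<open>K\<close>.\<close>

lemma polys_over_division:
  assumes "p \<in> polys_over K" "q \<in> polys_over K" "q \<noteq> 0"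
  shows "\<exists>a\<in>polys_over K. \<exists>r\<in>polys_over K. p = a * q + r \<and> (r = 0 \<or> degree r < degree q)"
  using assms(1)
proof (induction "degree p" arbitrary: p rule: less_induct)
  case less
  show ?case
  proof (cases "p = 0 \<or> degree p < degree q")
    case True
    then show ?thesis using less.prems polys_over_0 by (intro bexI[of _ 0] bexI[of _ p]) auto
  next
    case False
    define m where "m = monom (lead_coeff p / lead_coeff q) (degree p - degree q)"
    define p' where "p' = p - m * q"
    have m: "m \<in> polys_over K"
      unfolding m_def using less.prems assms(2)
      by (intro polys_over_monom is_subfield_divide[OF K] polys_overD)
    have p': "p' \<in> polys_over K"
      unfolding p'_def using less.prems assms(2) m by (intro polys_over_diff polys_over_mult)
    have "degree m \<le> degree p - degree q"
      unfolding m_def by (rule degree_monom_le)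
    then have "degree (m * q) \<le> degree p"
      using degree_mult_le[of m q] False by linarith
    then have "degree p' \<le> degree p"
      unfolding p'_def by (intro degree_diff_le) auto
    moreover have "coeff p' (degree p) = 0"
      using False assms(3) unfolding p'_def m_def by (simp add: coeff_monom_mult)
    ultimately have *: "p' = 0 \<or> degree p' < degree p"
      using eq_zero_or_degree_less by blast
    have "\<exists>a\<in>polys_over K. \<exists>r\<in>polys_over K. p' = a * q + r \<and> (r = 0 \<or> degree r < degree q)"
    proof (cases "p' = 0")
      case True
      then show ?thesis using polys_over_0 by (intro bexI[of _ 0]) auto
    qed (use less.hyps[OF _ p'] * in blast)
    then obtain a r where ar: "a \<in> polys_over K" "r \<in> polys_over K" "p' = a * q + r"
      "r = 0 \<or> degree r < degree q" by blast
    then have "p = (a + m) * q + r" unfolding p'_def by (simp add: algebra_simps)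
    then show ?thesis using ar m polys_over_add[of a m] by blast
  qed
qed

end

section \<open>Algebraic elements and minimal polynomials\<close>

definition algebraic_over :: "complex set \<Rightarrow> complex \<Rightarrow> bool" where
  "algebraic_over K x \<longleftrightarrow> (\<exists>p\<in>polys_over K. p \<noteq> 0 \<and> poly p x = 0)"

text \<open>A generator of the ideal of polynomials over \<open>K\<close> that vanish at
  \<open>x\<close>, hence unique up to a nonzero constant. Divisibility is what later transports the
  vanishing of one polynomial to all of them.\<close>

definition is_min_poly :: "complex set \<Rightarrow> complex \<Rightarrow> complex poly \<Rightarrow> bool" where
  "is_min_poly K x P \<longleftrightarrow> P \<in> polys_over K \<and> P \<noteq> 0 \<and> poly P x = 0 \<and>
     (\<forall>p\<in>polys_over K. poly p x = 0 \<longrightarrow> (\<exists>a\<in>polys_over K. p = a * P))"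

lemma min_poly_exists:
  assumes K: "is_subfield K" and x: "algebraic_over K x"
  obtains P where "is_min_poly K x P"
proof -
  obtain P where P: "P \<in> polys_over K" "P \<noteq> 0" "poly P x = 0"
    and min: "\<And>p. p \<in> polys_over K \<and> p \<noteq> 0 \<and> poly p x = 0 \<Longrightarrow> degree P \<le> degree p"
    using ex_has_least_nat[of "\<lambda>p. p \<in> polys_over K \<and> p \<noteq> 0 \<and> poly p x = 0" _ degree] x
    unfolding algebraic_over_def by metis
  have "\<exists>a\<in>polys_over K. p = a * P" if p: "p \<in> polys_over K" "poly p x = 0" for p
  proof -
    obtain a r where ar: "a \<in> polys_over K" "r \<in> polys_over K" "p = a * P + r"
      "r = 0 \<or> degree r < degree P"
      using polys_over_division[OF K p(1) P(1,2)] by blast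
    have "poly r x = 0" using ar(3) p(2) P(3) by simp
    then have "r = 0" using min[of r] ar(2,4) by (meson not_less)
    then show ?thesis using ar by auto
  qed
  then show ?thesis using that[of P] P unfolding is_min_poly_def by blast
qed

lemma min_poly_degree_le:
  assumes "is_min_poly K x P" "p \<in> polys_over K" "poly p x = 0" "p \<noteq> 0"
  shows "degree P \<le> degree p"
proof -
  obtain a where "p = a * P" using assms unfolding is_min_poly_def by blast
  then show ?thesis using assms(4) by (auto simp: degree_mult_eq)
qed

lemma min_poly_degree_pos:
  assumes "is_min_poly K x P"
  shows "degree P > 0"
proof (rule ccontr)
  assume "\<not> ?thesis"
  then obtain c where "P = [:c:]" by (metis degree_0_id neq0_conv degree_eq_zeroE)
  then show False using assms unfolding is_min_poly_def by auto
qed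

text \<open>Separability in characteristic zero: the derivative is nonzero and of smaller degree, so
  minimality forbids it to vanish at \<open>x\<close>.\<close>

lemma min_poly_pderiv:
  assumes K: "is_subfield K" and P: "is_min_poly K x P"
  shows "poly (pderiv P) x \<noteq> 0"
proof
  assume "poly (pderiv P) x = 0"
  moreover have "pderiv P \<in> polys_over K"
    using P unfolding is_min_poly_def by (auto intro: polys_over_pderiv[OF K])
  moreover have "pderiv P \<noteq> 0" using min_poly_degree_pos[OF P] by (simp add: pderiv_eq_0_iff)
  ultimately have "degree P \<le> degree (pderiv P)"
    using min_poly_degree_le[OF P] by blast
  then show False using min_poly_degree_pos[OF P] degree_pderiv[of P] by linarith
qed

text \<open>Bezout: a generator of the ideal spanned by \<open>p\<close> and the minimal polynomial is constant.\<close>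

lemma algebraic_reciprocal:
  assumes K: "is_subfield K" and x: "algebraic_over K x"
    and p: "p \<in> polys_over K" "poly p x \<noteq> 0"
  shows "\<exists>q\<in>polys_over K. poly p x * poly q x = 1"
proof -
  obtain P where P: "is_min_poly K x P" using min_poly_exists[OF K x] .
  then have P': "P \<in> polys_over K" "P \<noteq> 0" "poly P x = 0" unfolding is_min_poly_def by auto
  define J where "J = {g. \<exists>a\<in>polys_over K. \<exists>b\<in>polys_over K. g = a * P + b * p}"
  have Jpoly: "g \<in> polys_over K" if "g \<in> J" for g
    using that P'(1) p(1) unfolding J_def by (auto intro: polys_over_intros[OF K])
  have PJ: "P \<in> J" "p \<in> J"
    using polys_over_0[OF K] polys_over_1[OF K] unfolding J_def by force+
  obtain g where g: "g \<in> J" "g \<noteq> 0" and min: "\<And>h. h \<in> J \<and> h \<noteq> 0 \<Longrightarrow> degree g \<le> degree h"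
    using ex_has_least_nat[of "\<lambda>h. h \<in> J \<and> h \<noteq> 0" _ degree] PJ P'(2) by metis
  have dvd: "\<exists>a\<in>polys_over K. h = a * g" if h: "h \<in> J" for h
  proof -
    obtain a r where ar: "a \<in> polys_over K" "r \<in> polys_over K" "h = a * g + r"
      "r = 0 \<or> degree r < degree g"
      using polys_over_division[OF K Jpoly[OF h] Jpoly[OF g(1)] g(2)] by blast
    obtain u v u' v' where uv: "u \<in> polys_over K" "v \<in> polys_over K" "h = u * P + v * p"
      "u' \<in> polys_over K" "v' \<in> polys_over K" "g = u' * P + v' * p"
      using h g(1) unfolding J_def by blast
    have "r = (u - a * u') * P + (v - a * v') * p"
      using ar(3) uv(3,6) by (simp add: algebra_simps)
    moreover have "u - a * u' \<in> polys_over K" "v - a * v' \<in> polys_over K"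
      using uv ar by (auto intro: polys_over_intros[OF K])
    ultimately have "r \<in> J" unfolding J_def by blast
    then have "r = 0" using min[of r] ar(4) by (meson not_less)
    then show ?thesis using ar by auto
  qed
  obtain h where h: "h \<in> polys_over K" "P = h * g" using dvd[OF PJ(1)] by blast
  obtain h' where h': "p = h' * g" using dvd[OF PJ(2)] by blast
  have "poly h x = 0" using h h' P'(3) p(2) by auto
  then obtain c where c: "h = c * P" using P h(1) unfolding is_min_poly_def by blast
  have "P * 1 = P * (c * g)" using h(2) unfolding c by (simp add: mult_ac)
  then have "c * g = 1" using P'(2) by (metis mult_left_cancel)
  then have "g dvd 1" by (metis dvd_triv_right)
  then obtain e where e: "g = [:e:]" by (metis is_unit_polyE)
  have "e \<noteq> 0" using g(2) e by auto
  have "e \<in> K" using Jpoly[OF g(1)] e polys_overD[of g K 0] by simp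
  obtain a b where ab: "a \<in> polys_over K" "b \<in> polys_over K" "g = a * P + b * p"
    using g(1) unfolding J_def by blast
  have "e = poly b x * poly p x" using arg_cong[OF ab(3), of "\<lambda>q. poly q x"] e P'(3) by simp
  then have "poly p x * poly (smult (inverse e) b) x = 1"
    using \<open>e \<noteq> 0\<close> by (simp add: field_simps)
  then show ?thesis
    using polys_over_smult[OF K is_subfield_inverse[OF K \<open>e \<in> K\<close>] ab(2)] by blast
qed

section \<open>Extending partial homomorphisms\<close>

text \<open>One notion for three targets: dual numbers yield derivations, the complex field yields
  automorphisms, Laurent series yield residues. The function is total, but only its values on the
  subfield \<open>M\<close> are constrained.\<close>

definition partial_hom :: "complex set \<Rightarrow> (complex \<Rightarrow> 'r::comm_ring_1) \<Rightarrow> bool" where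
  "partial_hom M f \<longleftrightarrow> is_subfield M \<and> f 1 = 1 \<and>
     (\<forall>a\<in>M. \<forall>b\<in>M. f (a + b) = f a + f b \<and> f (a * b) = f a * f b)"

text \<open>The forced image of \<open>poly p x\<close> under an extension of \<open>f\<close> that
  sends \<open>x\<close> to \<open>r\<close>.\<close>

definition eval_hom :: "(complex \<Rightarrow> 'r::comm_ring_1) \<Rightarrow> 'r \<Rightarrow> complex poly \<Rightarrow> 'r" where
  "eval_hom f r p = poly (map_poly f p) r"

context
  fixes M and f :: "complex \<Rightarrow> 'r::comm_ring_1"
  assumes phom: "partial_hom M f"
begin

lemma partial_hom_subfield: "is_subfield M"
  and partial_hom_1: "f 1 = 1"
  and partial_hom_add: "a \<in> M \<Longrightarrow> b \<in> M \<Longrightarrow> f (a + b) = f a + f b"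
  and partial_hom_mult: "a \<in> M \<Longrightarrow> b \<in> M \<Longrightarrow> f (a * b) = f a * f b"
  using phom unfolding partial_hom_def by auto

lemma partial_hom_0: "f 0 = 0"
  using partial_hom_add[of 0 0] is_subfield_0[OF partial_hom_subfield] by simp

lemma partial_hom_minus: "a \<in> M \<Longrightarrow> f (- a) = - f a"
  using partial_hom_add[of "- a" a] is_subfield_minus[OF partial_hom_subfield] partial_hom_0
  by (simp add: eq_neg_iff_add_eq_0)

lemma partial_hom_sum: "(\<And>i. i \<in> I \<Longrightarrow> g i \<in> M) \<Longrightarrow> f (\<Sum>i\<in>I. g i) = (\<Sum>i\<in>I. f (g i))"
  by (induction I rule: infinite_finite_induct)
    (auto simp: partial_hom_0 intro!: partial_hom_add is_subfield_sum[OF partial_hom_subfield]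
      trans[OF partial_hom_add])

lemma eval_hom_0 [simp]: "eval_hom f r 0 = 0"
  by (simp add: eval_hom_def)

lemma eval_hom_pCons: "eval_hom f r (pCons c p) = f c + r * eval_hom f r p"
  by (simp add: eval_hom_def map_poly_pCons partial_hom_0)

lemma eval_hom_const: "eval_hom f r [:c:] = f c"
  by (simp add: eval_hom_pCons)

lemma eval_hom_1 [simp]: "eval_hom f r 1 = 1"
  by (simp add: one_pCons eval_hom_const partial_hom_1)

lemma eval_hom_add:
  assumes "p \<in> polys_over M" "q \<in> polys_over M"
  shows "eval_hom f r (p + q) = eval_hom f r p + eval_hom f r q"
proof -
  have "map_poly f (p + q) = map_poly f p + map_poly f q"
    using assms by (intro poly_eqI)
      (simp add: coeff_map_poly partial_hom_0 partial_hom_add polys_overD)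
  then show ?thesis by (simp add: eval_hom_def)
qed

lemma eval_hom_minus:
  assumes "p \<in> polys_over M"
  shows "eval_hom f r (- p) = - eval_hom f r p"
proof -
  have "map_poly f (- p) = - map_poly f p"
    using assms by (intro poly_eqI)
      (simp add: coeff_map_poly partial_hom_0 partial_hom_minus polys_overD)
  then show ?thesis by (simp add: eval_hom_def)
qed

lemma eval_hom_mult:
  assumes "p \<in> polys_over M" "q \<in> polys_over M"
  shows "eval_hom f r (p * q) = eval_hom f r p * eval_hom f r q"
proof -
  have "map_poly f (p * q) = map_poly f p * map_poly f q"
  proof (rule poly_eqI)
    fix n
    have "f (\<Sum>i\<le>n. coeff p i * coeff q (n - i)) =
        (\<Sum>i\<le>n. f (coeff p i) * f (coeff q (n - i)))"
      using assms
      by (subst partial_hom_sum)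
        (auto simp: partial_hom_mult polys_overD intro!: is_subfield_mult[OF partial_hom_subfield])
    then show "coeff (map_poly f (p * q)) n = coeff (map_poly f p * map_poly f q) n"
      by (simp add: coeff_map_poly partial_hom_0 coeff_mult)
  qed
  then show ?thesis by (simp add: eval_hom_def)
qed

lemma partial_hom_poly:
  assumes "p \<in> polys_over M" "x \<in> M"
  shows "f (poly p x) = eval_hom f (f x) p"
  using assms(1)
proof (induction p)
  case (pCons c p)
  then have "c \<in> M" "p \<in> polys_over M"
    using polys_overD[OF pCons.prems, of 0] polys_overD[OF pCons.prems, of "Suc _"]
    by (auto simp: polys_over_def)
  then show ?case
    using pCons.IH assms(2) poly_polys_over[OF partial_hom_subfield, of p x]
    by (simp add: eval_hom_pCons partial_hom_add partial_hom_mult is_subfield_mult[OF partial_hom_subfield])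
qed (simp add: partial_hom_0)

lemma eval_hom_diff:
  assumes "p \<in> polys_over M" "q \<in> polys_over M"
  shows "eval_hom f r (p - q) = eval_hom f r p - eval_hom f r q"
proof -
  have "- q \<in> polys_over M"
    using polys_over_diff[OF partial_hom_subfield polys_over_0[OF partial_hom_subfield] assms(2)]
    by simp
  then show ?thesis
    using eval_hom_add[OF assms(1), of "- q"] eval_hom_minus[OF assms(2)] by simp
qed

end

section \<open>Simple field extensions\<close>

definition adjoin :: "complex set \<Rightarrow> complex \<Rightarrow> complex set" where
  "adjoin K x = {poly p x / poly q x | p q. p \<in> polys_over K \<and> q \<in> polys_over K \<and> poly q x \<noteq> 0}"

lemma adjoinI:
  "p \<in> polys_over K \<Longrightarrow> q \<in> polys_over K \<Longrightarrow> poly q x \<noteq> 0 \<Longrightarrow> poly p x / poly q x \<in> adjoin K x"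
  unfolding adjoin_def by blast

lemma adjoinE:
  assumes "y \<in> adjoin K x"
  obtains p q where "p \<in> polys_over K" "q \<in> polys_over K" "poly q x \<noteq> 0" "y = poly p x / poly q x"
  using assms unfolding adjoin_def by blast

lemma
  assumes K: "is_subfield K"
  shows subset_adjoin: "K \<subseteq> adjoin K x"
    and generator_in_adjoin: "x \<in> adjoin K x"
    and is_subfield_adjoin: "is_subfield (adjoin K x)"
proof -
  note I = polys_over_intros[OF K]
  show 1: "K \<subseteq> adjoin K x"
  proof
    fix a assume "a \<in> K"
    then show "a \<in> adjoin K x"
      using adjoinI[of "[:a:]" K 1 x] by (simp add: I)
  qed
  show "x \<in> adjoin K x"
    using adjoinI[of "[:0, 1:]" K 1 x] by (simp add: I is_subfield_0[OF K] is_subfield_1[OF K])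
  show "is_subfield (adjoin K x)"
    unfolding is_subfield_def
  proof (intro conjI ballI)
    show "1 \<in> adjoin K x" using 1 is_subfield_1[OF K] by blast
    fix a assume "a \<in> adjoin K x"
    then obtain p q where pq: "p \<in> polys_over K" "q \<in> polys_over K" "poly q x \<noteq> 0"
      "a = poly p x / poly q x" by (rule adjoinE)
    have "0 - p \<in> polys_over K" by (intro I pq)
    then show "- a \<in> adjoin K x"
      using adjoinI[of "0 - p" K q x] pq by simp
    show "inverse a \<in> adjoin K x"
    proof (cases "poly p x = 0")
      case True
      then show ?thesis using pq 1 is_subfield_0[OF K] by auto
    next
      case False
      then show ?thesis using adjoinI[of q K p x] pq(1,2) unfolding pq(4) by simp
    qed
    fix b assume "b \<in> adjoin K x"
    then obtain p' q' where pq': "p' \<in> polys_over K" "q' \<in> polys_over K" "poly q' x \<noteq> 0"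
      "b = poly p' x / poly q' x" by (rule adjoinE)
    have m: "q * q' \<in> polys_over K" "poly (q * q') x \<noteq> 0" using pq pq' by (auto intro: I)
    show "a * b \<in> adjoin K x"
      using adjoinI[of "p * p'" K "q * q'" x] m pq pq' by (simp add: I)
    have "p * q' + p' * q \<in> polys_over K" using pq pq' by (auto intro: I)
    moreover have "a + b = poly (p * q' + p' * q) x / poly (q * q') x"
      unfolding pq(4) pq'(4) using pq(3) pq'(3) by (simp add: add_frac_eq)
    ultimately show "a + b \<in> adjoin K x" using adjoinI m by metis
  qed
qed

text \<open>A fraction \<open>poly p x / poly q x\<close> has to go to the quotient of the
  evaluations. \<open>zero\<close> makes this independent of the representation; \<open>unit\<close>
  makes the quotient exist and be unique in a ring that may have zero divisors.\<close>

lemma partial_hom_adjoin: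
  fixes f :: "complex \<Rightarrow> 'r::comm_ring_1"
  assumes f: "partial_hom M f"
    and zero: "\<And>p. p \<in> polys_over M \<Longrightarrow> poly p x = 0 \<Longrightarrow> eval_hom f r p = 0"
    and unit: "\<And>p. p \<in> polys_over M \<Longrightarrow> poly p x \<noteq> 0 \<Longrightarrow> eval_hom f r p dvd 1"
  obtains g where "partial_hom (adjoin M x) g" "\<And>a. a \<in> M \<Longrightarrow> g a = f a" "g x = r"
proof -
  note M = partial_hom_subfield[OF f]
  note I = polys_over_intros[OF M]
  let ?F = "eval_hom f r"
  have cancel: "a = b" if "u dvd 1" "a * u = b * u" for a b u :: 'r
  proof -
    obtain v where "1 = u * v" using \<open>u dvd 1\<close> by (rule dvdE)
    then show ?thesis using \<open>a * u = b * u\<close> by (metis mult.assoc mult.right_neutral)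
  qed
  \<comment> \<open>The graph of the extension, described without division because the target is
    only a ring.\<close>
  define rel where "rel y s \<longleftrightarrow> (\<exists>p\<in>polys_over M. \<exists>q\<in>polys_over M. poly q x \<noteq> 0 \<and>
     y = poly p x / poly q x \<and> s * ?F q = ?F p)" for y s
  have relI: "rel (poly p x / poly q x) s"
    if "p \<in> polys_over M" "q \<in> polys_over M" "poly q x \<noteq> 0" "s * ?F q = ?F p" for p q s
    using that unfolding rel_def by blast
  have ex: "\<exists>s. rel y s" if y: "y \<in> adjoin M x" for y
  proof -
    obtain p q where pq: "p \<in> polys_over M" "q \<in> polys_over M" "poly q x \<noteq> 0" "y = poly p x / poly q x"
      using y by (rule adjoinE)
    obtain v where "1 = ?F q * v" using unit[OF pq(2,3)] by (rule dvdE)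
    then have "(?F p * v) * ?F q = ?F p" by (metis mult.assoc mult.commute mult.right_neutral)
    then show ?thesis using pq unfolding rel_def by blast
  qed
  have uniq: "s = s'" if s: "rel y s" and s': "rel y s'" for y s s'
  proof -
    obtain p q where pq: "p \<in> polys_over M" "q \<in> polys_over M" "poly q x \<noteq> 0"
      "y = poly p x / poly q x" "s * ?F q = ?F p" using s unfolding rel_def by blast
    obtain p' q' where pq': "p' \<in> polys_over M" "q' \<in> polys_over M" "poly q' x \<noteq> 0"
      "y = poly p' x / poly q' x" "s' * ?F q' = ?F p'" using s' unfolding rel_def by blast
    have "p * q' - p' * q \<in> polys_over M" using pq pq' by (intro I)
    moreover have "poly (p * q' - p' * q) x = 0" using pq pq' by (simp add: field_simps)
    ultimately have "?F (p * q' - p' * q) = 0" by (rule zero)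
    then have "?F p * ?F q' = ?F p' * ?F q"
      using pq pq' by (simp add: eval_hom_diff[OF f] eval_hom_mult[OF f] I)
    then have "s * (?F q * ?F q') = s' * (?F q * ?F q')"
      using pq(5) pq'(5) by (metis mult.assoc mult.commute)
    moreover have "?F q * ?F q' dvd 1"
      using unit[of "q * q'"] pq pq' by (simp add: eval_hom_mult[OF f] I)
    ultimately show ?thesis using cancel by metis
  qed
  define g where "g y = (SOME s. rel y s)" for y
  have rel_g: "rel y (g y)" if "y \<in> adjoin M x" for y
    unfolding g_def using ex[OF that] by (rule someI_ex)
  have g_eq: "g y = s" if "rel y s" for y s
  proof -
    have "y \<in> adjoin M x" using that unfolding rel_def by (auto intro: adjoinI)
    then show ?thesis using uniq[OF rel_g that] by simp
  qed
  have gM: "g a = f a" if "a \<in> M" for a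
    using g_eq[of a "f a"] relI[of "[:a:]" 1 "f a"] that
    by (simp add: I eval_hom_1[OF f] eval_hom_const[OF f])
  have gx: "g x = r"
    using g_eq[of x r] relI[of "[:0, 1:]" 1 r] is_subfield_0[OF M] is_subfield_1[OF M]
    by (simp add: I eval_hom_1[OF f] eval_hom_pCons[OF f] eval_hom_0[OF f] partial_hom_0[OF f] partial_hom_1[OF f])
  have "g (a + b) = g a + g b \<and> g (a * b) = g a * g b"
    if a: "a \<in> adjoin M x" and b: "b \<in> adjoin M x" for a b
  proof -
    obtain p q where pq: "p \<in> polys_over M" "q \<in> polys_over M" "poly q x \<noteq> 0"
      "a = poly p x / poly q x" "g a * ?F q = ?F p" using rel_g[OF a] unfolding rel_def by blast
    obtain p' q' where pq': "p' \<in> polys_over M" "q' \<in> polys_over M" "poly q' x \<noteq> 0"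
      "b = poly p' x / poly q' x" "g b * ?F q' = ?F p'" using rel_g[OF b] unfolding rel_def by blast
    have m: "q * q' \<in> polys_over M" "poly (q * q') x \<noteq> 0" using pq pq' by (auto intro: I)
    have n: "p * q' + p' * q \<in> polys_over M" "p * p' \<in> polys_over M" using pq pq' by (auto intro: I)
    have "(g a + g b) * ?F (q * q') = (g a * ?F q) * ?F q' + (g b * ?F q') * ?F q"
      unfolding eval_hom_mult[OF f pq(2) pq'(2)] by (simp add: algebra_simps)
    also have "\<dots> = ?F (p * q' + p' * q)"
      unfolding pq(5) pq'(5) using pq(1,2) pq'(1,2) by (simp add: eval_hom_mult[OF f] eval_hom_add[OF f] I)
    finally have 1: "rel (poly (p * q' + p' * q) x / poly (q * q') x) (g a + g b)"
      using relI m n by blast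
    have "(g a * g b) * ?F (q * q') = (g a * ?F q) * (g b * ?F q')"
      unfolding eval_hom_mult[OF f pq(2) pq'(2)] by (simp add: mult_ac)
    also have "\<dots> = ?F (p * p')"
      unfolding pq(5) pq'(5) using pq(1,2) pq'(1,2) by (simp add: eval_hom_mult[OF f])
    finally have 2: "rel (poly (p * p') x / poly (q * q') x) (g a * g b)"
      using relI m n by blast
    have "a + b = poly (p * q' + p' * q) x / poly (q * q') x"
      "a * b = poly (p * p') x / poly (q * q') x"
      unfolding pq(4) pq'(4) using pq(3) pq'(3) by (simp_all add: add_frac_eq)
    then show ?thesis using g_eq[OF 1] g_eq[OF 2] by simp
  qed
  moreover have "g 1 = 1" using gM[OF is_subfield_1[OF M]] partial_hom_1[OF f] by simp
  ultimately have "partial_hom (adjoin M x) g"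
    unfolding partial_hom_def using is_subfield_adjoin[OF M] by blast
  then show ?thesis using that[of g] gM gx by blast
qed

text \<open>For algebraic \<open>x\<close> the unit condition is automatic: a nonzero
  \<open>poly p x\<close> has an inverse that is again a polynomial in \<open>x\<close>. What
  remains is to send \<open>x\<close> to a root of the transported minimal polynomial.\<close>

lemma partial_hom_adjoin_algebraic:
  fixes f :: "complex \<Rightarrow> 'r::comm_ring_1"
  assumes f: "partial_hom M f" and P: "is_min_poly M x P" and r: "eval_hom f r P = 0"
  obtains g where "partial_hom (adjoin M x) g" "\<And>a. a \<in> M \<Longrightarrow> g a = f a" "g x = r"
proof -
  note M = partial_hom_subfield[OF f]
  have zero: "eval_hom f r p = 0" if p: "p \<in> polys_over M" "poly p x = 0" for p
  proof -
    obtain a where "a \<in> polys_over M" "p = a * P" using P p unfolding is_min_poly_def by blast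
    then show ?thesis using P r by (simp add: eval_hom_mult[OF f] is_min_poly_def)
  qed
  have "algebraic_over M x" using P unfolding is_min_poly_def algebraic_over_def by blast
  have unit: "eval_hom f r p dvd 1" if p: "p \<in> polys_over M" "poly p x \<noteq> 0" for p
  proof -
    obtain q where q: "q \<in> polys_over M" "poly p x * poly q x = 1"
      using algebraic_reciprocal[OF M \<open>algebraic_over M x\<close> p] by blast
    have "eval_hom f r (p * q - 1) = 0"
      using p q by (intro zero polys_over_diff[OF M] polys_over_mult[OF M] polys_over_1[OF M]) auto
    then have "1 = eval_hom f r p * eval_hom f r q"
      using p q by (simp add: eval_hom_diff[OF f] eval_hom_mult[OF f] eval_hom_1[OF f]
          polys_over_mult[OF M] polys_over_1[OF M])
    then show ?thesis by (rule dvdI)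
  qed
  show ?thesis using partial_hom_adjoin[of M f x r] f zero unit that by metis
qed

text \<open>Zorn's lemma is applied to the graphs of the extensions of \<open>f0\<close>; the predicate \<open>ok\<close> records a
  pointwise invariant that the extensions maintain.\<close>

lemma partial_hom_total:
  fixes f0 :: "complex \<Rightarrow> 'r::comm_ring_1"
  assumes f0: "partial_hom M0 f0"
    and ok0: "\<And>a. a \<in> M0 \<Longrightarrow> ok a (f0 a)"
    and step: "\<And>M f x. partial_hom M f \<Longrightarrow> M0 \<subseteq> M \<Longrightarrow> (\<And>a. a \<in> M0 \<Longrightarrow> f a = f0 a) \<Longrightarrow>
      (\<And>a. a \<in> M \<Longrightarrow> ok a (f a)) \<Longrightarrow> x \<notin> M \<Longrightarrow>
      \<exists>N g. partial_hom N g \<and> M \<subseteq> N \<and> (\<forall>a\<in>M. g a = f a) \<and> (\<forall>a\<in>N. ok a (g a)) \<and> x \<in> N"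
  obtains g where "partial_hom UNIV g" "\<And>a. a \<in> M0 \<Longrightarrow> g a = f0 a" "\<And>a. ok a (g a)"
proof -
  define graph where "graph M f = (\<lambda>a. (a, f a)) ` M" for M and f :: "complex \<Rightarrow> 'r"
  define \<A> where "\<A> = {graph M f | M f. partial_hom M f \<and> M0 \<subseteq> M \<and> (\<forall>a\<in>M0. f a = f0 a) \<and>
    (\<forall>a\<in>M. ok a (f a))}"
  have graph_sub: "graph M f \<subseteq> graph N g \<longleftrightarrow> M \<subseteq> N \<and> (\<forall>a\<in>M. g a = f a)" for M N f g
    unfolding graph_def by auto
  have "\<A> \<noteq> {}" using f0 ok0 unfolding \<A>_def by blast
  moreover have "\<Union>\<C> \<in> \<A>" if ne: "\<C> \<noteq> {}" and chain: "subset.chain \<A> \<C>" for \<C>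
  proof -
    have CA: "\<C> \<subseteq> \<A>" using chain unfolding subset_chain_def by blast
    define G where "G = \<Union>\<C>"
    define M where "M = fst ` G"
    define f where "f a = (SOME r. (a, r) \<in> G)" for a
    have single: "r = s" if rs: "(a, r) \<in> G" "(a, s) \<in> G" for a r s
    proof -
      obtain U V where UV: "U \<in> \<C>" "V \<in> \<C>" "(a, r) \<in> U" "(a, s) \<in> V" using rs unfolding G_def by blast
      then have "U \<subseteq> V \<or> V \<subseteq> U" using chain unfolding subset_chain_def by blast
      then obtain Z where "Z \<in> \<C>" "(a, r) \<in> Z" "(a, s) \<in> Z" using UV by blast
      then show ?thesis using CA unfolding \<A>_def graph_def by blast
    qed
    have f_eq: "f a = r" if "(a, r) \<in> G" for a r
      unfolding f_def by (rule some_equality) (use that single in blast)+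
    have G: "G = graph M f"
      unfolding graph_def M_def using f_eq by force
    have common: "\<exists>N g. graph N g \<in> \<C> \<and> partial_hom N g \<and> N \<subseteq> M \<and> (\<forall>c\<in>N. f c = g c) \<and> a \<in> N \<and> b \<in> N"
      if ab: "a \<in> M" "b \<in> M" for a b
    proof -
      obtain U V where UV: "U \<in> \<C>" "V \<in> \<C>" "a \<in> fst ` U" "b \<in> fst ` V"
        using ab unfolding M_def G_def by blast
      then have "U \<subseteq> V \<or> V \<subseteq> U" using chain unfolding subset_chain_def by blast
      then obtain Z where Z: "Z \<in> \<C>" "a \<in> fst ` Z" "b \<in> fst ` Z" using UV by blast
      then obtain N and g :: "complex \<Rightarrow> 'r" where Ng: "Z = graph N g" "partial_hom N g" using CA unfolding \<A>_def by blast
      have "graph N g \<subseteq> graph M f" using Z(1) Ng(1) G unfolding G_def by blast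
      then have "N \<subseteq> M" "\<forall>c\<in>N. f c = g c" unfolding graph_sub by auto
      moreover have "a \<in> N" "b \<in> N" using Z Ng unfolding graph_def by auto
      ultimately show ?thesis using Z(1) Ng by blast
    qed
    have M0: "M0 \<subseteq> M \<and> (\<forall>a\<in>M0. f a = f0 a)"
    proof -
      obtain U where U: "U \<in> \<C>" using ne by blast
      then obtain N and g :: "complex \<Rightarrow> 'r" where Ng: "U = graph N g" "M0 \<subseteq> N" "\<forall>a\<in>M0. g a = f0 a"
        using CA unfolding \<A>_def by blast
      have "graph N g \<subseteq> graph M f" using U Ng(1) G unfolding G_def by blast
      then show ?thesis using Ng unfolding graph_sub by (metis subset_eq)
    qed
    have "partial_hom M f"
      unfolding partial_hom_def is_subfield_def
    proof (intro conjI ballI)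
      have "1 \<in> M0" using is_subfield_1[OF partial_hom_subfield[OF f0]] .
      then show "1 \<in> M" "f 1 = 1" using M0 partial_hom_1[OF f0] by auto
      fix a assume a: "a \<in> M"
      {
        obtain N and g :: "complex \<Rightarrow> 'r" where N: "partial_hom N g" "N \<subseteq> M" "a \<in> N" using common[OF a a] by blast
        show "- a \<in> M" "inverse a \<in> M"
          using N is_subfield_minus[OF partial_hom_subfield[OF N(1)] N(3)]
            is_subfield_inverse[OF partial_hom_subfield[OF N(1)] N(3)] by auto
      }
      fix b assume b: "b \<in> M"
      obtain N and g :: "complex \<Rightarrow> 'r" where N: "partial_hom N g" "N \<subseteq> M" "\<forall>c\<in>N. f c = g c" "a \<in> N" "b \<in> N"
        using common[OF a b] by blast
      have ab: "a + b \<in> N" "a * b \<in> N"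
        using is_subfield_add[OF partial_hom_subfield[OF N(1)] N(4,5)]
          is_subfield_mult[OF partial_hom_subfield[OF N(1)] N(4,5)] by auto
      then show "a + b \<in> M" "a * b \<in> M" using N(2) by auto
      show "f (a + b) = f a + f b" "f (a * b) = f a * f b"
        using N ab partial_hom_add[OF N(1) N(4,5)] partial_hom_mult[OF N(1) N(4,5)] by simp_all
    qed
    moreover have "ok a (f a)" if "a \<in> M" for a
    proof -
      have "(a, f a) \<in> G" using that G unfolding graph_def by blast
      then obtain U where "U \<in> \<C>" "(a, f a) \<in> U" unfolding G_def by blast
      then obtain N and g :: "complex \<Rightarrow> 'r" where "U = graph N g" "\<forall>a\<in>N. ok a (g a)" "(a, f a) \<in> graph N g"
        using CA unfolding \<A>_def by blast
      then show ?thesis unfolding graph_def by auto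
    qed
    ultimately show ?thesis using M0 G unfolding G_def \<A>_def by blast
  qed
  ultimately obtain U where U: "U \<in> \<A>" and max: "\<And>V. V \<in> \<A> \<Longrightarrow> U \<subseteq> V \<Longrightarrow> V = U"
    using subset_Zorn_nonempty[of \<A>] by blast
  obtain M f where M: "U = graph M f" "partial_hom M f" "M0 \<subseteq> M" "\<And>a. a \<in> M0 \<Longrightarrow> f a = f0 a"
    "\<And>a. a \<in> M \<Longrightarrow> ok a (f a)"
    using U unfolding \<A>_def by blast
  have "x \<in> M" for x
  proof (rule ccontr)
    assume "x \<notin> M"
    then obtain N and g :: "complex \<Rightarrow> 'r" where N: "partial_hom N g" "M \<subseteq> N" "\<forall>a\<in>M. g a = f a" "\<forall>a\<in>N. ok a (g a)" "x \<in> N"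
      using step[OF M(2) M(3) M(4) M(5)] by blast
    have "M0 \<subseteq> N" "\<forall>a\<in>M0. g a = f0 a" using M(3,4) N(2,3) by auto
    then have "graph N g \<in> \<A>" using N(1,4) unfolding \<A>_def by blast
    moreover have "U \<subseteq> graph N g" using N unfolding M(1) graph_sub by simp
    ultimately have "graph N g = U" using max by blast
    then have "x \<in> M" using N(5) unfolding M(1) graph_def by auto
    then show False using \<open>x \<notin> M\<close> by simp
  qed
  then have "M = UNIV" by blast
  then show ?thesis using that[of f] M by blast
qed

section \<open>Extending derivations\<close>

text \<open>Dual numbers: a derivation \<open>D\<close> is the same as a homomorphism \<open>a \<mapsto> a + D a \<epsilon>\<close>.\<close>

datatype dual = Dual (standard: complex) (infinitesimal: complex)

instantiation dual :: comm_ring_1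
begin

definition "0 = Dual 0 0"
definition "1 = Dual 1 0"
definition "a + b = Dual (standard a + standard b) (infinitesimal a + infinitesimal b)"
definition "- a = Dual (- standard a) (- infinitesimal a)"
definition "a - b = Dual (standard a - standard b) (infinitesimal a - infinitesimal b)"
definition "a * b = Dual (standard a * standard b)
  (standard a * infinitesimal b + standard b * infinitesimal a)"

instance
  by standard
    (auto simp: zero_dual_def one_dual_def plus_dual_def uminus_dual_def minus_dual_def times_dual_def
      algebra_simps)

end

lemmas dual_defs = zero_dual_def one_dual_def plus_dual_def times_dual_def

lemma dual_unit: "standard a \<noteq> 0 \<Longrightarrow> a dvd 1"
  by (rule dvdI[of _ _ "Dual (1 / standard a) (- infinitesimal a / (standard a)\<^sup>2)"])
    (simp add: dual_defs field_simps power2_eq_square)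

text \<open>First-order Taylor expansion. Read through the correspondence with derivations, the
  infinitesimal part is the chain rule with \<open>u\<close> prescribed as the derivative of
  \<open>x\<close>.\<close>

lemma eval_hom_dual:
  assumes f: "partial_hom M f" and std: "\<And>a. a \<in> M \<Longrightarrow> standard (f a) = a" and p: "p \<in> polys_over M"
  shows "eval_hom f (Dual x u) p =
    Dual (poly p x) (poly (map_poly (\<lambda>a. infinitesimal (f a)) p) x + poly (pderiv p) x * u)"
  using p
proof (induction p)
  case 0
  then show ?case by (simp add: eval_hom_0[OF f] dual_defs)
next
  case (pCons c p)
  then have cp: "c \<in> M" "p \<in> polys_over M"
    using polys_overD[OF pCons.prems, of 0] polys_overD[OF pCons.prems, of "Suc _"]
    by (auto simp: polys_over_def)
  have "infinitesimal (f 0) = 0" using partial_hom_0[OF f] by (simp add: dual_defs)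
  then show ?case
    using pCons.IH[OF cp(2)] std[OF cp(1)]
    by (simp add: eval_hom_pCons[OF f] map_poly_pCons pderiv_pCons dual_defs algebra_simps)
qed

lemma dual_hom_adjoin:
  assumes f: "partial_hom M f" and std: "\<And>a. a \<in> M \<Longrightarrow> standard (f a) = a"
    and zero: "\<And>p. p \<in> polys_over M \<Longrightarrow> poly p x = 0 \<Longrightarrow> eval_hom f (Dual x u) p = 0"
  obtains g where "partial_hom (adjoin M x) g" "\<And>a. a \<in> M \<Longrightarrow> g a = f a" "g x = Dual x u"
    "\<And>a. a \<in> adjoin M x \<Longrightarrow> standard (g a) = a"
proof -
  note M = partial_hom_subfield[OF f]
  have "eval_hom f (Dual x u) p dvd 1" if "p \<in> polys_over M" "poly p x \<noteq> 0" for p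
    using that by (intro dual_unit) (simp add: eval_hom_dual[OF f std])
  then obtain g where g: "partial_hom (adjoin M x) g" "\<And>a. a \<in> M \<Longrightarrow> g a = f a" "g x = Dual x u"
    using partial_hom_adjoin[of M f x "Dual x u"] f zero by metis
  have poly: "standard (g (poly p x)) = poly p x \<and> poly p x \<in> adjoin M x" if p: "p \<in> polys_over M" for p
  proof -
    have p': "p \<in> polys_over (adjoin M x)"
      using p subset_adjoin[OF M] unfolding polys_over_def by blast
    have "map_poly g p = map_poly f p"
      using g(2) p is_subfield_0[OF M]
      by (intro poly_eqI) (simp add: coeff_map_poly polys_overD partial_hom_0[OF g(1)] partial_hom_0[OF f])
    then have "g (poly p x) = eval_hom f (Dual x u) p"
      using partial_hom_poly[OF g(1) p' generator_in_adjoin[OF M]] g(3) by (simp add: eval_hom_def)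
    then show ?thesis
      using eval_hom_dual[OF f std p] poly_polys_over[OF is_subfield_adjoin[OF M] p' generator_in_adjoin[OF M]]
      by simp
  qed
  have "standard (g a) = a" if a: "a \<in> adjoin M x" for a
  proof -
    obtain p q where pq: "p \<in> polys_over M" "q \<in> polys_over M" "poly q x \<noteq> 0" "a = poly p x / poly q x"
      using a by (rule adjoinE)
    have "g a * g (poly q x) = g (poly p x)"
      using partial_hom_mult[OF g(1) a, of "poly q x"] poly[OF pq(2)] pq(3,4) by simp
    then have "standard (g a) * standard (g (poly q x)) = standard (g (poly p x))"
      by (metis dual.sel(1) times_dual_def)
    then have "standard (g a) * poly q x = poly p x" using poly pq(1,2) by simp
    then show ?thesis using pq(3) unfolding pq(4) by (simp add: nonzero_eq_divide_eq)
  qed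
  then show ?thesis using that[of g] g by blast
qed

text \<open>The homomorphism that fixes \<open>K\<close> and sends \<open>x\<close> to
  \<open>Dual x 1\<close> is extended to the whole complex field. Keeping the standard part equal to
  the identity makes the infinitesimal part a derivation.\<close>

lemma transcendental_derivation:
  assumes K: "is_subfield K" and x: "\<not> algebraic_over K x"
  obtains D where "derivation D" "\<And>a. a \<in> K \<Longrightarrow> D a = 0" "D x = 1"
proof -
  define f0 where "f0 a = Dual a 0" for a
  have f0: "partial_hom K f0"
    using K unfolding partial_hom_def f0_def by (simp add: dual_defs)
  have std0: "standard (f0 a) = a" for a by (simp add: f0_def)
  have trans: "eval_hom f r p = 0"
    if "partial_hom M f" "\<not> algebraic_over M y" "p \<in> polys_over M" "poly p y = 0"
    for M f y p and r :: dual
    using that eval_hom_0[OF that(1)] unfolding algebraic_over_def by metis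
  obtain g0 where g0: "partial_hom (adjoin K x) g0" "\<And>a. a \<in> K \<Longrightarrow> g0 a = f0 a" "g0 x = Dual x 1"
    "\<And>a. a \<in> adjoin K x \<Longrightarrow> standard (g0 a) = a"
    using dual_hom_adjoin[OF f0 std0, of x 1] trans[OF f0 x] by metis
  have step: "\<exists>N g. partial_hom N g \<and> M \<subseteq> N \<and> (\<forall>a\<in>M. g a = f a) \<and> (\<forall>a\<in>N. standard (g a) = a) \<and> y \<in> N"
    if f: "partial_hom M f" and std: "\<And>a. a \<in> M \<Longrightarrow> standard (f a) = a" for M f y
  proof -
    note M = partial_hom_subfield[OF f]
    have "\<exists>u. \<forall>p\<in>polys_over M. poly p y = 0 \<longrightarrow> eval_hom f (Dual y u) p = 0"
    proof (cases "algebraic_over M y")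
      case True
      then obtain P where P: "is_min_poly M y P" using min_poly_exists[OF M] by blast
      then have PM: "P \<in> polys_over M" "poly P y = 0" unfolding is_min_poly_def by auto
      \<comment> \<open>Vanishing of the infinitesimal part of the evaluated \<open>P\<close> is a
        linear equation for \<open>u\<close>; separability makes it solvable.\<close>
      define u where "u = - poly (map_poly (\<lambda>a. infinitesimal (f a)) P) y / poly (pderiv P) y"
      have "eval_hom f (Dual y u) P = 0"
        using PM min_poly_pderiv[OF M P]
        by (simp add: eval_hom_dual[OF f std] u_def dual_defs)
      moreover have "eval_hom f (Dual y u) p = eval_hom f (Dual y u) a * eval_hom f (Dual y u) P"
        if "a \<in> polys_over M" "p = a * P" for p a
        using that PM by (simp add: eval_hom_mult[OF f])
      ultimately have "\<forall>p\<in>polys_over M. poly p y = 0 \<longrightarrow> eval_hom f (Dual y u) p = 0"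
        using P unfolding is_min_poly_def by (metis mult_zero_right)
      then show ?thesis by blast
    next
      case False
      then show ?thesis using trans[OF f False] by blast
    qed
    then obtain u where "\<And>p. p \<in> polys_over M \<Longrightarrow> poly p y = 0 \<Longrightarrow> eval_hom f (Dual y u) p = 0"
      by blast
    then obtain g where "partial_hom (adjoin M y) g" "\<And>a. a \<in> M \<Longrightarrow> g a = f a"
      "\<And>a. a \<in> adjoin M y \<Longrightarrow> standard (g a) = a"
      using dual_hom_adjoin[OF f std, of y u] by metis
    then show ?thesis using subset_adjoin[OF M] generator_in_adjoin[OF M] by blast
  qed
  obtain g where g: "partial_hom UNIV g" "\<And>a. a \<in> adjoin K x \<Longrightarrow> g a = g0 a" "\<And>a. standard (g a) = a"
  proof (rule partial_hom_total[OF g0(1), of "\<lambda>a r. standard r = a"])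
    show "standard (g0 a) = a" if "a \<in> adjoin K x" for a using g0(4) that .
  qed (use step in auto)
  define D where "D a = infinitesimal (g a)" for a
  have "derivation D"
    unfolding derivation_def D_def
    using partial_hom_add[OF g(1)] partial_hom_mult[OF g(1)] g(3)
    by (simp add: plus_dual_def times_dual_def)
  moreover have "D a = 0" if "a \<in> K" for a
    using g(2)[of a] g0(2)[OF that] subsetD[OF subset_adjoin[OF K, of x] that] by (simp add: D_def f0_def)
  moreover have "D x = 1"
    using g(2)[of x] g0(3) generator_in_adjoin[OF K] by (simp add: D_def)
  ultimately show ?thesis using that by blast
qed

lemma derivation_algebraic:
  assumes K: "is_subfield K" and x: "algebraic_over K x"
    and D: "derivation D" "\<And>a. a \<in> K \<Longrightarrow> D a = 0"
  shows "D x = 0"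
proof -
  obtain P where P: "is_min_poly K x P" using min_poly_exists[OF K x] .
  then have PK: "P \<in> polys_over K" "poly P x = 0" unfolding is_min_poly_def by auto
  have "map_poly D P = 0"
    using PK D by (intro poly_eqI) (simp add: coeff_map_poly polys_overD)
  then have "poly (pderiv P) x * D x = 0"
    using derivation_poly[OF D(1), of P x] PK(2) D(1) by simp
  then show ?thesis using min_poly_pderiv[OF K P] by simp
qed

theorem dcl_eq_algebraic:
  assumes "is_subfield K"
  shows "dcl K = {x. algebraic_over K x}"
proof (intro subset_antisym subsetI)
  fix x assume x: "x \<in> dcl K"
  show "x \<in> {x. algebraic_over K x}"
  proof (rule ccontr)
    assume "x \<notin> {x. algebraic_over K x}"
    then obtain D where "derivation D" "\<And>a. a \<in> K \<Longrightarrow> D a = 0" "D x = 1"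
      using transcendental_derivation[OF assms] by blast
    then show False using dclD[OF x] by fastforce
  qed
next
  fix x assume "x \<in> {x. algebraic_over K x}"
  then show "x \<in> dcl K" using derivation_algebraic[OF assms, of x] by (simp add: dcl_def)
qed

text \<open>List polynomials carry the leading coefficient first, the type of polynomials the
  constant one; hence \<open>rev\<close>.\<close>

lemma eval_ring_of_type_algebra: "ring.eval \<CC> p x = poly (Poly (rev p)) x"
proof -
  interpret field \<CC> by (rule field_from_type_algebra)
  have pow: "x [^]\<^bsub>\<CC>\<^esub> (n::nat) = x ^ n" for n
    by (induction n) (auto simp: ring_of_type_algebra_def)
  show ?thesis
  proof (induction p)
    case Nil
    then show ?case by simp (simp add: ring_of_type_algebra_def)
  next
    case (Cons a p)
    then show ?case
      by (simp add: pow Poly_snoc poly_monom) (simp add: ring_of_type_algebra_def)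
  qed
qed

lemma cx_alg_closure_eq:
  assumes K: "is_subfield K"
  shows "cx_alg_closure K = dcl K"
proof -
  interpret field \<CC> by (rule field_from_type_algebra)
  have z: "\<zero>\<^bsub>\<CC>\<^esub> = 0" and carr: "carrier \<CC> = UNIV" by (auto simp: ring_of_type_algebra_def)
  have R: "subring K \<CC>" using K is_subfield_iff subfieldE(1) by blast
  have "(\<not> transcendental K x) = algebraic_over K x" for x
  proof
    assume "\<not> transcendental K x"
    then obtain p where p: "p \<in> carrier (K[X]\<^bsub>\<CC>\<^esub>)" "p \<noteq> []" "eval p x = 0"
      using algebraicE[OF R, of x] by (auto simp: over_def carr z)
    then have pK: "set p \<subseteq> K" and hd: "hd p \<noteq> 0"
      by (auto simp: univ_poly_carrier[symmetric] polynomial_def z)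
    have "Polynomial.coeff (Poly (rev p)) (length p - 1) = hd p"
      using p(2) by (simp add: nth_default_def rev_nth hd_conv_nth)
    then have "Poly (rev p) \<noteq> 0" using hd by force
    moreover have "Poly (rev p) \<in> polys_over K"
      using pK is_subfield_0[OF K] by (auto simp: polys_over_def nth_default_def rev_nth)
    ultimately show "algebraic_over K x"
      using p(3) unfolding algebraic_over_def eval_ring_of_type_algebra by blast
  next
    assume "algebraic_over K x"
    then obtain p where p: "p \<in> polys_over K" "p \<noteq> 0" "poly p x = 0" unfolding algebraic_over_def by blast
    have "set (rev (coeffs p)) \<subseteq> K"
      using p(1) unfolding polys_over_def by (auto simp: coeffs_def)
    moreover have "hd (rev (coeffs p)) \<noteq> 0"
      using p(2) by (simp add: hd_rev last_coeffs_eq_coeff_degree)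
    ultimately have "rev (coeffs p) \<in> carrier (K[X]\<^bsub>\<CC>\<^esub>)"
      by (simp add: univ_poly_carrier[symmetric] polynomial_def z)
    moreover have "eval (rev (coeffs p)) x = 0"
      using p(3) by (simp add: eval_ring_of_type_algebra)
    ultimately show "\<not> transcendental K x"
      using algebraicI[of "rev (coeffs p)" K x] p(2) by (simp add: z over_def)
  qed
  then show ?thesis unfolding cx_alg_closure_def dcl_eq_algebraic[OF K] by blast
qed

lemma cx_alg_closure_generate_field: "cx_alg_closure (generate_field \<CC> S) = dcl S"
  by (simp add: cx_alg_closure_eq is_subfield_generate_field dcl_generate_field)

text \<open>An annihilating polynomial has finitely many nonzero coefficients, and each of them
  already lies in a field generated by finitely many elements of \<open>S\<close>.\<close>

lemma dcl_finite_character: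
  assumes "x \<in> dcl S"
  obtains T where "T \<subseteq> S" "finite T" "x \<in> dcl T"
proof -
  have "algebraic_over (generate_field \<CC> S) x"
    using assms dcl_eq_algebraic[OF is_subfield_generate_field, of S] by (auto simp: dcl_generate_field)
  then obtain p where p: "p \<in> polys_over (generate_field \<CC> S)" "p \<noteq> 0" "poly p x = 0"
    unfolding algebraic_over_def by blast
  have "\<exists>T\<subseteq>S. finite T \<and> coeff p i \<in> generate_field \<CC> T" for i
    using generate_field_finite_character polys_overD[OF p(1)] by blast
  then obtain T where T: "\<And>i. T i \<subseteq> S \<and> finite (T i) \<and> coeff p i \<in> generate_field \<CC> (T i)"
    by metis
  define U where "U = (\<Union>i\<le>degree p. T i)"
  note F = is_subfield_generate_field[of U]
  have "coeff p i \<in> generate_field \<CC> U" for i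
  proof (cases "i \<le> degree p")
    case True
    then have "generate_field \<CC> (T i) \<subseteq> generate_field \<CC> U"
      by (intro generate_field_least F) (auto simp: U_def intro: generate_field.incl)
    then show ?thesis using T by blast
  qed (use is_subfield_0[OF F] in \<open>simp add: coeff_eq_0\<close>)
  then have "algebraic_over (generate_field \<CC> U) x"
    using p unfolding algebraic_over_def polys_over_def by blast
  then have "x \<in> dcl U" using dcl_eq_algebraic[OF F] by (auto simp: dcl_generate_field)
  moreover have "U \<subseteq> S" "finite U" using T by (auto simp: U_def)
  ultimately show ?thesis using that by blast
qed

section \<open>Automorphisms over a subfield\<close>

definition automorphism_over :: "complex set \<Rightarrow> (complex \<Rightarrow> complex) \<Rightarrow> bool" where
  "automorphism_over K \<sigma> \<longleftrightarrow> partial_hom UNIV \<sigma> \<and> bij \<sigma> \<and> (\<forall>a\<in>K. \<sigma> a = a)"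

lemma eval_hom_id: "eval_hom (\<lambda>a. a) x p = poly p x"
  by (simp add: eval_hom_def map_poly_idI)

lemma partial_hom_inj:
  fixes f :: "complex \<Rightarrow> complex"
  assumes "partial_hom M f"
  shows "inj_on f M"
proof (rule inj_onI, rule ccontr)
  fix x y assume xy: "x \<in> M" "y \<in> M" "f x = f y" "x \<noteq> y"
  note M = partial_hom_subfield[OF assms]
  have d: "x - y \<in> M" "inverse (x - y) \<in> M" using xy M by (auto intro: is_subfield_intros)
  have "f (x - y + y) = f (x - y) + f y" by (rule partial_hom_add[OF assms d(1) xy(2)])
  then have "f (x - y) = 0" using xy(3) by simp
  then have "f ((x - y) * inverse (x - y)) = 0" using partial_hom_mult[OF assms d] by simp
  then show False using xy(4) partial_hom_1[OF assms] by simp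
qed

lemma automorphism_root:
  assumes \<sigma>: "partial_hom UNIV \<sigma>" "\<And>a. a \<in> K \<Longrightarrow> \<sigma> a = a" and p: "p \<in> polys_over K"
  shows "\<sigma> (poly p x) = poly p (\<sigma> x)"
proof -
  have "map_poly \<sigma> p = p"
    using p \<sigma>(2) by (intro poly_eqI) (simp add: coeff_map_poly partial_hom_0[OF \<sigma>(1)] polys_overD)
  then show ?thesis using partial_hom_poly[OF \<sigma>(1), of p x] by (simp add: polys_over_def eval_hom_def)
qed

text \<open>An injective map that fixes \<open>K\<close> permutes the finite root set of every
  nonzero polynomial over \<open>K\<close>; as every number is such a root, the map is onto.\<close>

lemma total_hom_automorphism:
  fixes \<sigma> :: "complex \<Rightarrow> complex"
  assumes alg: "\<And>y. algebraic_over K y" and \<sigma>: "partial_hom UNIV \<sigma>" "\<And>a. a \<in> K \<Longrightarrow> \<sigma> a = a"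
  shows "automorphism_over K \<sigma>"
proof -
  have inj: "inj \<sigma>" using partial_hom_inj[OF \<sigma>(1)] .
  have "y \<in> range \<sigma>" for y
  proof -
    obtain p where p: "p \<in> polys_over K" "p \<noteq> 0" "poly p y = 0"
      using alg[of y] unfolding algebraic_over_def by blast
    define R where "R = {x. poly p x = 0}"
    have "finite R" unfolding R_def using p(2) by (rule poly_roots_finite)
    moreover have "\<sigma> ` R \<subseteq> R"
      using automorphism_root[OF \<sigma> p(1)] partial_hom_0[OF \<sigma>(1)] unfolding R_def by (metis (mono_tags, lifting) image_subset_iff mem_Collect_eq)
    moreover have "inj_on \<sigma> R" using inj by (rule inj_on_subset) simp
    ultimately have "\<sigma> ` R = R" by (metis endo_inj_surj)
    moreover have "y \<in> R" using p(3) by (simp add: R_def)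
    ultimately show ?thesis by blast
  qed
  then show ?thesis using \<sigma> inj unfolding automorphism_over_def bij_def by blast
qed

text \<open>The fixed field of the automorphisms over \<open>K\<close> is \<open>K\<close>: a minimal polynomial of degree at
  least two is separable, so it has a second root to which \<open>z\<close> can be sent.\<close>

lemma automorphism_moving:
  assumes K: "is_subfield K" and alg: "\<And>y. algebraic_over K y" and z: "z \<notin> K"
  obtains \<sigma> where "automorphism_over K \<sigma>" "\<sigma> z \<noteq> z"
proof -
  obtain P where P: "is_min_poly K z P" using min_poly_exists[OF K alg] .
  then have PK: "P \<in> polys_over K" "P \<noteq> 0" "poly P z = 0" unfolding is_min_poly_def by auto
  obtain Q where Q: "P = [:- z, 1:] * Q" using PK(3) by (metis poly_eq_0_iff_dvd dvdE)
  have "degree Q \<noteq> 0"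
  proof
    assume "degree Q = 0"
    then obtain c where c: "Q = [:c:]" by (metis degree_eq_zeroE)
    then have "P = [:- (z * c), c:]" using Q by simp
    then have "c \<in> K" "- (z * c) \<in> K" "c \<noteq> 0"
      using polys_overD[OF PK(1), of 0] polys_overD[OF PK(1), of 1] PK(2) by auto
    then have "- (- (z * c)) / c \<in> K" by (metis is_subfield_divide[OF K] is_subfield_minus[OF K])
    then show False using z \<open>c \<noteq> 0\<close> by simp
  qed
  then obtain w where w: "poly Q w = 0"
    using fundamental_theorem_of_algebra_alt[of Q] by (metis degree_pCons_0)
  have "w \<noteq> z"
  proof
    assume "w = z"
    then have "poly (pderiv P) z = 0" using w by (simp add: Q pderiv_mult pderiv_pCons del: mult_pCons_left)
    then show False using min_poly_pderiv[OF K P] by simp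
  qed
  have id: "partial_hom K (\<lambda>a. a)" using K by (simp add: partial_hom_def)
  have "eval_hom (\<lambda>a. a) w P = 0" using w by (simp add: eval_hom_id Q)
  then obtain g where g: "partial_hom (adjoin K z) g" "\<And>a. a \<in> K \<Longrightarrow> g a = a" "g z = w"
    using partial_hom_adjoin_algebraic[OF id P] by metis
  have step: "\<exists>N h. partial_hom N h \<and> M \<subseteq> N \<and> (\<forall>a\<in>M. h a = f a) \<and> (\<forall>a\<in>N. True) \<and> y \<in> N"
    if M: "partial_hom M f" "adjoin K z \<subseteq> M" for M y and f :: "complex \<Rightarrow> complex"
  proof -
    note MS = partial_hom_subfield[OF M(1)]
    have "algebraic_over M y"
      using alg[of y] M(2) subset_adjoin[OF K, of z] unfolding algebraic_over_def polys_over_def by blast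
    then obtain R where R: "is_min_poly M y R" using min_poly_exists[OF MS] by blast
    \<comment> \<open>Injectivity keeps the leading coefficient nonzero, so the transported minimal
      polynomial is not constant and has a root.\<close>
    have "f a = 0 \<longleftrightarrow> a = 0" if "a \<in> M" for a
      using partial_hom_inj[OF M(1)] that partial_hom_0[OF M(1)] is_subfield_0[OF MS]
      by (metis inj_onD)
    then have "f (lead_coeff R) \<noteq> 0"
      using R polys_overD[of R M] unfolding is_min_poly_def by auto
    then have "degree (map_poly f R) = degree R"
      by (rule map_poly_degree_eq)
    then obtain r where "poly (map_poly f R) r = 0"
      using fundamental_theorem_of_algebra_alt[of "map_poly f R"] min_poly_degree_pos[OF R]
      by (metis degree_pCons_0 less_irrefl)
    then have "eval_hom f r R = 0" by (simp add: eval_hom_def)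
    then obtain h where "partial_hom (adjoin M y) h" "\<And>a. a \<in> M \<Longrightarrow> h a = f a"
      using partial_hom_adjoin_algebraic[OF M(1) R] by metis
    then show ?thesis using subset_adjoin[OF MS] generator_in_adjoin[OF MS] by blast
  qed
  obtain \<sigma> where \<sigma>: "partial_hom UNIV \<sigma>" "\<And>a. a \<in> adjoin K z \<Longrightarrow> \<sigma> a = g a"
    by (rule partial_hom_total[OF g(1), of "\<lambda>_ _. True"]) (use step in auto)
  have "automorphism_over K \<sigma>"
    using \<sigma> g(2) subset_adjoin[OF K, of z] by (intro total_hom_automorphism[OF alg]) auto
  moreover have "\<sigma> z \<noteq> z" using \<sigma>(2) generator_in_adjoin[OF K] g(3) \<open>w \<noteq> z\<close> by simp
  ultimately show ?thesis using that by blast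
qed

section \<open>Relations between logarithmic derivatives\<close>

text \<open>If \<open>D\<close> killed \<open>t\<close> but not \<open>z\<close>, subtracting from
  \<open>D'\<close> the multiple of \<open>D\<close> with the same value at \<open>z\<close> would
  give a derivation that kills \<open>z\<close> and \<open>K\<close> and still moves
  \<open>t\<close>.\<close>

lemma dcl_exchange:
  assumes "t \<in> dcl (insert z K)" "t \<notin> dcl K"
  shows "z \<in> dcl (insert t K)"
proof (rule dclI)
  fix D assume D: "derivation D" "\<And>s. s \<in> insert t K \<Longrightarrow> D s = 0"
  obtain D' where D': "derivation D'" "\<And>s. s \<in> K \<Longrightarrow> D' s = 0" "D' t \<noteq> 0"
    using assms(2) unfolding dcl_def by blast
  show "D z = 0"
  proof (rule ccontr)
    assume z: "D z \<noteq> 0"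
    define E where "E x = D' x - (D' z / D z) * D x" for x
    have "derivation E"
      unfolding E_def by (intro derivation_subtract derivation_scale D D')
    moreover have "E s = 0" if "s \<in> insert z K" for s
      using that D D' z by (auto simp: E_def)
    ultimately have "E t = 0" using dclD[OF assms(1)] by blast
    then show False using D(2)[of t] D'(3) by (simp add: E_def)
  qed
qed

text \<open>When \<open>k\<close> is maximal among the closed sets that miss \<open>t\<close>,
  adjoining any further \<open>z\<close> captures \<open>t\<close>, and by exchange \<open>z\<close>
  is algebraic over \<open>k\<close> and \<open>t\<close>. Everything is thus reduced to one
  transcendental element, and derivations over \<open>k\<close> are determined by their value at
  it.\<close>

lemma maximal_closed_avoiding:
  assumes C: "dcl C = C" and t: "t \<notin> C"
  obtains k where "C \<subseteq> k" "dcl k = k" "t \<notin> k" "dcl (insert t k) = UNIV"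
proof -
  define \<A> where "\<A> = {k. C \<subseteq> k \<and> dcl k = k \<and> t \<notin> k}"
  have "\<A> \<noteq> {}" using C t unfolding \<A>_def by blast
  moreover have "\<Union>\<C> \<in> \<A>" if ne: "\<C> \<noteq> {}" and chain: "subset.chain \<A> \<C>" for \<C>
  proof -
    have CA: "\<C> \<subseteq> \<A>" using chain unfolding subset_chain_def by blast
    have "dcl (\<Union>\<C>) \<subseteq> \<Union>\<C>"
    proof
      fix x assume "x \<in> dcl (\<Union>\<C>)"
      then obtain T where T: "T \<subseteq> \<Union>\<C>" "finite T" "x \<in> dcl T" by (rule dcl_finite_character)
      obtain k where "k \<in> \<C>" "T \<subseteq> k"
        using finite_subset_Union_chain[OF T(2,1) ne chain] by blast
      then show "x \<in> \<Union>\<C>" using dcl_mono[of T k] T(3) CA unfolding \<A>_def by blast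
    qed
    then have "dcl (\<Union>\<C>) = \<Union>\<C>" using dcl_superset by blast
    then show ?thesis using CA ne unfolding \<A>_def by blast
  qed
  ultimately obtain k where k: "k \<in> \<A>" and max: "\<And>l. l \<in> \<A> \<Longrightarrow> k \<subseteq> l \<Longrightarrow> l = k"
    using subset_Zorn_nonempty[of \<A>] by blast
  have k': "C \<subseteq> k" "dcl k = k" "t \<notin> k" using k unfolding \<A>_def by auto
  have "z \<in> dcl (insert t k)" for z
  proof (cases "z \<in> k")
    case True
    then show ?thesis using dcl_superset[of "insert t k"] by blast
  next
    case False
    let ?l = "dcl (insert z k)"
    have "k \<subseteq> ?l" "z \<in> ?l" using dcl_superset[of "insert z k"] by auto
    then have "?l \<notin> \<A>" using max[of ?l] False by blast
    then have "t \<in> ?l" using \<open>k \<subseteq> ?l\<close> k'(1) unfolding \<A>_def by (auto simp: dcl_idem)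
    then show ?thesis using dcl_exchange[of t z k] k' by simp
  qed
  then show ?thesis using that k' by blast
qed

section \<open>Homomorphisms into fields, automorphisms over \<open>k(t)\<close>\<close>

lemma partial_hom_inverse:
  fixes f :: "complex \<Rightarrow> 'r::field"
  assumes f: "partial_hom M f" and a: "a \<in> M"
  shows "f (inverse a) = inverse (f a)"
proof (cases "a = 0")
  case True
  then show ?thesis by (simp add: partial_hom_0[OF f])
next
  case False
  have "f a * f (inverse a) = 1"
    using partial_hom_mult[OF f a is_subfield_inverse[OF partial_hom_subfield[OF f] a]] False
      partial_hom_1[OF f] by simp
  then show ?thesis by (metis inverse_unique)
qed

lemma partial_hom_divide:
  fixes f :: "complex \<Rightarrow> 'r::field"
  assumes "partial_hom M f" "a \<in> M" "b \<in> M"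
  shows "f (a / b) = f a / f b"
  using assms partial_hom_mult[OF assms(1,2), of "inverse b"]
  by (simp add: partial_hom_inverse divide_inverse is_subfield_inverse[OF partial_hom_subfield])

lemma partial_hom_prod:
  assumes f: "partial_hom UNIV f"
  shows "f (\<Prod>i\<in>I. g i) = (\<Prod>i\<in>I. f (g i))"
  by (induction I rule: infinite_finite_induct)
    (auto simp: partial_hom_1[OF f] partial_hom_mult[OF f])

lemma partial_hom_nonzero:
  fixes f :: "complex \<Rightarrow> 'r::field"
  assumes f: "partial_hom M f" and a: "a \<in> M" "a \<noteq> 0"
  shows "f a \<noteq> 0"
proof -
  have "f a * f (inverse a) = 1"
    using partial_hom_mult[OF f a(1) is_subfield_inverse[OF partial_hom_subfield[OF f] a(1)]] a(2)
      partial_hom_1[OF f] by simp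
  then show ?thesis by auto
qed

lemma automorphism_over_comp:
  assumes "automorphism_over K \<sigma>" "automorphism_over K \<rho>"
  shows "automorphism_over K (\<sigma> \<circ> \<rho>)"
  using assms unfolding automorphism_over_def partial_hom_def by (auto intro: bij_comp)

lemma automorphism_over_id: "automorphism_over K id"
  unfolding automorphism_over_def partial_hom_def is_subfield_def by simp

text \<open>Conjugating \<open>\<delta>\<close> by \<open>\<sigma>\<close> gives a derivation with
  the same values on \<open>k\<close> and at \<open>t\<close>, and these values determine a
  derivation because \<open>dcl (insert t k)\<close> is everything.\<close>

lemma automorphism_derivation_commute:
  assumes \<delta>: "derivation \<delta>" "\<And>a. a \<in> k \<Longrightarrow> \<delta> a = 0" "\<delta> t = 1"
    and gen: "dcl (insert t k) = UNIV" and \<sigma>: "automorphism_over (adjoin k t) \<sigma>" and k: "is_subfield k"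
  shows "\<sigma> (\<delta> x) = \<delta> (\<sigma> x)"
proof -
  have hom: "partial_hom UNIV \<sigma>" and bij: "bij \<sigma>" and fixed: "\<And>a. a \<in> adjoin k t \<Longrightarrow> \<sigma> a = a"
    using \<sigma> unfolding automorphism_over_def by auto
  define \<tau> where "\<tau> = inv_into UNIV \<sigma>"
  have \<sigma>\<tau>: "\<sigma> (\<tau> x) = x" and \<tau>\<sigma>: "\<tau> (\<sigma> x) = x" for x
    using bij unfolding \<tau>_def by (auto simp: bij_is_surj bij_is_inj surj_f_inv_f)
  have add: "\<sigma> (x + y) = \<sigma> x + \<sigma> y" and mult: "\<sigma> (x * y) = \<sigma> x * \<sigma> y" for x y
    using partial_hom_add[OF hom] partial_hom_mult[OF hom] by auto
  have \<tau>add: "\<tau> (x + y) = \<tau> x + \<tau> y" and \<tau>mult: "\<tau> (x * y) = \<tau> x * \<tau> y" for x y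
    by (metis \<sigma>\<tau> \<tau>\<sigma> add) (metis \<sigma>\<tau> \<tau>\<sigma> mult)
  define E where "E x = \<tau> (\<delta> (\<sigma> x)) - \<delta> x" for x
  have "derivation (\<lambda>x. \<tau> (\<delta> (\<sigma> x)))"
    unfolding derivation_def
    by (simp add: add mult derivation_add[OF \<delta>(1)] derivation_mult[OF \<delta>(1)] \<tau>add \<tau>mult \<tau>\<sigma>)
  then have "derivation E" unfolding E_def by (intro derivation_subtract \<delta>(1))
  moreover have "E a = 0" if "a \<in> insert t k" for a
  proof -
    have "\<sigma> a = a" using fixed that subset_adjoin[OF k, of t] generator_in_adjoin[OF k, of t] by auto
    moreover have "\<tau> 0 = 0" "\<tau> 1 = 1"
      using \<tau>\<sigma>[of 0] \<tau>\<sigma>[of 1] partial_hom_0[OF hom] partial_hom_1[OF hom] by auto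
    ultimately show ?thesis using that \<delta> by (auto simp: E_def)
  qed
  ultimately have "E x = 0" using dclD[of x "insert t k" E] gen by auto
  then show ?thesis by (metis E_def \<sigma>\<tau> eq_iff_diff_eq_0)
qed

text \<open>Expansion at \<open>t = 0\<close>. As \<open>k\<close> is closed, \<open>t\<close> is
  transcendental over it, so nonzero polynomials in \<open>t\<close> go to nonzero series. That
  \<open>\<delta>\<close> becomes the formal derivative is checked on polynomials and carried to
  fractions by the product rule.\<close>

lemma laurent_embedding:
  assumes k: "is_subfield k" "dcl k = k" "t \<notin> k"
    and \<delta>: "derivation \<delta>" "\<And>a. a \<in> k \<Longrightarrow> \<delta> a = 0" "\<delta> t = 1"
  obtains \<Phi> :: "complex \<Rightarrow> complex fls" where "partial_hom (adjoin k t) \<Phi>"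
    "\<And>a. a \<in> k \<Longrightarrow> \<Phi> a = fls_const a" "\<Phi> t = fls_X"
    "\<And>f. f \<in> adjoin k t \<Longrightarrow> \<delta> f \<in> adjoin k t \<and> \<Phi> (\<delta> f) = fls_deriv (\<Phi> f)"
proof -
  have trans: "p = 0" if "p \<in> polys_over k" "poly p t = 0" for p
    using that k dcl_eq_algebraic[OF k(1)] unfolding algebraic_over_def by blast
  have const: "partial_hom k (fls_const :: complex \<Rightarrow> complex fls)"
    using k(1) unfolding partial_hom_def by (auto simp: fls_plus_const fls_const_mult_const)
  have eval: "eval_hom fls_const fls_X p = fps_to_fls (fps_of_poly p)" for p :: "complex poly"
  proof (induction p)
    case (pCons c p)
    then show ?case
      by (simp add: eval_hom_pCons[OF const] fps_of_poly_pCons fls_times_fps_to_fls fps_to_fls_plus fls_X_times_conv_shift)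
  qed (simp add: eval_hom_0[OF const])
  have unit: "eval_hom fls_const fls_X p dvd 1" if "p \<in> polys_over k" "poly p t \<noteq> 0" for p
    using that by (auto simp: eval dvd_field_iff)
  obtain \<Phi> :: "complex \<Rightarrow> complex fls" where \<Phi>: "partial_hom (adjoin k t) \<Phi>"
    "\<And>a. a \<in> k \<Longrightarrow> \<Phi> a = fls_const a" "\<Phi> t = fls_X"
    using partial_hom_adjoin[OF const, of t fls_X] trans eval_hom_0[OF const] unit by metis
  note K = is_subfield_adjoin[OF k(1), of t]
  note kK = subsetD[OF subset_adjoin[OF k(1), of t]] and tK = generator_in_adjoin[OF k(1), of t]
  have poly: "poly p t \<in> adjoin k t \<and> \<delta> (poly p t) \<in> adjoin k t \<and>
      \<Phi> (\<delta> (poly p t)) = fls_deriv (\<Phi> (poly p t))" if "p \<in> polys_over k" for p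
    using that
  proof (induction p)
    case 0
    then show ?case
      using is_subfield_0[OF K] by (simp add: derivation_0[OF \<delta>(1)] partial_hom_0[OF \<Phi>(1)])
  next
    case (pCons c p)
    then have c: "c \<in> k" and "p \<in> polys_over k"
      using polys_overD[OF pCons.prems, of 0] polys_overD[OF pCons.prems, of "Suc _"]
      by (auto simp: polys_over_def)
    define f where "f = poly p t"
    have f: "f \<in> adjoin k t" "\<delta> f \<in> adjoin k t" "\<Phi> (\<delta> f) = fls_deriv (\<Phi> f)"
      using pCons.IH[OF \<open>p \<in> polys_over k\<close>] unfolding f_def by auto
    have m: "t * f \<in> adjoin k t" "t * \<delta> f \<in> adjoin k t"
      using f tK by (auto intro: is_subfield_mult[OF K])
    have d: "\<delta> (c + t * f) = t * \<delta> f + f"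
      using c \<delta> by (simp add: derivation_add derivation_mult)
    have "\<Phi> (c + t * f) = fls_const c + fls_X * \<Phi> f"
      using partial_hom_add[OF \<Phi>(1) kK[OF c] m(1)] partial_hom_mult[OF \<Phi>(1) tK f(1)] \<Phi>(2)[OF c] \<Phi>(3)
      by simp
    moreover have "\<Phi> (t * \<delta> f + f) = fls_X * \<Phi> (\<delta> f) + \<Phi> f"
      using partial_hom_add[OF \<Phi>(1) m(2) f(1)] partial_hom_mult[OF \<Phi>(1) tK f(2)] \<Phi>(3) by simp
    ultimately show ?case
      using d f m kK[OF c] is_subfield_add[OF K] by (simp add: f_def[symmetric] add.commute)
  qed
  have "\<delta> f \<in> adjoin k t \<and> \<Phi> (\<delta> f) = fls_deriv (\<Phi> f)" if "f \<in> adjoin k t" for f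
  proof -
    obtain p q where pq: "p \<in> polys_over k" "q \<in> polys_over k" "poly q t \<noteq> 0" "f = poly p t / poly q t"
      using \<open>f \<in> adjoin k t\<close> by (rule adjoinE)
    define P Q where "P = poly p t" and "Q = poly q t"
    have P: "P \<in> adjoin k t" "\<delta> P \<in> adjoin k t" "\<Phi> (\<delta> P) = fls_deriv (\<Phi> P)"
      and Q: "Q \<in> adjoin k t" "\<delta> Q \<in> adjoin k t" "\<Phi> (\<delta> Q) = fls_deriv (\<Phi> Q)" "Q \<noteq> 0"
      using poly[OF pq(1)] poly[OF pq(2)] pq(3) unfolding P_def Q_def by auto
    have fQ: "f * Q = P" using pq(4) Q(4) unfolding P_def Q_def by simp
    have df: "\<delta> f * Q = \<delta> P - f * \<delta> Q"
      using arg_cong[OF fQ, of \<delta>] derivation_mult[OF \<delta>(1), of f Q] by (simp add: algebra_simps)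
    then have "\<delta> f = (\<delta> P - f * \<delta> Q) / Q" using Q(4) by (simp add: field_simps)
    then have 1: "\<delta> f \<in> adjoin k t"
      using P Q \<open>f \<in> adjoin k t\<close>
      by (simp add: is_subfield_divide[OF K] is_subfield_diff[OF K] is_subfield_mult[OF K])
    have "\<Phi> (f * Q) = \<Phi> f * \<Phi> Q" by (rule partial_hom_mult[OF \<Phi>(1) that Q(1)])
    then have "fls_deriv (\<Phi> P) = fls_deriv (\<Phi> f) * \<Phi> Q + \<Phi> f * fls_deriv (\<Phi> Q)"
      unfolding fQ by simp
    moreover have "\<Phi> (\<delta> f * Q + f * \<delta> Q) = \<Phi> (\<delta> f) * \<Phi> Q + \<Phi> f * \<Phi> (\<delta> Q)"
      using partial_hom_add[OF \<Phi>(1) is_subfield_mult[OF K 1 Q(1)] is_subfield_mult[OF K that Q(2)]]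
        partial_hom_mult[OF \<Phi>(1) 1 Q(1)] partial_hom_mult[OF \<Phi>(1) that Q(2)] by simp
    moreover have "\<delta> f * Q + f * \<delta> Q = \<delta> P" using df by simp
    ultimately have "\<Phi> (\<delta> f) * \<Phi> Q = fls_deriv (\<Phi> f) * \<Phi> Q" using P(3) Q(3) by auto
    moreover have "\<Phi> Q \<noteq> 0" by (rule partial_hom_nonzero[OF \<Phi>(1) Q(1,4)])
    ultimately show ?thesis using 1 by simp
  qed
  then show ?thesis using that[of \<Phi>] \<Phi> by blast
qed

text \<open>If some \<open>y b\<close> were outside \<open>C\<close>, enlarge \<open>C\<close> to \<open>k\<close> so that the complex field becomes algebraic over \<open>k(y b)\<close>.
  Norms and traces over the automorphisms move the relation to \<open>k(y b)\<close>, where residues at zero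
  contradict the rational independence of the coefficients.\<close>

theorem log_derivative_relation:
  assumes C: "dcl C = C" and B: "finite B" "B \<subseteq> C"
    and indep: "\<And>q :: complex \<Rightarrow> rat. (\<Sum>b\<in>B. of_rat (q b) * b) = 0 \<Longrightarrow> \<forall>b\<in>B. q b = 0"
    and y: "\<And>b. b \<in> B \<Longrightarrow> y b \<noteq> 0"
    and rel: "\<And>D. derivation D \<Longrightarrow> (\<And>c. c \<in> C \<Longrightarrow> D c = 0) \<Longrightarrow> (\<Sum>b\<in>B. b * (D (y b) / y b)) = D w"
    and b0: "b0 \<in> B"
  shows "y b0 \<in> C"
proof (rule ccontr)
  define t where "t = y b0"
  assume "y b0 \<notin> C"
  then obtain k where k: "C \<subseteq> k" "dcl k = k" "t \<notin> k" "dcl (insert t k) = UNIV"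
    using maximal_closed_avoiding[OF C, of t] unfolding t_def by blast
  have ks: "is_subfield k" using is_subfield_dcl[of k] k(2) by simp
  have "t \<notin> dcl k" using k by simp
  then obtain D0 where D0: "derivation D0" "\<And>a. a \<in> k \<Longrightarrow> D0 a = 0" "D0 t \<noteq> 0"
    unfolding dcl_def by blast
  define \<delta> where "\<delta> x = (1 / D0 t) * D0 x" for x
  have \<delta>: "derivation \<delta>" "\<And>a. a \<in> k \<Longrightarrow> \<delta> a = 0" "\<delta> t = 1"
    using derivation_scale[OF D0(1), of "1 / D0 t"] D0(2,3) unfolding \<delta>_def by auto
  define K where "K = adjoin k t"
  have K: "is_subfield K" unfolding K_def by (rule is_subfield_adjoin[OF ks])
  have kK: "k \<subseteq> K" and tK: "t \<in> K"
    unfolding K_def using subset_adjoin[OF ks] generator_in_adjoin[OF ks] by auto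
  have "dcl K = UNIV" using dcl_mono[of "insert t k" K] k(4) kK tK by auto
  then have alg: "algebraic_over K x" for x using dcl_eq_algebraic[OF K] by auto

  define S where "S = insert w (y ` B)"
  have S: "finite S" using B(1) by (simp add: S_def)
  \<comment> \<open>The group of automorphisms may be infinite, but only its action on the finitely
    many numbers in the relation matters. There each image is a root of a fixed polynomial, so
    finitely many restrictions remain.\<close>
  define orb where "orb = {restrict \<sigma> S | \<sigma>. automorphism_over K \<sigma>}"
  have orb_E: "\<exists>\<sigma>. automorphism_over K \<sigma> \<and> r = restrict \<sigma> S" if "r \<in> orb" for r
    using that unfolding orb_def by blast
  have fin: "finite orb"
  proof -
    have "\<forall>x. \<exists>p. p \<in> polys_over K \<and> p \<noteq> 0 \<and> poly p x = 0" using alg unfolding algebraic_over_def by blast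
    then obtain P where P: "\<And>x. P x \<in> polys_over K \<and> P x \<noteq> 0 \<and> poly (P x) x = 0" by metis
    have "orb \<subseteq> (\<Pi>\<^sub>E x\<in>S. {z. poly (P x) z = 0})"
    proof
      fix r assume "r \<in> orb"
      then obtain \<sigma> where \<sigma>: "automorphism_over K \<sigma>" "r = restrict \<sigma> S" using orb_E by blast
      then have h: "partial_hom UNIV \<sigma>" "\<And>a. a \<in> K \<Longrightarrow> \<sigma> a = a" unfolding automorphism_over_def by auto
      have "poly (P x) (\<sigma> x) = 0" for x
        using automorphism_root[of \<sigma> K "P x" x] h P[of x] partial_hom_0[OF h(1)] by simp
      then show "r \<in> (\<Pi>\<^sub>E x\<in>S. {z. poly (P x) z = 0})" using \<sigma>(2) by simp
    qed
    moreover have "finite (\<Pi>\<^sub>E x\<in>S. {z. poly (P x) z = 0})"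
      using P S by (intro finite_PiE) (auto intro: poly_roots_finite)
    ultimately show ?thesis by (rule finite_subset)
  qed
  have "orb \<noteq> {}" using automorphism_over_id unfolding orb_def by blast
  have perm: "bij_betw (\<lambda>r. restrict (\<rho> \<circ> r) S) orb orb" if \<rho>: "automorphism_over K \<rho>" for \<rho>
  proof -
    have into: "(\<lambda>r. restrict (\<rho> \<circ> r) S) ` orb \<subseteq> orb"
    proof clarify
      fix r assume "r \<in> orb"
      then obtain \<sigma> where \<sigma>: "automorphism_over K \<sigma>" "r = restrict \<sigma> S" using orb_E by blast
      then have "restrict (\<rho> \<circ> r) S = restrict (\<rho> \<circ> \<sigma>) S" by (auto simp: restrict_def)
      then show "restrict (\<rho> \<circ> r) S \<in> orb" using automorphism_over_comp[OF \<rho> \<sigma>(1)] unfolding orb_def by auto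
    qed
    have inj: "inj_on (\<lambda>r. restrict (\<rho> \<circ> r) S) orb"
    proof (rule inj_onI)
      fix r s assume rs: "r \<in> orb" "s \<in> orb" "restrict (\<rho> \<circ> r) S = restrict (\<rho> \<circ> s) S"
      show "r = s"
      proof (rule extensionalityI[of _ S])
        show "r \<in> extensional S" "s \<in> extensional S" using rs(1,2) unfolding orb_def by auto
        fix x assume "x \<in> S"
        then have "\<rho> (r x) = \<rho> (s x)" using fun_cong[OF rs(3), of x] by simp
        then show "r x = s x" using \<rho> unfolding automorphism_over_def by (meson bij_is_inj injD)
      qed
    qed
    show ?thesis using endo_inj_surj[OF fin into inj] inj by (simp add: bij_betw_def)
  qed
  \<comment> \<open>Up to a power the norm of \<open>y b\<close>, and below, up to a multiple, the
    trace of \<open>w\<close>. An automorphism over \<open>K\<close> only permutes the factors and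
    summands, so both lie in the fixed field \<open>K\<close>.\<close>
  define Y where "Y b = (\<Prod>r\<in>orb. r (y b))" for b
  define W where "W = (\<Sum>r\<in>orb. r w)"
  have fixed: "x \<in> K" if "\<And>\<rho>. automorphism_over K \<rho> \<Longrightarrow> \<rho> x = x" for x
    using automorphism_moving[OF K alg, of x] that by metis
  have YK: "Y b \<in> K" if b: "b \<in> B" for b
  proof (rule fixed)
    fix \<rho> assume \<rho>: "automorphism_over K \<rho>"
    then have "\<rho> (Y b) = (\<Prod>r\<in>orb. restrict (\<rho> \<circ> r) S (y b))"
      using b partial_hom_prod[of \<rho>] unfolding Y_def automorphism_over_def S_def by simp
    also have "\<dots> = Y b"
      unfolding Y_def by (rule prod.reindex_bij_betw[OF perm[OF \<rho>]])
    finally show "\<rho> (Y b) = Y b" .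
  qed
  have WK: "W \<in> K"
  proof (rule fixed)
    fix \<rho> assume \<rho>: "automorphism_over K \<rho>"
    then have "\<rho> W = (\<Sum>r\<in>orb. restrict (\<rho> \<circ> r) S w)"
      using partial_hom_sum[of UNIV \<rho>] unfolding W_def automorphism_over_def S_def by simp
    also have "\<dots> = W"
      unfolding W_def by (rule sum.reindex_bij_betw[OF perm[OF \<rho>]])
    finally show "\<rho> W = W" .
  qed
  have rnz: "r (y b) \<noteq> 0" if "r \<in> orb" "b \<in> B" for r b
  proof -
    obtain \<sigma> where \<sigma>: "automorphism_over K \<sigma>" "r = restrict \<sigma> S" using orb_E \<open>r \<in> orb\<close> by blast
    then show ?thesis using partial_hom_nonzero[of UNIV \<sigma> "y b"] y that(2)
      unfolding automorphism_over_def S_def by simp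
  qed
  \<comment> \<open>An automorphism over \<open>K\<close> fixes the coefficients and commutes with
    \<open>\<delta>\<close>, so every conjugate of the relation holds; their sum is
    \<open>relK\<close>.\<close>
  have conj: "(\<Sum>b\<in>B. b * (\<delta> (r (y b)) / r (y b))) = \<delta> (r w)" if "r \<in> orb" for r
  proof -
    obtain \<sigma> where \<sigma>: "automorphism_over K \<sigma>" "r = restrict \<sigma> S" using orb_E \<open>r \<in> orb\<close> by blast
    then have h: "partial_hom UNIV \<sigma>" "\<And>a. a \<in> K \<Longrightarrow> \<sigma> a = a" unfolding automorphism_over_def by auto
    have comm: "\<sigma> (\<delta> x) = \<delta> (\<sigma> x)" for x
      using automorphism_derivation_commute[OF \<delta> k(4) _ ks] \<sigma>(1) unfolding K_def by blast
    have bK: "\<sigma> b = b" if "b \<in> B" for b using that h(2) B(2) k(1) kK by blast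
    have "(\<Sum>b\<in>B. b * (\<delta> (y b) / y b)) = \<delta> w" using rel \<delta> k(1) by blast
    then have "\<sigma> (\<Sum>b\<in>B. b * (\<delta> (y b) / y b)) = \<delta> (\<sigma> w)" using comm by simp
    moreover have "\<sigma> (\<Sum>b\<in>B. b * (\<delta> (y b) / y b)) = (\<Sum>b\<in>B. b * (\<delta> (\<sigma> (y b)) / \<sigma> (y b)))"
    proof (subst partial_hom_sum[OF h(1)])
      show "(\<Sum>b\<in>B. \<sigma> (b * (\<delta> (y b) / y b))) = (\<Sum>b\<in>B. b * (\<delta> (\<sigma> (y b)) / \<sigma> (y b)))"
        by (intro sum.cong refl)
          (simp add: partial_hom_mult[OF h(1)] partial_hom_divide[OF h(1)] bK comm del: times_divide_eq_right)
    qed simp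
    ultimately show ?thesis using \<sigma>(2) by (simp add: S_def)
  qed
  have relK: "(\<Sum>b\<in>B. b * (\<delta> (Y b) / Y b)) = \<delta> W"
  proof -
    have "(\<Sum>b\<in>B. b * (\<delta> (Y b) / Y b)) = (\<Sum>b\<in>B. b * (\<Sum>r\<in>orb. \<delta> (r (y b)) / r (y b)))"
      unfolding Y_def using rnz by (intro sum.cong refl) (simp add: derivation_prod[OF \<delta>(1) fin])
    also have "\<dots> = (\<Sum>r\<in>orb. \<Sum>b\<in>B. b * (\<delta> (r (y b)) / r (y b)))"
      unfolding sum_distrib_left by (rule sum.swap)
    also have "\<dots> = \<delta> W" using conj by (simp add: W_def derivation_sum[OF \<delta>(1)])
    finally show ?thesis .
  qed

  obtain \<Phi> :: "complex \<Rightarrow> complex fls" where \<Phi>: "partial_hom K \<Phi>"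
    "\<And>a. a \<in> k \<Longrightarrow> \<Phi> a = fls_const a" "\<Phi> t = fls_X"
    "\<And>f. f \<in> K \<Longrightarrow> \<delta> f \<in> K \<and> \<Phi> (\<delta> f) = fls_deriv (\<Phi> f)"
    using laurent_embedding[OF ks k(2,3) \<delta>] unfolding K_def by blast
  have summand: "\<delta> (Y b) / Y b \<in> K" "b * (\<delta> (Y b) / Y b) \<in> K"
    "\<Phi> (b * (\<delta> (Y b) / Y b)) = fls_const b * (fls_deriv (\<Phi> (Y b)) * inverse (\<Phi> (Y b)))"
    if b: "b \<in> B" for b
  proof -
    have bk: "b \<in> k" "b \<in> K" using b B(2) k(1) kK by auto
    have d: "\<delta> (Y b) \<in> K" "\<Phi> (\<delta> (Y b)) = fls_deriv (\<Phi> (Y b))" using \<Phi>(4)[OF YK[OF b]] by auto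
    show 1: "\<delta> (Y b) / Y b \<in> K" by (rule is_subfield_divide[OF K d(1) YK[OF b]])
    then show "b * (\<delta> (Y b) / Y b) \<in> K" by (rule is_subfield_mult[OF K bk(2)])
    show "\<Phi> (b * (\<delta> (Y b) / Y b)) = fls_const b * (fls_deriv (\<Phi> (Y b)) * inverse (\<Phi> (Y b)))"
      unfolding partial_hom_mult[OF \<Phi>(1) bk(2) 1] partial_hom_divide[OF \<Phi>(1) d(1) YK[OF b]] d(2) \<Phi>(2)[OF bk(1)]
      by (simp add: divide_inverse)
  qed
  have "fls_deriv (\<Phi> W) = \<Phi> (\<Sum>b\<in>B. b * (\<delta> (Y b) / Y b))" using \<Phi>(4)[OF WK] relK by simp
  also have "\<dots> = (\<Sum>b\<in>B. fls_const b * (fls_deriv (\<Phi> (Y b)) * inverse (\<Phi> (Y b))))"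
    using partial_hom_sum[OF \<Phi>(1), of B "\<lambda>b. b * (\<delta> (Y b) / Y b)"] summand by simp
  \<comment> \<open>A formal derivative has residue zero, a logarithmic derivative has the order of
    vanishing as its residue. What is left is an integral relation between the elements of
    \<open>B\<close>.\<close>
  finally have "fls_residue (\<Sum>b\<in>B. fls_const b * (fls_deriv (\<Phi> (Y b)) * inverse (\<Phi> (Y b)))) = 0"
    using fls_residue_deriv[of "\<Phi> W"] by simp
  moreover have "fls_residue (\<Sum>b\<in>B'. f b) = (\<Sum>b\<in>B'. fls_residue (f b))"
    for B' :: "complex set" and f :: "complex \<Rightarrow> complex fls"
    by (induction B' rule: infinite_finite_induct) (auto simp: fls_residue_add)
  ultimately have "(\<Sum>b\<in>B. b * of_int (fls_subdegree (\<Phi> (Y b)))) = 0"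
    by (simp only: fls_residue_fls_const_times fls_residue_deriv_times_inverse_eq_subdegree)
  then have "(\<Sum>b\<in>B. of_rat (of_int (fls_subdegree (\<Phi> (Y b)))) * b) = 0"
    by (simp add: mult.commute)
  then have "\<forall>b\<in>B. (of_int (fls_subdegree (\<Phi> (Y b))) :: rat) = 0"
    using indep[of "\<lambda>b. of_int (fls_subdegree (\<Phi> (Y b)))"] by simp
  then have "fls_subdegree (\<Phi> (Y b0)) = 0" using b0 by simp
  \<comment> \<open>By its choice \<open>t\<close> is \<open>y b0\<close> and lies in
    \<open>K\<close>, so it equals all its conjugates. The order of \<open>Y b0\<close> at zero is
    therefore \<open>card orb\<close>, which is positive.\<close>
  moreover have "Y b0 = t ^ card orb"
  proof -
    have "r (y b0) = t" if "r \<in> orb" for r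
    proof -
      obtain \<sigma> where "automorphism_over K \<sigma>" "r = restrict \<sigma> S" using orb_E \<open>r \<in> orb\<close> by blast
      then show ?thesis using tK b0 unfolding automorphism_over_def S_def t_def by simp
    qed
    then have "Y b0 = (\<Prod>r\<in>orb. t)" unfolding Y_def by (intro prod.cong refl)
    then show ?thesis by simp
  qed
  moreover have "\<Phi> (t ^ n) = fls_X ^ n" for n
  proof (induction n)
    case 0
    then show ?case by (simp add: partial_hom_1[OF \<Phi>(1)])
  next
    case (Suc n)
    then show ?case
      using partial_hom_mult[OF \<Phi>(1) tK is_subfield_power[OF K tK, of n]] \<Phi>(3) by simp
  qed
  moreover have "card orb \<noteq> 0" using fin \<open>orb \<noteq> {}\<close> by simp
  ultimately show False by (simp add: fls_subdegree_pow)
qed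

section \<open>Independence of the defects\<close>

lemma additive_of_rat:
  fixes f :: "complex \<Rightarrow> complex"
  assumes add: "\<And>x y. f (x + y) = f x + f y"
  shows "f (of_rat q * x) = of_rat q * f x"
proof -
  have 0: "f 0 = 0" using add[of 0 0] by simp
  have m: "f (- x) = - f x" for x using add[of x "- x"] 0 by (simp add: eq_neg_iff_add_eq_0 add.commute)
  have n: "f (of_nat n * x) = of_nat n * f x" for n x
    by (induction n) (auto simp: 0 add algebra_simps)
  have i: "f (of_int n * x) = of_int n * f x" for n x
    by (cases n) (auto simp: n m simp del: of_nat_Suc)
  obtain a b where ab: "q = Rat.Fract a b" "b > 0" by (cases q) auto
  have "of_int b * f (of_rat q * x) = f (of_int b * (of_rat q * x))" by (simp add: i)
  also have "\<dots> = f (of_int a * x)" using ab by (simp add: of_rat_rat)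
  also have "\<dots> = of_int a * f x" by (rule i)
  finally show ?thesis using ab by (simp add: of_rat_rat field_simps)
qed

lemma additive_rat_lincomb:
  fixes f :: "complex \<Rightarrow> complex"
  assumes add: "\<And>x y. f (x + y) = f x + f y"
  shows "f (\<Sum>z\<in>Z. of_rat (q z) * z) = (\<Sum>z\<in>Z. of_rat (q z) * f z)"
proof -
  have "f 0 = 0" using add[of 0 0] by simp
  then show ?thesis
    by (induction Z rule: infinite_finite_induct) (auto simp: add additive_of_rat[of f, OF add])
qed

text \<open>The functional \<omega> of the overview. For a derivation it is additive in
  \<open>z\<close>, and it vanishes at every \<open>z\<close> exactly when the derivation is
  exponential.\<close>

definition exp_defect :: "(complex \<Rightarrow> complex) \<Rightarrow> complex \<Rightarrow> complex" where
  "exp_defect D z = D (exp z) / exp z - D z"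

lemma log_derivative_add: "derivation D \<Longrightarrow> D (exp (x + y)) / exp (x + y) = D (exp x) / exp x + D (exp y) / exp y"
  by (simp add: exp_add derivation_mult add_divide_distrib)

lemma exp_defect_add: "derivation D \<Longrightarrow> exp_defect D (x + y) = exp_defect D x + exp_defect D y"
  unfolding exp_defect_def by (simp add: log_derivative_add derivation_add)

lemma exp_defect_rat_lincomb:
  "derivation D \<Longrightarrow> exp_defect D (\<Sum>z\<in>Z. of_rat (q z) * z) = (\<Sum>z\<in>Z. of_rat (q z) * exp_defect D z)"
  by (rule additive_rat_lincomb) (rule exp_defect_add)

lemma exp_defect_exp_derivation: "exp_derivation D \<Longrightarrow> exp_defect D z = 0"
  unfolding exp_defect_def exp_derivation_def by simp

lemma exp_defect_lincomb: "exp_defect (\<lambda>x. \<Sum>i\<in>I. c i * D i x) z = (\<Sum>i\<in>I. c i * exp_defect (D i) z)"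
  unfolding exp_defect_def
  by (simp add: sum_divide_distrib sum_subtractf right_diff_distrib)

lemma exp_defect_diff: "exp_defect (\<lambda>x. D x - D' x) z = exp_defect D z - exp_defect D' z"
  unfolding exp_defect_def by (simp add: diff_divide_distrib)

text \<open>Both second derivatives of \<open>exp z\<close> contain the term
  \<open>D z * \<delta> (exp z)\<close>, and both parts of the defect contain
  \<open>\<delta> (D z)\<close>; these cancel, and only \<open>D\<close> applied to the defect
  remains.\<close>

lemma exp_defect_bracket:
  assumes D: "exp_derivation D" and \<delta>: "derivation \<delta>"
  shows "exp_defect (\<lambda>x. D (\<delta> x) - \<delta> (D x)) z = D (exp_defect \<delta> z)"
proof -
  have D': "derivation D" "D (exp z) = exp z * D z" using D unfolding exp_derivation_def by auto
  have "\<delta> (exp z) = exp z * (\<delta> (exp z) / exp z)" by simp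
  then have "D (\<delta> (exp z)) = exp z * D (\<delta> (exp z) / exp z) + \<delta> (exp z) * D z"
    using derivation_mult[OF D'(1), of "exp z" "\<delta> (exp z) / exp z"] D'(2) by simp
  moreover have "\<delta> (D (exp z)) = exp z * \<delta> (D z) + D z * \<delta> (exp z)"
    unfolding D'(2) by (rule derivation_mult[OF \<delta>])
  ultimately show ?thesis
    unfolding exp_defect_def by (simp add: derivation_diff[OF D'(1)] diff_divide_distrib add_divide_distrib)
qed

section \<open>The constant field \<open>C_exp\<close> and Ax's theorem\<close>

lemma exp_derivation_derivation: "exp_derivation D \<Longrightarrow> derivation D"
  unfolding exp_derivation_def by blast

lemma C_expD: "c \<in> C_exp \<Longrightarrow> exp_derivation D \<Longrightarrow> D c = 0"
  unfolding C_exp_def by blast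

lemma C_expI: "(\<And>D. exp_derivation D \<Longrightarrow> D c = 0) \<Longrightarrow> c \<in> C_exp"
  unfolding C_exp_def by blast

lemma dcl_C_exp: "dcl C_exp = C_exp"
proof (intro subset_antisym dcl_superset subsetI C_expI)
  fix x D assume "x \<in> dcl C_exp" "exp_derivation D"
  then show "D x = 0" using dclD[of x C_exp D] C_expD exp_derivation_derivation by blast
qed

lemma is_subfield_C_exp: "is_subfield C_exp"
  using is_subfield_dcl[of C_exp] by (simp add: dcl_C_exp)

lemma exp_in_C_exp_iff: "exp z \<in> C_exp \<longleftrightarrow> z \<in> C_exp"
proof -
  have mem: "c \<in> C_exp \<longleftrightarrow> (\<forall>D. exp_derivation D \<longrightarrow> D c = 0)" for c
    by (simp add: C_exp_def)
  have iff: "D (exp z) = 0 \<longleftrightarrow> D z = 0" if "exp_derivation D" for D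
  proof -
    have "D (exp z) = exp z * D z" using that unfolding exp_derivation_def by blast
    then show ?thesis by simp
  qed
  show ?thesis unfolding mem by (intro all_cong iff)
qed

text \<open>Normalising one coefficient of a relation to \<open>1\<close> and differentiating yields a shorter
  relation, so a relation of minimal length has constant coefficients.\<close>

lemma relation_with_constant_coefficients:
  fixes rel :: "('i \<Rightarrow> complex) \<Rightarrow> bool"
  assumes I: "finite I" and M: "is_subfield M"
    and scale: "\<And>l c. rel l \<Longrightarrow> c \<in> M \<Longrightarrow> rel (\<lambda>i. c * l i)"
    and deriv: "\<And>l D. rel l \<Longrightarrow> (\<And>i. i \<in> I \<Longrightarrow> l i \<in> M) \<Longrightarrow> D \<in> \<Delta> \<Longrightarrow> rel (\<lambda>i. D (l i))"
    and \<Delta>: "\<And>D. D \<in> \<Delta> \<Longrightarrow> derivation D" "\<And>D m. D \<in> \<Delta> \<Longrightarrow> m \<in> M \<Longrightarrow> D m \<in> M"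
    and l: "rel l" "\<And>i. i \<in> I \<Longrightarrow> l i \<in> M" "\<exists>i\<in>I. l i \<noteq> 0"
  shows "\<exists>m. rel m \<and> (\<forall>i\<in>I. m i \<in> M \<and> (\<forall>D\<in>\<Delta>. D (m i) = 0)) \<and> (\<exists>i\<in>I. m i \<noteq> 0)"
  using l
proof (induction "card {i \<in> I. l i \<noteq> 0}" arbitrary: l rule: less_induct)
  case less
  obtain i0 where i0: "i0 \<in> I" "l i0 \<noteq> 0" using less.prems by blast
  define m where "m i = inverse (l i0) * l i" for i
  have c: "inverse (l i0) \<in> M" using less.prems(2) i0(1) by (simp add: is_subfield_inverse[OF M])
  have m: "rel m" "\<And>i. i \<in> I \<Longrightarrow> m i \<in> M"
    unfolding m_def using scale[OF less.prems(1) c] is_subfield_mult[OF M c less.prems(2)] by auto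
  have m1: "m i0 = 1" using i0 by (simp add: m_def)
  show ?case
  proof (cases "\<forall>i\<in>I. \<forall>D\<in>\<Delta>. D (m i) = 0")
    case True
    moreover have "\<exists>i\<in>I. m i \<noteq> 0" using m1 i0(1) by (intro bexI[of _ i0]) auto
    ultimately show ?thesis using m by blast
  next
    case False
    then obtain D where D: "D \<in> \<Delta>" "\<exists>i\<in>I. D (m i) \<noteq> 0" by blast
    have D': "derivation D" using \<Delta>(1)[OF D(1)] .
    have "{i \<in> I. D (m i) \<noteq> 0} \<subseteq> {i \<in> I. l i \<noteq> 0} - {i0}"
      using m1 D' by (auto simp: m_def)
    then have "{i \<in> I. D (m i) \<noteq> 0} \<subset> {i \<in> I. l i \<noteq> 0}" using i0 by blast
    then have "card {i \<in> I. D (m i) \<noteq> 0} < card {i \<in> I. l i \<noteq> 0}"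
      using I by (intro psubset_card_mono) auto
    moreover have "rel (\<lambda>i. D (m i))" using deriv[OF m D(1)] by blast
    moreover have "D (m i) \<in> M" if "i \<in> I" for i using \<Delta>(2)[OF D(1) m(2)[OF that]] .
    ultimately show ?thesis using less.hyps[of "\<lambda>i. D (m i)"] D(2) by blast
  qed
qed

lemma rat_vector_space: "vector_space (\<lambda>(q::rat) (z::complex). of_rat q * z)"
  by standard (auto simp: algebra_simps of_rat_add of_rat_mult)

lemma rational_basis:
  fixes M :: "complex set"
  assumes "finite M"
  obtains B where "B \<subseteq> M" "\<And>q. (\<Sum>b\<in>B. of_rat (q b) * b) = 0 \<Longrightarrow> \<forall>b\<in>B. q b = 0"
    "\<And>m. m \<in> M \<Longrightarrow> \<exists>q. m = (\<Sum>b\<in>B. of_rat (q b) * b)"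
proof -
  interpret Q: vector_space "\<lambda>(q::rat) (z::complex). of_rat q * z" by (rule rat_vector_space)
  obtain B where B: "B \<subseteq> M" "Q.independent B" "M \<subseteq> Q.span B"
    using Q.maximal_independent_subset by metis
  have fin: "finite B" using B(1) assms by (rule finite_subset)
  have "\<forall>b\<in>B. q b = 0" if "(\<Sum>b\<in>B. of_rat (q b) * b) = 0" for q
    using B(2) that Q.dependent_finite[OF fin] by auto
  moreover have "\<exists>q. m = (\<Sum>b\<in>B. of_rat (q b) * b)" if "m \<in> M" for m
    using B(3) that Q.span_finite[OF fin] by auto
  ultimately show ?thesis using that B(1) by blast
qed

text \<open>Once the coefficients are constants in \<open>C_exp\<close>, they still need not be
  rational. Regrouping along a rational basis \<open>B\<close> of them gives a relation between
  logarithmic derivatives with rationally independent weights, and the residue argument makes each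
  \<open>exp (w b)\<close> constant.\<close>

theorem exp_defect_independent:
  assumes Z: "finite Z" "rat_independent_mod C_exp Z"
    and rel: "\<And>D. derivation D \<Longrightarrow> (\<And>c. c \<in> C_exp \<Longrightarrow> D c = 0) \<Longrightarrow> (\<Sum>z\<in>Z. l z * exp_defect D z) = 0"
  shows "\<forall>z\<in>Z. l z = 0"
proof (rule ccontr)
  assume nz: "\<not> ?thesis"
  define R where "R l \<longleftrightarrow> (\<forall>D. derivation D \<and> (\<forall>c\<in>C_exp. D c = 0) \<longrightarrow> (\<Sum>z\<in>Z. l z * exp_defect D z) = 0)"
    for l :: "complex \<Rightarrow> complex"
  have "\<exists>m. R m \<and> (\<forall>i\<in>Z. m i \<in> UNIV \<and> (\<forall>D\<in>Collect exp_derivation. D (m i) = 0)) \<and> (\<exists>i\<in>Z. m i \<noteq> 0)"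
  proof (rule relation_with_constant_coefficients[OF Z(1)])
    show "is_subfield UNIV" by (simp add: is_subfield_def)
    show "R (\<lambda>i. c * l i)" if "R l" for l c
      using that unfolding R_def by (simp add: mult.assoc sum_distrib_left[symmetric])
    show "R (\<lambda>i. D (l i))" if R: "R l" and "D \<in> Collect exp_derivation" for l D
      unfolding R_def
    proof (intro allI impI)
      fix \<delta> assume \<delta>: "derivation \<delta> \<and> (\<forall>c\<in>C_exp. \<delta> c = 0)"
      have D: "exp_derivation D" "derivation D" using that(2) by (auto simp: exp_derivation_def)
      define E where "E x = D (\<delta> x) - \<delta> (D x)" for x
      have "derivation E" unfolding E_def using derivation_bracket D(2) \<delta> by blast
      moreover have "E c = 0" if "c \<in> C_exp" for c
        using that \<delta> D C_expD[OF that D(1)] by (simp add: E_def)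
      ultimately have "(\<Sum>z\<in>Z. l z * exp_defect E z) = 0" using R unfolding R_def by blast
      moreover have "exp_defect E z = D (exp_defect \<delta> z)" for z
        unfolding E_def using exp_defect_bracket[OF D(1)] \<delta> by blast
      ultimately have 1: "(\<Sum>z\<in>Z. l z * D (exp_defect \<delta> z)) = 0" by simp
      have "(\<Sum>z\<in>Z. l z * exp_defect \<delta> z) = 0" using R \<delta> unfolding R_def by blast
      then have "D (\<Sum>z\<in>Z. l z * exp_defect \<delta> z) = 0" using D(2) by simp
      then have "(\<Sum>z\<in>Z. l z * D (exp_defect \<delta> z)) + (\<Sum>z\<in>Z. exp_defect \<delta> z * D (l z)) = 0"
        by (simp add: derivation_sum[OF D(2)] derivation_mult[OF D(2)] sum.distrib)
      then show "(\<Sum>z\<in>Z. D (l z) * exp_defect \<delta> z) = 0" using 1 by (simp add: mult.commute)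
    qed
    show "R l" using rel unfolding R_def by blast
  qed (use nz in \<open>auto simp: exp_derivation_def\<close>)
  then obtain m where m: "R m" "\<And>z D. z \<in> Z \<Longrightarrow> exp_derivation D \<Longrightarrow> D (m z) = 0" "\<exists>z\<in>Z. m z \<noteq> 0" by auto
  have mC: "m z \<in> C_exp" if "z \<in> Z" for z using m(2)[OF that] by (rule C_expI)
  obtain B where B: "B \<subseteq> m ` Z" "\<And>q. (\<Sum>b\<in>B. of_rat (q b) * b) = 0 \<Longrightarrow> \<forall>b\<in>B. q b = 0"
    "\<And>x. x \<in> m ` Z \<Longrightarrow> \<exists>q. x = (\<Sum>b\<in>B. of_rat (q b) * b)"
    using rational_basis[of "m ` Z"] Z(1) by blast
  have finB: "finite B" and BC: "B \<subseteq> C_exp"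
    using finite_subset[OF B(1)] Z(1) B(1) mC by auto
  have "\<forall>z\<in>Z. \<exists>q. m z = (\<Sum>b\<in>B. of_rat (q b) * b)" using B(3) by blast
  then obtain q where q: "\<And>z. z \<in> Z \<Longrightarrow> m z = (\<Sum>b\<in>B. of_rat (q z b) * b)" by metis
  \<comment> \<open>The defect of \<open>w b\<close> collects what multiplies the basis element
    \<open>b\<close>. Since \<open>D\<close> kills \<open>b\<close>, the part of the relation
    without logarithmic derivatives is the derivative of one number.\<close>
  define w where "w b = (\<Sum>z\<in>Z. of_rat (q z b) * z)" for b
  have key: "(\<Sum>b\<in>B. b * (D (exp (w b)) / exp (w b))) = D (\<Sum>b\<in>B. b * w b)"
    if D: "derivation D" "\<And>c. c \<in> C_exp \<Longrightarrow> D c = 0" for D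
  proof -
    have "(\<Sum>b\<in>B. b * exp_defect D (w b)) = (\<Sum>b\<in>B. \<Sum>z\<in>Z. b * (of_rat (q z b) * exp_defect D z))"
      unfolding w_def by (simp add: exp_defect_rat_lincomb[OF D(1)] sum_distrib_left)
    also have "\<dots> = (\<Sum>z\<in>Z. \<Sum>b\<in>B. b * (of_rat (q z b) * exp_defect D z))" by (rule sum.swap)
    also have "\<dots> = (\<Sum>z\<in>Z. m z * exp_defect D z)"
      by (intro sum.cong refl) (simp add: q sum_distrib_left mult_ac)
    also have "\<dots> = 0" using m(1) D unfolding R_def by blast
    finally have "(\<Sum>b\<in>B. b * (D (exp (w b)) / exp (w b))) - (\<Sum>b\<in>B. b * D (w b)) = 0"
      unfolding exp_defect_def by (simp add: right_diff_distrib sum_subtractf)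
    moreover have "(\<Sum>b\<in>B. b * D (w b)) = (\<Sum>b\<in>B. D (b * w b))"
      using BC D(2) by (intro sum.cong refl) (auto simp: derivation_mult[OF D(1)])
    ultimately show ?thesis by (simp add: derivation_sum[OF D(1)])
  qed
  have "q z b = 0" if "z \<in> Z" "b \<in> B" for z b
  proof -
    have "exp (w b) \<in> C_exp"
    proof (rule log_derivative_relation[OF dcl_C_exp finB BC, where y = "\<lambda>b. exp (w b)" and w = "\<Sum>b\<in>B. b * w b"])
      show "\<forall>b\<in>B. q b = 0" if "(\<Sum>b\<in>B. of_rat (q b) * b) = 0" for q
        using B(2) that .
      show "(\<Sum>b\<in>B. b * (D (exp (w b)) / exp (w b))) = D (\<Sum>b\<in>B. b * w b)"
        if "derivation D" "\<And>c. c \<in> C_exp \<Longrightarrow> D c = 0" for D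
        using key that .
    qed (use \<open>b \<in> B\<close> in auto)
    then have "w b \<in> C_exp" by (simp add: exp_in_C_exp_iff)
    then show ?thesis
      using Z(2) that(1) unfolding rat_independent_mod_def w_def by (auto dest: spec[of _ "\<lambda>z. q z b"])
  qed
  then have "m z = 0" if "z \<in> Z" for z using q[OF that] that by simp
  then show False using m(3) by blast
qed

section \<open>Linear algebra of functionals\<close>

text \<open>Gaussian elimination: the pivot \<open>v i0 t0\<close> removes the equation
  \<open>t0\<close> together with the unknown \<open>i0\<close>.\<close>

lemma homogeneous_system:
  fixes v :: "'i \<Rightarrow> 't \<Rightarrow> 'f::field"
  assumes "finite T" "finite I" "card T < card I"
  shows "\<exists>c. (\<exists>i\<in>I. c i \<noteq> 0) \<and> (\<forall>t\<in>T. (\<Sum>i\<in>I. c i * v i t) = 0)"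
  using assms
proof (induction T arbitrary: I v rule: finite_induct)
  case empty
  then have "I \<noteq> {}" by auto
  then show ?case by (intro exI[of _ "\<lambda>_. 1"]) auto
next
  case (insert t0 T)
  show ?case
  proof (cases "\<forall>i\<in>I. v i t0 = 0")
    case True
    have "card T < card I" using insert by simp
    then obtain c where "\<exists>i\<in>I. c i \<noteq> 0" "\<forall>t\<in>T. (\<Sum>i\<in>I. c i * v i t) = 0"
      using insert.IH[of I v] insert.prems(1) by blast
    then show ?thesis using True by (intro exI[of _ c]) auto
  next
    case False
    then obtain i0 where i0: "i0 \<in> I" "v i0 t0 \<noteq> 0" by blast
    define J where "J = I - {i0}"
    have J: "finite J" "i0 \<notin> J" "I = insert i0 J" using insert.prems i0 by (auto simp: J_def)
    define w where "w i t = v i t - v i t0 / v i0 t0 * v i0 t" for i t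
    have "card T < card J" using insert J by simp
    then obtain c where c: "\<exists>i\<in>J. c i \<noteq> 0" "\<forall>t\<in>T. (\<Sum>i\<in>J. c i * w i t) = 0"
      using insert.IH[of J w] J(1) by blast
    define d where "d i = (if i = i0 then - (\<Sum>i\<in>J. c i * (v i t0 / v i0 t0)) else c i)" for i
    have "(\<Sum>i\<in>I. d i * v i t) = (\<Sum>i\<in>J. c i * w i t)" for t
    proof -
      have "(\<Sum>i\<in>J. d i * v i t) = (\<Sum>i\<in>J. c i * v i t)"
        using J(2) by (intro sum.cong) (auto simp: d_def)
      then have "(\<Sum>i\<in>I. d i * v i t) = (\<Sum>i\<in>J. c i * v i t) - (\<Sum>i\<in>J. c i * (v i t0 / v i0 t0)) * v i0 t"
        using J by (simp add: d_def)
      also have "\<dots> = (\<Sum>i\<in>J. c i * w i t)"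
        by (simp add: w_def right_diff_distrib sum_subtractf sum_distrib_right mult.assoc)
      finally show ?thesis .
    qed
    moreover have "w i t0 = 0" for i using i0(2) by (simp add: w_def)
    moreover have "\<exists>i\<in>I. d i \<noteq> 0" using c(1) J by (auto simp: d_def)
    ultimately show ?thesis using c(2) by (intro exI[of _ d]) auto
  qed
qed

text \<open>Appending \<open>u\<close> as a further column gives more unknowns than equations, hence
  a nontrivial relation. By injectivity its coefficient at \<open>u\<close> is nonzero, so it can be
  solved for \<open>u\<close>.\<close>

lemma linear_system_solvable:
  fixes v :: "'i \<Rightarrow> 't \<Rightarrow> 'f::field"
  assumes fin: "finite T" "finite I" and card: "card T \<le> card I"
    and inj: "\<And>c. \<forall>t\<in>T. (\<Sum>i\<in>I. c i * v i t) = 0 \<Longrightarrow> \<forall>i\<in>I. c i = 0"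
  shows "\<exists>c. \<forall>t\<in>T. (\<Sum>i\<in>I. c i * v i t) = u t"
proof -
  define J where "J = insert None (Some ` I)"
  define w where "w j = (case j of None \<Rightarrow> u | Some i \<Rightarrow> v i)" for j
  have "card J = Suc (card I)" using fin(2) by (simp add: J_def card_image)
  then obtain c where c: "\<exists>j\<in>J. c j \<noteq> 0" "\<forall>t\<in>T. (\<Sum>j\<in>J. c j * w j t) = 0"
    using homogeneous_system[OF fin(1), of J w] fin(2) card by (auto simp: J_def)
  have sum: "c None * u t + (\<Sum>i\<in>I. c (Some i) * v i t) = 0" if "t \<in> T" for t
  proof -
    have "(\<Sum>j\<in>Some ` I. c j * w j t) = (\<Sum>i\<in>I. c (Some i) * v i t)"
      by (simp add: sum.reindex w_def)
    moreover have "(\<Sum>j\<in>J. c j * w j t) = c None * u t + (\<Sum>j\<in>Some ` I. c j * w j t)"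
      unfolding J_def using fin(2) by (subst sum.insert) (auto simp: w_def)
    ultimately show ?thesis using c(2) that by simp
  qed
  have "c None \<noteq> 0"
  proof
    assume "c None = 0"
    then have "\<forall>i\<in>I. c (Some i) = 0" using sum inj[of "\<lambda>i. c (Some i)"] by simp
    then show False using c(1) \<open>c None = 0\<close> by (auto simp: J_def)
  qed
  have "(\<Sum>i\<in>I. - c (Some i) / c None * v i t) = u t" if "t \<in> T" for t
  proof -
    have "(\<Sum>i\<in>I. - c (Some i) / c None * v i t) = - (\<Sum>i\<in>I. c (Some i) * v i t) / c None"
      by (simp add: sum_divide_distrib sum_negf)
    also have "(\<Sum>i\<in>I. c (Some i) * v i t) = - (c None * u t)"
      using sum[OF that] by (metis add.commute eq_neg_iff_add_eq_0)
    also have "- (- (c None * u t)) / c None = u t" using \<open>c None \<noteq> 0\<close> by simp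
    finally show ?thesis .
  qed
  then show ?thesis by (intro exI[of _ "\<lambda>i. - c (Some i) / c None"] ballI)
qed

section \<open>Spaces of derivations and functionals on them\<close>

definition Der_over :: "complex set \<Rightarrow> (complex \<Rightarrow> complex) set" where
  "Der_over K = {D. derivation D \<and> (\<forall>a\<in>K. D a = 0)}"

lemma Der_overD: "D \<in> Der_over K \<Longrightarrow> derivation D" "D \<in> Der_over K \<Longrightarrow> a \<in> K \<Longrightarrow> D a = 0"
  unfolding Der_over_def by auto

lemma Der_over_0: "(\<lambda>_. 0) \<in> Der_over K"
  by (simp add: Der_over_def)

lemma Der_over_plus: "D \<in> Der_over K \<Longrightarrow> D' \<in> Der_over K \<Longrightarrow> (\<lambda>x. D x + c * D' x) \<in> Der_over K"
  unfolding Der_over_def by (auto intro: derivation_plus derivation_scale)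

lemma Der_over_lincomb: "(\<And>i. i \<in> I \<Longrightarrow> D i \<in> Der_over K) \<Longrightarrow> (\<lambda>x. \<Sum>i\<in>I. c i * D i x) \<in> Der_over K"
  unfolding Der_over_def by (auto intro!: derivation_lincomb)

lemma Der_over_dcl: "D \<in> Der_over K \<Longrightarrow> x \<in> dcl K \<Longrightarrow> D x = 0"
  unfolding Der_over_def dcl_def by blast

text \<open>Sum and scaling in one identity, and on all maps, so that one definition serves every
  base field.\<close>

definition linear_functional :: "((complex \<Rightarrow> complex) \<Rightarrow> complex) \<Rightarrow> bool" where
  "linear_functional \<phi> \<longleftrightarrow> (\<forall>D D' c. \<phi> (\<lambda>x. D x + c * D' x) = \<phi> D + c * \<phi> D')"

lemma linear_functional_exp_defect: "linear_functional (\<lambda>D. exp_defect D z)"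
  unfolding linear_functional_def exp_defect_def
  by (simp add: add_divide_distrib algebra_simps)

lemma linear_functional_lincomb:
  assumes "linear_functional \<phi>"
  shows "\<phi> (\<lambda>x. \<Sum>i\<in>I. c i * D i x) = (\<Sum>i\<in>I. c i * \<phi> (D i))"
proof -
  have add: "\<phi> (\<lambda>x. D x + c * D' x) = \<phi> D + c * \<phi> D'" for D D' c
    using assms unfolding linear_functional_def by blast
  have 0: "\<phi> (\<lambda>_. 0) = 0" using add[of "\<lambda>_. 0" 1 "\<lambda>_. 0"] by simp
  show ?thesis
  proof (induction I rule: infinite_finite_induct)
    case (insert j J)
    then show ?case using add[of "\<lambda>x. \<Sum>i\<in>J. c i * D i x" "c j" "D j"] by (simp add: add.commute)
  qed (simp_all add: 0)
qed

text \<open>\<open>Der_over K\<close> may have infinite dimension, so no dimension formula is used.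
  The old functionals have dual derivations by induction; the new functional is not a combination of
  them, which yields a derivation killed by the old functionals but not by the new one.\<close>

lemma independent_functionals_surjective:
  assumes "finite I" and lin: "\<And>i. i \<in> I \<Longrightarrow> linear_functional (\<phi> i)"
    and "\<And>l. (\<And>D. D \<in> Der_over K \<Longrightarrow> (\<Sum>i\<in>I. l i * \<phi> i D) = 0) \<Longrightarrow> \<forall>i\<in>I. l i = 0"
  shows "\<exists>D\<in>Der_over K. \<forall>i\<in>I. \<phi> i D = u i"
  using assms
proof (induction I arbitrary: u rule: finite_induct)
  case empty
  then show ?case using Der_over_0 by blast
next
  case (insert j J)
  have add: "\<phi> i (\<lambda>x. D x + c * D' x) = \<phi> i D + c * \<phi> i D'" if "i \<in> insert j J" for i D D' c
    using insert.prems(1)[OF that] unfolding linear_functional_def by blast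
  have indep: "\<forall>i\<in>J. l i = 0" if l: "\<And>D. D \<in> Der_over K \<Longrightarrow> (\<Sum>i\<in>J. l i * \<phi> i D) = 0" for l
  proof -
    have *: "(\<Sum>i\<in>insert j J. (if i = j then 0 else l i) * \<phi> i D) = (\<Sum>i\<in>J. l i * \<phi> i D)" for D
      using insert.hyps by (auto intro!: sum.cong)
    have "\<forall>i\<in>insert j J. (if i = j then 0 else l i) = 0"
      by (rule insert.prems(2)) (simp only: * l)
    then show ?thesis using insert.hyps(2) by (metis insertI2)
  qed
  have IH: "\<exists>D\<in>Der_over K. \<forall>i\<in>J. \<phi> i D = u i" for u
    using insert.IH[of u] insert.prems(1) indep by blast
  have "\<forall>k\<in>J. \<exists>D\<in>Der_over K. \<forall>i\<in>J. \<phi> i D = (if i = k then 1 else 0)"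
    by (intro ballI IH)
  then obtain d where d: "\<And>k. k \<in> J \<Longrightarrow> d k \<in> Der_over K"
    "\<And>k i. k \<in> J \<Longrightarrow> i \<in> J \<Longrightarrow> \<phi> i (d k) = (if i = k then 1 else 0)" by metis
  \<comment> \<open>If \<open>\<phi> j\<close> were a combination, evaluation at the dual
    derivations \<open>d k\<close> would give these coefficients.\<close>
  have "\<exists>D\<in>Der_over K. \<phi> j D \<noteq> (\<Sum>k\<in>J. \<phi> j (d k) * \<phi> k D)"
  proof (rule ccontr)
    assume "\<not> ?thesis"
    then have eq: "\<phi> j D = (\<Sum>k\<in>J. \<phi> j (d k) * \<phi> k D)" if "D \<in> Der_over K" for D using that by blast
    have "(\<Sum>i\<in>insert j J. (if i = j then - 1 else \<phi> j (d i)) * \<phi> i D) = 0" if "D \<in> Der_over K" for D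
    proof -
      have "(\<Sum>i\<in>J. (if i = j then - 1 else \<phi> j (d i)) * \<phi> i D) = (\<Sum>k\<in>J. \<phi> j (d k) * \<phi> k D)"
        using insert.hyps by (auto intro!: sum.cong)
      then show ?thesis using eq[OF that] insert.hyps by simp
    qed
    then have "\<forall>i\<in>insert j J. (if i = j then - 1 else \<phi> j (d i)) = 0" by (rule insert.prems(2))
    then show False by simp
  qed
  then obtain D where D: "D \<in> Der_over K" "\<phi> j D \<noteq> (\<Sum>k\<in>J. \<phi> j (d k) * \<phi> k D)" by blast
  define e where "e x = D x + (- 1) * (\<Sum>k\<in>J. \<phi> k D * d k x)" for x
  have e: "e \<in> Der_over K" unfolding e_def using D d by (intro Der_over_plus Der_over_lincomb)
  have \<phi>e: "\<phi> i e = \<phi> i D - (\<Sum>k\<in>J. \<phi> k D * \<phi> i (d k))" if "i \<in> insert j J" for i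
    unfolding e_def using add[OF that, of D "- 1" "\<lambda>x. \<Sum>k\<in>J. \<phi> k D * d k x"]
      linear_functional_lincomb[OF insert.prems(1)[OF that]] by simp
  have eJ: "\<phi> i e = 0" if "i \<in> J" for i
  proof -
    have "(\<Sum>k\<in>J. \<phi> k D * \<phi> i (d k)) = (\<Sum>k\<in>J. if i = k then \<phi> k D else 0)"
      using that d(2) by (intro sum.cong) auto
    then show ?thesis using \<phi>e[of i] that insert.hyps by simp
  qed
  have ej: "\<phi> j e \<noteq> 0" using \<phi>e[of j] D(2) by (simp add: mult.commute)
  obtain G where G: "G \<in> Der_over K" "\<forall>i\<in>J. \<phi> i G = u i" using IH by blast
  define H where "H x = G x + ((u j - \<phi> j G) / \<phi> j e) * e x" for x
  have "H \<in> Der_over K" unfolding H_def using G e by (intro Der_over_plus)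
  moreover have "\<phi> i H = u i" if "i \<in> insert j J" for i
    unfolding H_def add[OF that] using that eJ ej G(2) by auto
  ultimately show ?case by blast
qed

section \<open>Transcendence degree and the two dimensions\<close>

lemma SUP_enat_attained:
  assumes "A \<noteq> {}" "(SUP x\<in>A. enat (f x)) = enat N"
  shows "\<exists>x\<in>A. f x = N"
proof -
  have fin: "finite ((\<lambda>x. enat (f x)) ` A)"
    using assms by (auto simp: Sup_enat_def split: if_splits)
  then have "enat N = Max ((\<lambda>x. enat (f x)) ` A)"
    using assms by (auto simp: Sup_enat_def)
  then have "enat N \<in> (\<lambda>x. enat (f x)) ` A" using Max_in[OF fin] assms(1) by simp
  then show ?thesis by auto
qed

lemma SUP_enat_bounded:
  assumes "\<And>x. x \<in> A \<Longrightarrow> f x \<le> n"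
  obtains m where "(SUP x\<in>A. enat (f x)) = enat m"
proof -
  have "(SUP x\<in>A. enat (f x)) \<le> enat n" using assms by (intro SUP_least) simp
  then show ?thesis using that enat_ile by blast
qed

section \<open>Transcendence bases\<close>

lemma alg_independent_empty: "alg_independent K {}"
  unfolding alg_independent_def
proof (intro allI impI)
  fix p :: "complex multiset \<Rightarrow>\<^sub>0 complex"
  assume p: "(\<forall>m. Poly_Mapping.lookup p m \<in> K) \<and> (\<forall>m\<in>Poly_Mapping.keys p. set_mset m \<subseteq> {}) \<and> eval_self p = 0"
  then have k: "Poly_Mapping.keys p \<subseteq> {{#}}" by auto
  then have "eval_self p = (\<Sum>m\<in>{{#}}. Poly_Mapping.lookup p m * prod_mset m)"
    unfolding eval_self_def by (intro sum.mono_neutral_left) (auto simp: in_keys_iff)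
  then have "Poly_Mapping.lookup p {#} = 0" using p by simp
  then have "Poly_Mapping.lookup p m = 0" for m
    using k by (cases "m = {#}") (auto simp: in_keys_iff)
  then show "p = 0" by (intro poly_mapping_eqI) simp
qed

text \<open>The dependence is read as a polynomial \<open>Q\<close> in \<open>f\<close> with
  coefficients in \<open>dcl (K \<union> S)\<close>. If \<open>Q\<close> were zero, one of its
  coefficients would be a nontrivial relation between elements of \<open>S\<close>.\<close>

lemma alg_dependent_imp_dcl:
  assumes S: "alg_independent K S" and f: "\<not> alg_independent K (insert f S)" "f \<notin> S" and K0: "0 \<in> K"
  shows "f \<in> dcl (K \<union> S)"
proof -
  obtain p where p: "\<And>m. Poly_Mapping.lookup p m \<in> K" "\<And>m. m \<in> Poly_Mapping.keys p \<Longrightarrow> set_mset m \<subseteq> insert f S"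
    "eval_self p = 0" "p \<noteq> 0" using f(1) unfolding alg_independent_def by blast
  define L where "L = dcl (K \<union> S)"
  have L: "is_subfield L" "K \<subseteq> L" "S \<subseteq> L"
    unfolding L_def using is_subfield_dcl dcl_superset[of "K \<union> S"] by auto
  define rest where "rest m = filter_mset (\<lambda>x. x \<noteq> f) m" for m
  have split: "m = rest m + replicate_mset (count m f) f" for m
    unfolding rest_def by (auto simp: multiset_eq_iff)
  have prod_split: "prod_mset m = prod_mset (rest m) * f ^ count m f" for m
    by (subst split[of m]) (simp add: prod_mset_replicate_mset)
  have rest_L: "prod_mset (rest m) \<in> L" if "m \<in> Poly_Mapping.keys p" for m
  proof -
    have "set_mset (rest m) \<subseteq> L" using p(2)[OF that] L(3) unfolding rest_def by auto
    moreover have "prod_mset n \<in> L" if "set_mset n \<subseteq> L" for n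
      using that by (induction n) (auto simp: is_subfield_1[OF L(1)] is_subfield_mult[OF L(1)])
    ultimately show ?thesis by blast
  qed
  define Q where "Q = (\<Sum>m\<in>Poly_Mapping.keys p. monom (Poly_Mapping.lookup p m * prod_mset (rest m)) (count m f))"
  have "poly Q f = eval_self p"
  proof -
    have "poly Q f = (\<Sum>m\<in>Poly_Mapping.keys p. Poly_Mapping.lookup p m * (prod_mset (rest m) * f ^ count m f))"
      unfolding Q_def by (simp add: poly_sum poly_monom mult.assoc)
    then show ?thesis unfolding eval_self_def prod_split[symmetric] .
  qed
  then have Qf: "poly Q f = 0" using p(3) by simp
  have Qi: "coeff Q i = (\<Sum>m\<in>{m\<in>Poly_Mapping.keys p. count m f = i}. Poly_Mapping.lookup p m * prod_mset (rest m))" for i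
    unfolding Q_def by (simp add: coeff_sum sum.If_cases Int_def)
  have "coeff Q i \<in> L" for i
    unfolding Qi using rest_L p(1) L(2)
    by (intro is_subfield_sum[OF L(1)] is_subfield_mult[OF L(1)]) auto
  then have "Q \<in> polys_over L" by (simp add: polys_over_def)
  moreover have "Q \<noteq> 0"
  proof
    assume "Q = 0"
    obtain m0 where m0: "m0 \<in> Poly_Mapping.keys p" using p(4) by (metis keys_eq_empty ex_in_conv)
    define i where "i = count m0 f"
    define R where "R = replicate_mset i f"
    \<comment> \<open>The coefficient of the \<open>i\<close>-th power of \<open>f\<close> as a
      polynomial in the other variables: the monomials of \<open>p\<close> with exactly
      \<open>i\<close> factors \<open>f\<close>, with these factors removed.\<close>
    define g where "g m = (if f \<in># m then 0 else Poly_Mapping.lookup p (m + R))" for m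
    have "{m. g m \<noteq> 0} \<subseteq> (\<lambda>m. m + R) -` Poly_Mapping.keys p"
      unfolding g_def by (auto simp: in_keys_iff split: if_splits)
    moreover have "finite ((\<lambda>m. m + R) -` Poly_Mapping.keys p)"
      by (intro finite_vimageI) (auto intro: injI)
    ultimately have fin: "finite {m. g m \<noteq> 0}" by (rule finite_subset)
    define q where "q = Abs_poly_mapping g"
    have q: "Poly_Mapping.lookup q m = g m" for m unfolding q_def using fin by (simp add: lookup_Abs_poly_mapping)
    have rest_plus: "rest (m + R) = m" "count (m + R) f = i" if "f \<notin># m" for m
      using that unfolding rest_def R_def by (auto simp: multiset_eq_iff count_eq_zero_iff)
    have plus_rest: "rest m + R = m" "f \<notin># rest m" if "count m f = i" for m
      using split[of m] that unfolding R_def rest_def by auto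
    have bij: "bij_betw (\<lambda>m. m + R) (Poly_Mapping.keys q) {m\<in>Poly_Mapping.keys p. count m f = i}"
    proof (rule bij_betwI[of _ _ _ rest])
      show "(\<lambda>m. m + R) \<in> Poly_Mapping.keys q \<rightarrow> {m\<in>Poly_Mapping.keys p. count m f = i}"
        using rest_plus by (auto simp: in_keys_iff q g_def split: if_splits)
      show "rest \<in> {m\<in>Poly_Mapping.keys p. count m f = i} \<rightarrow> Poly_Mapping.keys q"
        using plus_rest by (auto simp: in_keys_iff q g_def)
      show "rest (m + R) = m" if "m \<in> Poly_Mapping.keys q" for m
        using that rest_plus by (auto simp: in_keys_iff q g_def split: if_splits)
      show "rest m + R = m" if "m \<in> {m\<in>Poly_Mapping.keys p. count m f = i}" for m
        using that plus_rest by auto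
    qed
    have notin: "f \<notin># m" "Poly_Mapping.lookup q m = Poly_Mapping.lookup p (m + R)"
      if "m \<in> Poly_Mapping.keys q" for m
      using that by (auto simp: in_keys_iff q g_def split: if_splits)
    have "eval_self q = (\<Sum>m\<in>Poly_Mapping.keys q. Poly_Mapping.lookup p (m + R) * prod_mset (rest (m + R)))"
      unfolding eval_self_def using notin rest_plus by (intro sum.cong) auto
    also have "\<dots> = coeff Q i"
      unfolding Qi by (rule sum.reindex_bij_betw[OF bij])
    finally have "eval_self q = 0" using \<open>Q = 0\<close> by simp
    moreover have "Poly_Mapping.lookup q m \<in> K" for m using p(1) K0 by (simp add: q g_def)
    moreover have "set_mset m \<subseteq> S" if "m \<in> Poly_Mapping.keys q" for m
    proof -
      have "m + R \<in> Poly_Mapping.keys p" using bij that by (auto simp: bij_betw_def)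
      then have "set_mset m \<subseteq> insert f S" using p(2)[of "m + R"] by auto
      then show ?thesis using notin(1)[OF that] by blast
    qed
    ultimately have "q = 0" using S unfolding alg_independent_def by blast
    then have "g (rest m0) = 0" using q[of "rest m0"] by simp
    then show False using m0 plus_rest[of m0] by (simp add: g_def i_def in_keys_iff)
  qed
  ultimately have "algebraic_over L f" using Qf unfolding algebraic_over_def by blast
  then show ?thesis using dcl_eq_algebraic[OF L(1)] unfolding L_def by (auto simp: dcl_idem)
qed

text \<open>A finite supremum is attained, and by maximality no further element of \<open>M\<close>
  can be added, so each is algebraic over \<open>K\<close> and \<open>S\<close>.\<close>

lemma trdeg_basis:
  assumes "trdeg K M = enat N" "0 \<in> K"
  obtains S where "finite S" "S \<subseteq> M" "card S = N" "M \<subseteq> dcl (K \<union> S)"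
proof -
  define A where "A = {S. finite S \<and> S \<subseteq> M \<and> alg_independent K S}"
  have sup: "(SUP S\<in>A. enat (card S)) = enat N" using assms(1) by (simp add: trdeg_def A_def)
  have "{} \<in> A" by (simp add: A_def alg_independent_empty)
  then obtain S where S: "S \<in> A" "card S = N" using SUP_enat_attained[of A card, OF _ sup] by blast
  have "f \<in> dcl (K \<union> S)" if f: "f \<in> M" for f
  proof (cases "f \<in> S")
    case True
    then show ?thesis using dcl_superset[of "K \<union> S"] by blast
  next
    case False
    have "insert f S \<notin> A"
    proof
      assume "insert f S \<in> A"
      then have "enat (card (insert f S)) \<le> enat N" using SUP_upper[of "insert f S" A "\<lambda>S. enat (card S)"] sup by simp
      then show False using S False by (simp add: A_def)
    qed
    then have "\<not> alg_independent K (insert f S)" using S(1) f by (simp add: A_def)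
    then show ?thesis using alg_dependent_imp_dcl[of K S f] S(1) False assms(2) by (simp add: A_def)
  qed
  then show ?thesis using that[of S] S by (auto simp: A_def)
qed

section \<open>Rational spans and exponential dimension\<close>

lemma span_rat_eq:
  assumes "\<And>a b. a \<in> V \<Longrightarrow> b \<in> V \<Longrightarrow> a + b \<in> V" "\<And>q a. a \<in> V \<Longrightarrow> of_rat q * a \<in> V" "0 \<in> V"
  shows "span_rat V = V"
proof -
  interpret Q: vector_space "\<lambda>(q::rat) (z::complex). of_rat q * z" by (rule rat_vector_space)
  have "Q.subspace V" using assms unfolding Q.subspace_def by blast
  then show ?thesis by (rule Q.span_eq_iff[THEN iffD2])
qed

lemma span_rat_C_exp: "span_rat C_exp = C_exp"
  by (intro span_rat_eq is_subfield_add[OF is_subfield_C_exp] is_subfield_mult[OF is_subfield_C_exp]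
      is_subfield_of_rat[OF is_subfield_C_exp] is_subfield_0[OF is_subfield_C_exp])

lemma derivation_exp_rat:
  assumes "derivation D" "D (exp z) = 0"
  shows "D (exp (of_rat q * z)) = 0"
proof -
  have "D (exp (of_rat q * z)) / exp (of_rat q * z) = of_rat q * (D (exp z) / exp z)"
    using additive_of_rat[of "\<lambda>z. D (exp z) / exp z", OF log_derivative_add[OF assms(1)]] .
  then show ?thesis using assms(2) by simp
qed

lemma derivation_span_rat:
  assumes D: "derivation D" and V: "\<And>v. v \<in> V \<Longrightarrow> D v = 0" "\<And>v. v \<in> V \<Longrightarrow> D (exp v) = 0"
    and s: "s \<in> span_rat V"
  shows "D s = 0" "D (exp s) = 0"
proof -
  interpret Q: vector_space "\<lambda>(q::rat) (z::complex). of_rat q * z" by (rule rat_vector_space)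
  have "D s = 0 \<and> D (exp s) = 0"
    using s
  proof (induction rule: Q.span_induct_alt)
    case base
    then show ?case using D by simp
  next
    case (step c x y)
    then show ?case
      using V[OF step(1)] derivation_exp_rat[OF D V(2)[OF step(1)], of c]
      by (simp add: derivation_add[OF D] derivation_mult[OF D] derivation_of_rat[OF D] exp_add)
  qed
  then show "D s = 0" "D (exp s) = 0" by auto
qed

lemma exp_derivation_lincomb:
  assumes "\<And>i. i \<in> I \<Longrightarrow> exp_derivation (D i)"
  shows "exp_derivation (\<lambda>x. \<Sum>i\<in>I. c i * D i x)"
  unfolding exp_derivation_def
proof (intro conjI allI)
  show "derivation (\<lambda>x. \<Sum>i\<in>I. c i * D i x)"
    using assms by (intro derivation_lincomb exp_derivation_derivation)
  show "(\<Sum>i\<in>I. c i * D i (exp z)) = exp z * (\<Sum>i\<in>I. c i * D i z)" for z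
    unfolding sum_distrib_left using assms by (intro sum.cong) (auto simp: exp_derivation_def)
qed

text \<open>If \<open>n\<close> exceeded \<open>card T\<close>, a nontrivial combination of the
  derivations would kill \<open>T\<close> and hence every \<open>a k\<close>, where duality reads
  off its coefficients.\<close>

lemma edim_at_least_bound:
  assumes T: "finite T" and n: "edim_at_least n T {}"
  shows "n \<le> card T"
proof (rule ccontr)
  assume "\<not> ?thesis"
  obtain a D where aD: "\<And>i. i \<in> {1..n} \<Longrightarrow> a i \<in> ecl T" "\<And>i. i \<in> {1..n} \<Longrightarrow> exp_derivation (D i)"
    "\<And>i. i \<in> {1..n} \<Longrightarrow> D i (a i) = 1" "\<And>i k. i \<in> {1..n} \<Longrightarrow> k \<in> {1..n} \<Longrightarrow> i \<noteq> k \<Longrightarrow> D i (a k) = 0"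
    using n unfolding edim_at_least_def by blast
  obtain c where c: "\<exists>i\<in>{1..n}. c i \<noteq> 0" "\<forall>t\<in>T. (\<Sum>i\<in>{1..n}. c i * D i t) = 0"
    using homogeneous_system[OF T, of "{1..n}" D] \<open>\<not> n \<le> card T\<close> by auto
  have "exp_derivation (\<lambda>x. \<Sum>i\<in>{1..n}. c i * D i x)" using aD(2) by (rule exp_derivation_lincomb)
  then have "(\<Sum>i\<in>{1..n}. c i * D i (a k)) = 0" if "k \<in> {1..n}" for k
    using aD(1)[OF that] c(2) unfolding ecl_def by blast
  moreover have "(\<Sum>i\<in>{1..n}. c i * D i (a k)) = c k" if "k \<in> {1..n}" for k
  proof -
    have "(\<Sum>i\<in>{1..n}. c i * D i (a k)) = (\<Sum>i\<in>{1..n}. if i = k then c i else 0)"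
      using aD(3,4) that by (intro sum.cong) auto
    then show ?thesis using that by simp
  qed
  ultimately show False using c(1) by simp
qed

lemma rat_independent_mod_card:
  assumes T: "finite T" and S: "finite S" "S \<subseteq> span_rat T" "rat_independent_mod W S" "0 \<in> W"
  shows "card S \<le> card T"
proof -
  interpret Q: vector_space "\<lambda>(q::rat) (z::complex). of_rat q * z" by (rule rat_vector_space)
  have "Q.independent S"
    using S(3,4) unfolding Q.dependent_finite[OF S(1)] rat_independent_mod_def by metis
  then show ?thesis using Q.independent_span_bound[OF T _ S(2)] by simp
qed

section \<open>Independence of the defects over the base field\<close>

text \<open>\<open>S\<close>, the pairs \<open>(a i, d i)\<close> and \<open>B\<close> witness \<open>l.dim(T|C_exp)\<close>, \<open>dim\<^sup>e(T)\<close> and the transcendence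
  degree of \<open>F\<close>, so \<open>card_B\<close> is the hypothesis of the theorem.\<close>

locale exponential_base =
  fixes T F :: "complex set" and S :: "complex set" and B :: "complex set"
    and r :: nat and a :: "nat \<Rightarrow> complex" and d :: "nat \<Rightarrow> complex \<Rightarrow> complex"
  assumes F_def: "F = generate_field \<CC> (C_exp \<union> T \<union> exp ` T)"
    and B: "finite B" "B \<subseteq> F" "F \<subseteq> dcl (C_exp \<union> B)"
    and S: "finite S" "S \<subseteq> span_rat T" "rat_independent_mod C_exp S"
    and card_B: "card B = card S + r"
    and a: "\<And>i. i \<in> {1..r} \<Longrightarrow> a i \<in> ecl T"
    and d: "\<And>i. i \<in> {1..r} \<Longrightarrow> exp_derivation (d i)"
    and d_a: "\<And>i. i \<in> {1..r} \<Longrightarrow> d i (a i) = 1"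
      "\<And>i k. i \<in> {1..r} \<Longrightarrow> k \<in> {1..r} \<Longrightarrow> i \<noteq> k \<Longrightarrow> d i (a k) = 0"
begin

text \<open>The trivial part of all later dependences: elements of \<open>W\<close> and their
  exponentials are algebraic over \<open>F\<close>, so derivations over \<open>F\<close> have no
  defect there.\<close>

definition W :: "complex set" where
  "W = span_rat (C_exp \<union> T)"

lemma generators_in_F: "C_exp \<subseteq> F" "T \<subseteq> F" "exp ` T \<subseteq> F"
  unfolding F_def by (auto intro: generate_field.incl)

lemma W_add: "x \<in> W \<Longrightarrow> y \<in> W \<Longrightarrow> x + y \<in> W"
  and W_scale: "x \<in> W \<Longrightarrow> of_rat q * x \<in> W"
  and W_0: "0 \<in> W"
  and W_diff: "x \<in> W \<Longrightarrow> y \<in> W \<Longrightarrow> x - y \<in> W"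
  and C_exp_W: "C_exp \<subseteq> W"
  and span_T_W: "span_rat T \<subseteq> W"
proof -
  interpret Q: vector_space "\<lambda>(q::rat) (z::complex). of_rat q * z" by (rule rat_vector_space)
  show "x \<in> W \<Longrightarrow> y \<in> W \<Longrightarrow> x + y \<in> W" unfolding W_def by (rule Q.span_add)
  show "x \<in> W \<Longrightarrow> of_rat q * x \<in> W" unfolding W_def by (rule Q.span_scale)
  show "0 \<in> W" unfolding W_def by (rule Q.span_zero)
  show "x \<in> W \<Longrightarrow> y \<in> W \<Longrightarrow> x - y \<in> W" unfolding W_def by (rule Q.span_diff)
  show "C_exp \<subseteq> W" unfolding W_def using Q.span_superset by blast
  show "span_rat T \<subseteq> W" unfolding W_def by (intro Q.span_mono) blast
qed

lemma W_lincomb: "(\<And>x. x \<in> Z \<Longrightarrow> x \<in> W) \<Longrightarrow> (\<Sum>x\<in>Z. of_rat (c x) * x) \<in> W"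
  by (induction Z rule: infinite_finite_induct) (auto simp: W_0 intro: W_add W_scale)

lemma Der_F_W:
  assumes "derivation D" "\<And>x. x \<in> F \<Longrightarrow> D x = 0" "w \<in> W"
  shows "D w = 0" "D (exp w) = 0"
proof -
  have V: "D v = 0" "D (exp v) = 0" if "v \<in> C_exp \<union> T" for v
  proof -
    show "D v = 0" using that assms(2) generators_in_F by blast
    show "D (exp v) = 0"
      using that assms(2) generators_in_F exp_in_C_exp_iff[of v] by blast
  qed
  show "D w = 0"
    using V assms(3) unfolding W_def by (rule derivation_span_rat(1)[OF assms(1)])
  show "D (exp w) = 0"
    using V assms(3) unfolding W_def by (rule derivation_span_rat(2)[OF assms(1)])
qed

lemma W_dcl_F: "w \<in> W \<Longrightarrow> w \<in> dcl F" "w \<in> W \<Longrightarrow> exp w \<in> dcl F"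
  using Der_F_W by (auto intro!: dclI)

lemma Der_F_exp_defect: "D \<in> Der_over F \<Longrightarrow> w \<in> W \<Longrightarrow> exp_defect D w = 0"
  using Der_F_W[of D w] unfolding exp_defect_def Der_over_def by simp

lemma exp_derivation_Der_C: "exp_derivation D \<Longrightarrow> D \<in> Der_over C_exp"
  unfolding Der_over_def using C_expD exp_derivation_derivation by blast

lemma Der_C_B_F: "D \<in> Der_over C_exp \<Longrightarrow> (\<And>b. b \<in> B \<Longrightarrow> D b = 0) \<Longrightarrow> D \<in> Der_over F"
  using B(3) dclD[of _ "C_exp \<union> B" D] unfolding Der_over_def by blast

text \<open>Ax's theorem makes the defects at \<open>S\<close> independent functionals on the
  derivations over \<open>C_exp\<close>, and such functionals take arbitrary values.\<close>

lemma dual_derivations: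
  obtains \<delta> where "\<And>s. s \<in> S \<Longrightarrow> \<delta> s \<in> Der_over C_exp"
    "\<And>s s'. s \<in> S \<Longrightarrow> s' \<in> S \<Longrightarrow> exp_defect (\<delta> s) s' = (if s' = s then 1 else 0)"
proof -
  have "\<exists>D\<in>Der_over C_exp. \<forall>s'\<in>S. exp_defect D s' = u s'" for u
  proof (rule independent_functionals_surjective[OF S(1)])
    show "\<forall>s\<in>S. l s = 0" if "\<And>D. D \<in> Der_over C_exp \<Longrightarrow> (\<Sum>s\<in>S. l s * exp_defect D s) = 0" for l
      by (rule exp_defect_independent[OF S(1,3)]) (use that in \<open>simp add: Der_over_def\<close>)
  qed (rule linear_functional_exp_defect)
  then have "\<forall>s\<in>S. \<exists>D\<in>Der_over C_exp. \<forall>s'\<in>S. exp_defect D s' = (if s' = s then 1 else 0)" by (intro ballI)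
  then show ?thesis using that by metis
qed

text \<open>By the count \<open>card B = card S + r\<close>, the derivations dual to \<open>S\<close> together with the \<open>d i\<close>
  span all derivations over \<open>C_exp\<close> modulo those that kill \<open>F\<close>.\<close>

lemma exp_derivation_on_F:
  assumes D: "D \<in> Der_over C_exp" "\<And>s. s \<in> S \<Longrightarrow> exp_defect D s = 0"
  shows "\<exists>E. exp_derivation E \<and> (\<lambda>x. D x - E x) \<in> Der_over F"
proof -
  obtain \<delta> where \<delta>: "\<And>s. s \<in> S \<Longrightarrow> \<delta> s \<in> Der_over C_exp"
    "\<And>s s'. s \<in> S \<Longrightarrow> s' \<in> S \<Longrightarrow> exp_defect (\<delta> s) s' = (if s' = s then 1 else 0)"
    using dual_derivations by blast
  define I where "I = S <+> {1..r}"
  define v where "v i = (case i of Inl s \<Rightarrow> \<delta> s | Inr j \<Rightarrow> d j)" for i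
  have I: "finite I" "card I = card B" using S(1) card_B by (auto simp: I_def card_Plus)
  have vC: "v i \<in> Der_over C_exp" if "i \<in> I" for i
    using that \<delta>(1) exp_derivation_Der_C[OF d] by (auto simp: I_def v_def)
  define G where "G c x = (\<Sum>i\<in>I. c i * v i x)" for c x
  have GC: "G c \<in> Der_over C_exp" for c
    unfolding G_def using vC by (rule Der_over_lincomb)
  have G_split: "G c x = (\<Sum>s\<in>S. c (Inl s) * \<delta> s x) + (\<Sum>j\<in>{1..r}. c (Inr j) * d j x)" for c x
    unfolding G_def I_def using S(1) by (simp add: sum.Plus v_def)
  have G_defect: "exp_defect (G c) s = c (Inl s)" if s: "s \<in> S" for c s
  proof -
    have "exp_defect (G c) s = (\<Sum>i\<in>I. c i * exp_defect (v i) s)"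
      unfolding G_def by (rule exp_defect_lincomb)
    also have "\<dots> = (\<Sum>s'\<in>S. c (Inl s') * exp_defect (\<delta> s') s) + (\<Sum>j\<in>{1..r}. c (Inr j) * exp_defect (d j) s)"
      unfolding I_def using S(1) by (simp add: sum.Plus v_def)
    also have "(\<Sum>s'\<in>S. c (Inl s') * exp_defect (\<delta> s') s) = (\<Sum>s'\<in>S. if s = s' then c (Inl s') else 0)"
      using \<delta>(2) s by (intro sum.cong) auto
    also have "\<dots> = c (Inl s)" using S(1) s by simp
    also have "(\<Sum>j\<in>{1..r}. c (Inr j) * exp_defect (d j) s) = 0"
      using exp_defect_exp_derivation[OF d] by simp
    finally show ?thesis by simp
  qed
  have S_W: "s \<in> W" if "s \<in> S" for s using that S(2) span_T_W by blast
  have exp_part: "exp_derivation (\<lambda>x. \<Sum>j\<in>{1..r}. c (Inr j) * d j x)" for c :: "complex + nat \<Rightarrow> complex"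
    using d by (rule exp_derivation_lincomb)
  have "\<exists>c. \<forall>b\<in>B. (\<Sum>i\<in>I. c i * v i b) = D b"
  proof (rule linear_system_solvable[OF B(1) I(1)])
    show "card B \<le> card I" using I(2) by simp
    \<comment> \<open>A combination that kills \<open>B\<close> kills \<open>F\<close>. It then has
      no defect at \<open>S\<close>, so its coefficients there vanish; the rest is exponential and
      kills \<open>T\<close>, hence each \<open>a k\<close>, so the other coefficients vanish
      too.\<close>
    fix c assume "\<forall>b\<in>B. (\<Sum>i\<in>I. c i * v i b) = 0"
    then have GF: "G c \<in> Der_over F" using Der_C_B_F[OF GC] by (simp add: G_def)
    have Inl: "c (Inl s) = 0" if "s \<in> S" for s
      using Der_F_exp_defect[OF GF S_W[OF that]] G_defect[OF that] by simp
    then have Geq: "G c = (\<lambda>x. \<Sum>j\<in>{1..r}. c (Inr j) * d j x)" by (auto simp: G_split)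
    then have "exp_derivation (G c)" using exp_part by simp
    moreover have "G c x = 0" if "x \<in> T" for x using Der_overD(2)[OF GF] that generators_in_F by blast
    ultimately have "G c (a k) = 0" if "k \<in> {1..r}" for k
      using a[OF that] unfolding ecl_def by blast
    moreover have "G c (a k) = c (Inr k)" if "k \<in> {1..r}" for k
    proof -
      have "G c (a k) = (\<Sum>j\<in>{1..r}. if j = k then c (Inr j) else 0)"
        unfolding Geq using d_a that by (intro sum.cong) auto
      then show ?thesis using that by simp
    qed
    ultimately show "\<forall>i\<in>I. c i = 0" using Inl by (auto simp: I_def)
  qed
  then obtain c where c: "\<forall>b\<in>B. G c b = D b" unfolding G_def by blast
  define H where "H x = D x + (- 1) * G c x" for x
  have HF: "H \<in> Der_over F"
  proof (rule Der_C_B_F)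
    show "H \<in> Der_over C_exp" unfolding H_def using D(1) GC by (rule Der_over_plus)
  qed (use c in \<open>simp add: H_def\<close>)
  have "c (Inl s) = 0" if "s \<in> S" for s
  proof -
    have "exp_defect H s = exp_defect D s - exp_defect (G c) s"
      unfolding H_def using exp_defect_diff[of D "G c"] by simp
    then show ?thesis using Der_F_exp_defect[OF HF S_W[OF that]] D(2)[OF that] G_defect[OF that] by simp
  qed
  then have "G c = (\<lambda>x. \<Sum>j\<in>{1..r}. c (Inr j) * d j x)" by (auto simp: G_split)
  then have "exp_derivation (G c)" using exp_part by simp
  then show ?thesis using HF unfolding H_def by (intro exI[of _ "G c"]) simp
qed

text \<open>The relation is completed to one over \<open>C_exp\<close> on
  \<open>Z \<union> S\<close>, to which Ax's theorem applies. Given \<open>D\<close> over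
  \<open>C_exp\<close>, the dual derivations remove its defects at \<open>S\<close>; the rest agrees
  on \<open>F\<close> with an exponential derivation, which has no defect at all, so the assumed
  relation applies to the rest.\<close>

theorem exp_defect_independent_over_F:
  assumes Z: "finite Z" "rat_independent_mod W Z"
    and rel: "\<And>D. D \<in> Der_over F \<Longrightarrow> (\<Sum>z\<in>Z. l z * exp_defect D z) = 0"
  shows "\<forall>z\<in>Z. l z = 0"
proof -
  obtain \<delta> where \<delta>: "\<And>s. s \<in> S \<Longrightarrow> \<delta> s \<in> Der_over C_exp"
    "\<And>s s'. s \<in> S \<Longrightarrow> s' \<in> S \<Longrightarrow> exp_defect (\<delta> s) s' = (if s' = s then 1 else 0)"
    using dual_derivations by blast
  have S_W: "s \<in> W" if "s \<in> S" for s using that S(2) span_T_W by blast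
  have disj: "Z \<inter> S = {}"
  proof (rule ccontr)
    assume "Z \<inter> S \<noteq> {}"
    then obtain z where z: "z \<in> Z" "z \<in> S" by blast
    define c :: "complex \<Rightarrow> rat" where "c x = (if x = z then 1 else 0)" for x
    have "(\<Sum>x\<in>Z. of_rat (c x) * x) = (\<Sum>x\<in>Z. if x = z then x else 0)"
      by (intro sum.cong) (auto simp: c_def)
    then have "(\<Sum>x\<in>Z. of_rat (c x) * x) \<in> W" using z Z(1) S_W by simp
    then have "\<forall>x\<in>Z. c x = 0" using Z(2) unfolding rat_independent_mod_def by blast
    then have "c z = 0" using z(1) by blast
    then show False by (simp add: c_def)
  qed
  \<comment> \<open>The coefficients at \<open>S\<close> offset what the correction \<open>G\<close>
    below contributes to the defects at \<open>Z\<close>.\<close>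
  define m where "m x = (if x \<in> Z then l x else - (\<Sum>z\<in>Z. l z * exp_defect (\<delta> x) z))" for x
  have "\<forall>x\<in>Z \<union> S. m x = 0"
  proof (rule exp_defect_independent)
    show "finite (Z \<union> S)" using Z(1) S(1) by simp
    show "rat_independent_mod C_exp (Z \<union> S)"
      unfolding rat_independent_mod_def
    proof (intro allI impI)
      fix c :: "complex \<Rightarrow> rat"
      assume "(\<Sum>x\<in>Z \<union> S. of_rat (c x) * x) \<in> C_exp"
      then have sum: "(\<Sum>x\<in>Z. of_rat (c x) * x) + (\<Sum>x\<in>S. of_rat (c x) * x) \<in> C_exp" (is "?z + ?s \<in> _")
        using disj Z(1) S(1) by (simp add: sum.union_disjoint)
      have "?s \<in> W" using S_W by (rule W_lincomb)
      then have "?z \<in> W" using W_diff[of "?z + ?s" ?s] sum C_exp_W by auto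
      then have cZ: "\<forall>x\<in>Z. c x = 0" using Z(2) unfolding rat_independent_mod_def by blast
      then have "?s \<in> C_exp" using sum by simp
      then have "\<forall>x\<in>S. c x = 0" using S(3) unfolding rat_independent_mod_def by blast
      then show "\<forall>x\<in>Z \<union> S. c x = 0" using cZ by blast
    qed
    fix D assume D: "derivation D" "\<And>c. c \<in> C_exp \<Longrightarrow> D c = 0"
    then have DC: "D \<in> Der_over C_exp" by (simp add: Der_over_def)
    define G where "G x = (\<Sum>s\<in>S. exp_defect D s * \<delta> s x)" for x
    define H where "H x = D x + (- 1) * G x" for x
    have HC: "H \<in> Der_over C_exp"
      unfolding H_def G_def using DC \<delta>(1) by (intro Der_over_plus Der_over_lincomb)
    have defect_G: "exp_defect G x = (\<Sum>s\<in>S. exp_defect D s * exp_defect (\<delta> s) x)" for x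
      unfolding G_def by (rule exp_defect_lincomb)
    have defect_H: "exp_defect H x = exp_defect D x - exp_defect G x" for x
      unfolding H_def using exp_defect_diff[of D G] by simp
    have "exp_defect H s = 0" if "s \<in> S" for s
    proof -
      have "exp_defect G s = (\<Sum>s'\<in>S. if s = s' then exp_defect D s' else 0)"
        unfolding defect_G using \<delta>(2) that by (intro sum.cong) auto
      then show ?thesis using S(1) that by (simp add: defect_H)
    qed
    then obtain E where E: "exp_derivation E" "(\<lambda>x. H x - E x) \<in> Der_over F"
      using exp_derivation_on_F[OF HC] by blast
    have "(\<Sum>z\<in>Z. l z * exp_defect H z) = 0"
      using rel[OF E(2)] exp_defect_exp_derivation[OF E(1)] by (simp add: exp_defect_diff)
    then have "(\<Sum>z\<in>Z. l z * exp_defect D z) = (\<Sum>z\<in>Z. l z * exp_defect G z)"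
      by (simp add: defect_H right_diff_distrib sum_subtractf)
    also have "\<dots> = (\<Sum>z\<in>Z. \<Sum>s\<in>S. l z * (exp_defect D s * exp_defect (\<delta> s) z))"
      by (simp add: defect_G sum_distrib_left)
    also have "\<dots> = (\<Sum>s\<in>S. \<Sum>z\<in>Z. l z * (exp_defect D s * exp_defect (\<delta> s) z))" by (rule sum.swap)
    also have "\<dots> = - (\<Sum>s\<in>S. m s * exp_defect D s)"
    proof -
      have "m s * exp_defect D s = - (\<Sum>z\<in>Z. l z * (exp_defect D s * exp_defect (\<delta> s) z))" if "s \<in> S" for s
        using that disj by (auto simp: m_def sum_distrib_left mult_ac)
      then show ?thesis by (simp add: sum_negf)
    qed
    finally have "(\<Sum>z\<in>Z. l z * exp_defect D z) + (\<Sum>s\<in>S. m s * exp_defect D s) = 0" by simp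
    moreover have "(\<Sum>z\<in>Z. m z * exp_defect D z) = (\<Sum>z\<in>Z. l z * exp_defect D z)" by (simp add: m_def)
    ultimately show "(\<Sum>x\<in>Z \<union> S. m x * exp_defect D x) = 0"
      using disj Z(1) S(1) by (simp add: sum.union_disjoint)
  qed
  moreover have "m z = l z" if "z \<in> Z" for z using that by (simp add: m_def)
  ultimately show ?thesis by (metis UnI1)
qed

end

section \<open>Towers of exponentials and logarithms\<close>

text \<open>The elements are absorbed one by one, and monotonicity of \<open>h\<close> keeps those
  already absorbed. The set \<open>h A\<close> stands for the generators that a chain contributes,
  so both kinds of chains are covered.\<close>

lemma finite_chain_extension:
  assumes "finite U" "chain A" and mono: "\<And>A A'. A \<subseteq> A' \<Longrightarrow> h A \<subseteq> h A'"
    and step: "\<And>t A. t \<in> U \<Longrightarrow> chain A \<Longrightarrow> \<exists>A'. A \<subseteq> A' \<and> chain A' \<and> t \<in> dcl (h A')"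
  shows "\<exists>A'. A \<subseteq> A' \<and> chain A' \<and> U \<subseteq> dcl (h A')"
  using assms(1,2) step
proof (induction U arbitrary: A rule: finite_induct)
  case empty
  then show ?case by blast
next
  case (insert t U)
  obtain A1 where A1: "A \<subseteq> A1" "chain A1" "U \<subseteq> dcl (h A1)"
    using insert.IH[OF insert.prems(1)] insert.prems(2) by blast
  obtain A2 where A2: "A1 \<subseteq> A2" "chain A2" "t \<in> dcl (h A2)"
    using insert.prems(2)[of t A1] A1(2) by blast
  have "dcl (h A1) \<subseteq> dcl (h A2)" by (intro dcl_mono mono A2(1))
  then show ?case using A1 A2 by (intro exI[of _ A2]) auto
qed

lemma rat_independent_mod_empty: "rat_independent_mod V {}"
  by (simp add: rat_independent_mod_def)

lemma is_subfield_UN_incseq: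
  assumes "incseq f" "\<And>n. is_subfield (f n)"
  shows "is_subfield (\<Union>n. f n)"
  unfolding is_subfield_def
proof (intro conjI ballI)
  show "1 \<in> (\<Union>n. f n)" using is_subfield_1[OF assms(2)[of 0]] by blast
  fix a assume "a \<in> (\<Union>n. f n)"
  then obtain i where i: "a \<in> f i" by blast
  show "- a \<in> (\<Union>n. f n)" using is_subfield_minus[OF assms(2) i] by blast
  show "inverse a \<in> (\<Union>n. f n)" using is_subfield_inverse[OF assms(2) i] by blast
  fix b assume "b \<in> (\<Union>n. f n)"
  then obtain j where j: "b \<in> f j" by blast
  have ab: "a \<in> f (max i j)" "b \<in> f (max i j)"
    using i j incseqD[OF assms(1), of i "max i j"] incseqD[OF assms(1), of j "max i j"] by auto
  show "a + b \<in> (\<Union>n. f n)" using is_subfield_add[OF assms(2) ab] by blast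
  show "a * b \<in> (\<Union>n. f n)" using is_subfield_mult[OF assms(2) ab] by blast
qed

context exponential_base
begin

section \<open>Dependence modulo \<open>W\<close> and chains\<close>

lemma dependent_imp_lincomb:
  assumes A: "finite A" "rat_independent_mod W A"
    and x: "x \<in> A \<or> \<not> rat_independent_mod W (insert x A)"
  shows "\<exists>q. x - (\<Sum>z\<in>A. of_rat (q z) * z) \<in> W"
proof (cases "x \<in> A")
  case True
  have "(\<Sum>z\<in>A. of_rat (if z = x then 1 else 0) * z) = (\<Sum>z\<in>A. if z = x then z else 0)"
    by (intro sum.cong) auto
  then have "x - (\<Sum>z\<in>A. of_rat (if z = x then 1 else 0) * z) \<in> W" using True A(1) W_0 by simp
  then show ?thesis by (intro exI[of _ "\<lambda>z. if z = x then 1 else 0"])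
next
  case False
  then obtain c where c: "(\<Sum>z\<in>insert x A. of_rat (c z) * z) \<in> W" "\<exists>z\<in>insert x A. c z \<noteq> 0"
    using x unfolding rat_independent_mod_def by blast
  have sum: "of_rat (c x) * x + (\<Sum>z\<in>A. of_rat (c z) * z) \<in> W" using c(1) False A(1) by simp
  have cx: "c x \<noteq> 0"
  proof
    assume "c x = 0"
    then have "(\<Sum>z\<in>A. of_rat (c z) * z) \<in> W" using sum by simp
    then have "\<forall>z\<in>A. c z = 0" using A(2) unfolding rat_independent_mod_def by blast
    then show False using c(2) \<open>c x = 0\<close> by blast
  qed
  have "of_rat (inverse (c x)) * (of_rat (c x) * x + (\<Sum>z\<in>A. of_rat (c z) * z)) \<in> W"
    using sum by (rule W_scale)
  also have "of_rat (inverse (c x)) * (of_rat (c x) * x + (\<Sum>z\<in>A. of_rat (c z) * z)) =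
      x - (\<Sum>z\<in>A. of_rat (- inverse (c x) * c z) * z)"
  proof -
    have "of_rat (inverse (c x)) * (of_rat (c x) * x) = x"
      using cx by (simp add: of_rat_inverse)
    then show ?thesis
      by (simp add: distrib_left sum_distrib_left of_rat_mult of_rat_minus sum_negf mult.assoc)
  qed
  finally show ?thesis by (intro exI[of _ "\<lambda>z. - inverse (c x) * c z"])
qed

text \<open>Rational multiples of exponents only introduce roots of exponentials; in terms of
  derivations, \<open>D (exp z) / exp z\<close> is additive in \<open>z\<close>.\<close>

lemma exp_lincomb_dcl:
  assumes "\<And>z. z \<in> A \<Longrightarrow> exp z \<in> dcl V"
  shows "exp (\<Sum>z\<in>A. of_rat (q z) * z) \<in> dcl V"
proof (rule dclI)
  fix D assume D: "derivation D" "\<And>s. s \<in> V \<Longrightarrow> D s = 0"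
  let ?f = "\<lambda>z. D (exp z) / exp z"
  have "?f (\<Sum>z\<in>A. of_rat (q z) * z) = (\<Sum>z\<in>A. of_rat (q z) * ?f z)"
    by (rule additive_rat_lincomb) (rule log_derivative_add[OF D(1)])
  moreover have "D (exp z) = 0" if "z \<in> A" for z using dclD[OF assms[OF that] D] .
  ultimately show "D (exp (\<Sum>z\<in>A. of_rat (q z) * z)) = 0" by simp
qed

lemma lincomb_dcl:
  assumes "\<And>z. z \<in> A \<Longrightarrow> z \<in> dcl V"
  shows "(\<Sum>z\<in>A. of_rat (q z) * z) \<in> dcl V"
  using assms by (intro is_subfield_sum[OF is_subfield_dcl] is_subfield_mult[OF is_subfield_dcl]
      is_subfield_of_rat[OF is_subfield_dcl])

text \<open>The exponents in the order of their use. One enters only if it is new modulo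
  \<open>W\<close>; for the others the exponential is already algebraic over what is
  present.\<close>

inductive E_chain :: "complex set \<Rightarrow> bool" where
  empty: "E_chain {}"
| insert: "E_chain A \<Longrightarrow> x \<notin> A \<Longrightarrow> x \<in> dcl (F \<union> exp ` A) \<Longrightarrow> rat_independent_mod W (insert x A) \<Longrightarrow>
    E_chain (insert x A)"

text \<open>The mirror image of \<open>E_chain\<close>: the elements themselves are the new
  generators, and their exponentials are what is already algebraic.\<close>

inductive L_chain :: "complex set \<Rightarrow> bool" where
  empty: "L_chain {}"
| insert: "L_chain A \<Longrightarrow> x \<notin> A \<Longrightarrow> exp x \<in> dcl (F \<union> A) \<Longrightarrow> rat_independent_mod W (insert x A) \<Longrightarrow>
    L_chain (insert x A)"

lemma E_chain_props:
  assumes "E_chain A"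
  shows "finite A \<and> rat_independent_mod W A \<and> A \<subseteq> dcl (F \<union> exp ` A)"
  using assms
proof (induction rule: E_chain.induct)
  case empty
  then show ?case by (simp add: rat_independent_mod_empty)
next
  case (insert A x)
  have "dcl (F \<union> exp ` A) \<subseteq> dcl (F \<union> exp ` insert x A)" by (intro dcl_mono) auto
  then show ?case using insert by auto
qed

lemma L_chain_props:
  assumes "L_chain A"
  shows "finite A \<and> rat_independent_mod W A \<and> exp ` A \<subseteq> dcl (F \<union> A)"
  using assms
proof (induction rule: L_chain.induct)
  case empty
  then show ?case by (simp add: rat_independent_mod_empty)
next
  case (insert A x)
  have "dcl (F \<union> A) \<subseteq> dcl (F \<union> insert x A)" by (intro dcl_mono) auto
  then show ?case using insert by auto
qed

lemma dependent_dcl: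
  assumes A: "finite A" "rat_independent_mod W A"
    and x: "x \<in> A \<or> \<not> rat_independent_mod W (insert x A)"
  shows "x \<in> dcl (F \<union> A)" "exp x \<in> dcl (F \<union> exp ` A)"
proof -
  obtain q where q: "x - (\<Sum>z\<in>A. of_rat (q z) * z) \<in> W" using dependent_imp_lincomb[OF assms] by blast
  define w where "w = x - (\<Sum>z\<in>A. of_rat (q z) * z)"
  have w: "w \<in> dcl F" "exp w \<in> dcl F" using W_dcl_F q unfolding w_def by auto
  have x_eq: "x = w + (\<Sum>z\<in>A. of_rat (q z) * z)" by (simp add: w_def)
  have w': "w \<in> dcl (F \<union> A)" "exp w \<in> dcl (F \<union> exp ` A)"
    using w dcl_mono[of F "F \<union> A"] dcl_mono[of F "F \<union> exp ` A"] by auto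
  have "(\<Sum>z\<in>A. of_rat (q z) * z) \<in> dcl (F \<union> A)"
    using dcl_superset[of "F \<union> A"] by (intro lincomb_dcl) auto
  then show "x \<in> dcl (F \<union> A)" using is_subfield_add[OF is_subfield_dcl w'(1)] x_eq by simp
  have "exp (\<Sum>z\<in>A. of_rat (q z) * z) \<in> dcl (F \<union> exp ` A)"
    using dcl_superset[of "F \<union> exp ` A"] by (intro exp_lincomb_dcl) auto
  then show "exp x \<in> dcl (F \<union> exp ` A)"
    using is_subfield_mult[OF is_subfield_dcl w'(2)] x_eq by (simp add: exp_add)
qed

lemma dcl_F: "cx_alg_closure F = dcl F"
  unfolding F_def by (simp add: cx_alg_closure_generate_field dcl_generate_field)

text \<open>The initial chain is arbitrary so that finitely many elements of the tower can be placed
  over one common chain.\<close>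

lemma E_tower_chain:
  assumes "x \<in> E_tower F n" "E_chain A"
  shows "\<exists>A'. A \<subseteq> A' \<and> E_chain A' \<and> x \<in> dcl (F \<union> exp ` A')"
  using assms
proof (induction n arbitrary: x A)
  case 0
  then show ?case using dcl_mono[of F "F \<union> exp ` A"] by (auto simp: dcl_F)
next
  case (Suc n)
  have "x \<in> dcl (E_tower F n \<union> {exp x |x. x \<in> E_tower F n})"
    using Suc.prems(1) by (simp add: cx_alg_closure_generate_field)
  then obtain U where U: "U \<subseteq> E_tower F n \<union> {exp x |x. x \<in> E_tower F n}" "finite U" "x \<in> dcl U"
    by (rule dcl_finite_character)
  have "\<exists>A'. A \<subseteq> A' \<and> E_chain A' \<and> U \<subseteq> dcl (F \<union> exp ` A')"
  proof (rule finite_chain_extension[where chain = E_chain and h = "\<lambda>A. F \<union> exp ` A", OF U(2) Suc.prems(2)])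
    fix t A assume t: "t \<in> U" and A: "E_chain A"
    show "\<exists>A'. A \<subseteq> A' \<and> E_chain A' \<and> t \<in> dcl (F \<union> exp ` A')"
    proof (cases "t \<in> E_tower F n")
      case True
      then show ?thesis using Suc.IH A by blast
    next
      case False
      then obtain s where s: "t = exp s" "s \<in> E_tower F n" using t U(1) by blast
      then obtain A1 where A1: "A \<subseteq> A1" "E_chain A1" "s \<in> dcl (F \<union> exp ` A1)" using Suc.IH A by blast
      show ?thesis
      proof (cases "s \<in> A1 \<or> \<not> rat_independent_mod W (insert s A1)")
        case True
        then have "t \<in> dcl (F \<union> exp ` A1)"
          using dependent_dcl(2)[of A1 s] E_chain_props[OF A1(2)] s(1) by blast
        then show ?thesis using A1 by blast
      next
        case False
        then have "E_chain (insert s A1)" using A1 by (blast intro: E_chain.insert)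
        moreover have "t \<in> dcl (F \<union> exp ` insert s A1)"
          using dcl_superset[of "F \<union> exp ` insert s A1"] s(1) by blast
        ultimately show ?thesis using A1(1) by blast
      qed
    qed
  qed auto
  then show ?case using dcl_least[of U] U(3) by blast
qed

lemma L_tower_chain:
  assumes "x \<in> L_tower F n" "L_chain A"
  shows "\<exists>A'. A \<subseteq> A' \<and> L_chain A' \<and> x \<in> dcl (F \<union> A')"
  using assms
proof (induction n arbitrary: x A)
  case 0
  then show ?case using dcl_mono[of F "F \<union> A"] by (auto simp: dcl_F)
next
  case (Suc n)
  have "x \<in> dcl (L_tower F n \<union> {x. exp x \<in> L_tower F n})"
    using Suc.prems(1) by (simp add: cx_alg_closure_generate_field)
  then obtain U where U: "U \<subseteq> L_tower F n \<union> {x. exp x \<in> L_tower F n}" "finite U" "x \<in> dcl U"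
    by (rule dcl_finite_character)
  have "\<exists>A'. A \<subseteq> A' \<and> L_chain A' \<and> U \<subseteq> dcl (F \<union> A')"
  proof (rule finite_chain_extension[where chain = L_chain and h = "\<lambda>A. F \<union> A", OF U(2) Suc.prems(2)])
    fix t A assume t: "t \<in> U" and A: "L_chain A"
    show "\<exists>A'. A \<subseteq> A' \<and> L_chain A' \<and> t \<in> dcl (F \<union> A')"
    proof (cases "t \<in> L_tower F n")
      case True
      then show ?thesis using Suc.IH A by blast
    next
      case False
      then have "exp t \<in> L_tower F n" using t U(1) by blast
      then obtain A1 where A1: "A \<subseteq> A1" "L_chain A1" "exp t \<in> dcl (F \<union> A1)" using Suc.IH A by blast
      show ?thesis
      proof (cases "t \<in> A1 \<or> \<not> rat_independent_mod W (insert t A1)")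
        case True
        then have "t \<in> dcl (F \<union> A1)"
          using dependent_dcl(1)[of A1 t] L_chain_props[OF A1(2)] by blast
        then show ?thesis using A1 by blast
      next
        case False
        then have "L_chain (insert t A1)" using A1 by (blast intro: L_chain.insert)
        moreover have "t \<in> dcl (F \<union> insert t A1)"
          using dcl_superset[of "F \<union> insert t A1"] by blast
        ultimately show ?thesis using A1(1) by blast
      qed
    qed
  qed auto
  then show ?case using dcl_least[of U] U(3) by blast
qed

section \<open>Freeness of the two towers\<close>

text \<open>Dual form of the algebraic independence of \<open>exp ` A \<union> A'\<close> over \<open>F\<close>.\<close>

definition free_pair :: "complex set \<Rightarrow> complex set \<Rightarrow> bool" where
  "free_pair A A' \<longleftrightarrow>
     (\<forall>u v. \<exists>D\<in>Der_over F. (\<forall>x\<in>A. D (exp x) = u x) \<and> (\<forall>y\<in>A'. D y = v y))"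

text \<open>The last property holds because a derivation over \<open>F\<close> differs from a
  combination of the \<open>e x\<close> by one that kills the exponentials of
  \<open>A\<close>.\<close>

lemma free_pair_duals:
  assumes "free_pair A A'" "finite A"
  obtains e where "\<And>x. x \<in> A \<Longrightarrow> e x \<in> Der_over (F \<union> A')"
    "\<And>x y. x \<in> A \<Longrightarrow> y \<in> A \<Longrightarrow> e x (exp y) = (if y = x then 1 else 0)"
    "\<And>z. z \<in> dcl (F \<union> exp ` A) \<Longrightarrow> (\<And>x. x \<in> A \<Longrightarrow> e x z = 0) \<Longrightarrow> z \<in> dcl F"
proof -
  have "\<forall>x. \<exists>D\<in>Der_over F. (\<forall>y\<in>A. D (exp y) = (if y = x then 1 else 0)) \<and> (\<forall>y\<in>A'. D y = 0)"
    using assms(1)[unfolded free_pair_def] by (intro allI) (elim allE)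
  then obtain e where e: "\<And>x. e x \<in> Der_over F" "\<And>x y. y \<in> A \<Longrightarrow> e x (exp y) = (if y = x then 1 else 0)"
    "\<And>x y. y \<in> A' \<Longrightarrow> e x y = 0" by metis
  have 1: "e x \<in> Der_over (F \<union> A')" for x
    using e(1)[of x] e(3)[of _ x] unfolding Der_over_def by blast
  have "z \<in> dcl F" if z: "z \<in> dcl (F \<union> exp ` A)" "\<And>x. x \<in> A \<Longrightarrow> e x z = 0" for z
  proof (rule dclI)
    fix D assume D: "derivation D" "\<And>s. s \<in> F \<Longrightarrow> D s = 0"
    then have DF: "D \<in> Der_over F" by (simp add: Der_over_def)
    define G where "G y = D y + (- 1) * (\<Sum>x\<in>A. D (exp x) * e x y)" for y
    have GF: "G \<in> Der_over F" unfolding G_def using DF e(1) by (intro Der_over_plus Der_over_lincomb)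
    have "G (exp y) = 0" if "y \<in> A" for y
    proof -
      have "(\<Sum>x\<in>A. D (exp x) * e x (exp y)) = (\<Sum>x\<in>A. if y = x then D (exp x) else 0)"
        using e(2)[OF that] by (intro sum.cong) auto
      then show ?thesis using assms(2) that by (simp add: G_def)
    qed
    then have "G \<in> Der_over (F \<union> exp ` A)" using GF unfolding Der_over_def by blast
    then have "G z = 0" using z(1) by (rule Der_over_dcl)
    then show "D z = 0" using z(2) by (simp add: G_def)
  qed
  then show ?thesis using that[of e] 1 e(2) by blast
qed

text \<open>The derivations dual to the exponentials of \<open>A\<close> kill \<open>A'\<close> and
  so everything algebraic over \<open>F\<close> and \<open>A'\<close>.\<close>

lemma free_pair_Int:
  assumes "free_pair A A'" "finite A" "z \<in> dcl (F \<union> exp ` A)" "z \<in> dcl (F \<union> A')"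
  shows "z \<in> dcl F"
proof -
  obtain e where e: "\<And>x. x \<in> A \<Longrightarrow> e x \<in> Der_over (F \<union> A')"
    "\<And>z. z \<in> dcl (F \<union> exp ` A) \<Longrightarrow> (\<And>x. x \<in> A \<Longrightarrow> e x z = 0) \<Longrightarrow> z \<in> dcl F"
    using free_pair_duals[OF assms(1,2)] by metis
  show ?thesis using e(2)[OF assms(3)] Der_over_dcl[OF e(1) assms(4)] by blast
qed

text \<open>By the two algebraicity assumptions, a derivation over \<open>F\<close> that kills the
  exponentials of \<open>A\<close> and the elements of \<open>A'\<close> has no defect on
  \<open>Z\<close>. On the span of the derivations dual to the defects, prescribing these values is
  a square linear system with trivial kernel, hence solvable.\<close>

lemma independent_free_pair:
  assumes A: "finite A" "A \<subseteq> dcl (F \<union> exp ` A)" and A': "finite A'" "exp ` A' \<subseteq> dcl (F \<union> A')"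
    and disj: "A \<inter> A' = {}" and indep: "rat_independent_mod W (A \<union> A')"
  shows "free_pair A A'"
  unfolding free_pair_def
proof (intro allI)
  fix u v :: "complex \<Rightarrow> complex"
  define Z where "Z = A \<union> A'"
  have Z: "finite Z" "rat_independent_mod W Z" using A A' indep by (auto simp: Z_def)
  have "\<exists>D\<in>Der_over F. \<forall>z\<in>Z. exp_defect D z = f z" for f
  proof (rule independent_functionals_surjective[OF Z(1)])
    show "\<forall>z\<in>Z. l z = 0" if "\<And>D. D \<in> Der_over F \<Longrightarrow> (\<Sum>z\<in>Z. l z * exp_defect D z) = 0" for l
      by (rule exp_defect_independent_over_F[OF Z]) (rule that)
  qed (rule linear_functional_exp_defect)
  then have "\<forall>y\<in>Z. \<exists>D\<in>Der_over F. \<forall>z\<in>Z. exp_defect D z = (if z = y then 1 else 0)" by (intro ballI)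
  then obtain e where e: "\<And>y. y \<in> Z \<Longrightarrow> e y \<in> Der_over F"
    "\<And>y z. y \<in> Z \<Longrightarrow> z \<in> Z \<Longrightarrow> exp_defect (e y) z = (if z = y then 1 else 0)" by metis
  define arg where "arg z = (if z \<in> A then exp z else z)" for z
  define G where "G c x = (\<Sum>y\<in>Z. c y * e y x)" for c x
  have GF: "G c \<in> Der_over F" for c unfolding G_def using e(1) by (rule Der_over_lincomb)
  have "\<exists>c. \<forall>z\<in>Z. (\<Sum>y\<in>Z. c y * e y (arg z)) = (if z \<in> A then u z else v z)"
  proof (rule linear_system_solvable[OF Z(1) Z(1)])
    fix c assume "\<forall>z\<in>Z. (\<Sum>y\<in>Z. c y * e y (arg z)) = 0"
    then have G0: "\<And>z. z \<in> Z \<Longrightarrow> G c (arg z) = 0" by (simp add: G_def)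
    have "G c (exp z) = 0" if "z \<in> A" for z using G0[of z] that by (simp add: arg_def Z_def)
    then have GA: "G c \<in> Der_over (F \<union> exp ` A)" using GF[of c] unfolding Der_over_def by blast
    have "G c z = 0" if "z \<in> A'" for z
    proof -
      have "z \<notin> A" using that disj by blast
      then show ?thesis using G0[of z] that by (simp add: arg_def Z_def)
    qed
    then have GA': "G c \<in> Der_over (F \<union> A')" using GF[of c] unfolding Der_over_def by blast
    have zero: "G c z = 0 \<and> G c (exp z) = 0" if "z \<in> Z" for z
    proof (cases "z \<in> A")
      case True
      then show ?thesis using Der_over_dcl[OF GA, of z] Der_over_dcl[OF GA, of "exp z"] A(2)
          dcl_superset[of "F \<union> exp ` A"] by blast
    next
      case False
      then have "z \<in> A'" using that by (simp add: Z_def)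
      then show ?thesis using Der_over_dcl[OF GA', of z] Der_over_dcl[OF GA', of "exp z"] A'(2)
          dcl_superset[of "F \<union> A'"] by blast
    qed
    have "c z = 0" if z: "z \<in> Z" for z
    proof -
      have "exp_defect (G c) z = (\<Sum>y\<in>Z. c y * exp_defect (e y) z)"
        unfolding G_def by (rule exp_defect_lincomb)
      also have "\<dots> = (\<Sum>y\<in>Z. if z = y then c y else 0)" using e(2) z by (intro sum.cong) auto
      also have "\<dots> = c z" using z Z(1) by simp
      finally show ?thesis using zero[OF z] by (simp add: exp_defect_def)
    qed
    then show "\<forall>z\<in>Z. c z = 0" by blast
  qed simp
  then obtain c where c: "\<And>z. z \<in> Z \<Longrightarrow> G c (arg z) = (if z \<in> A then u z else v z)"
    unfolding G_def by blast
  have "G c (exp x) = u x" if "x \<in> A" for x using c[of x] that by (simp add: arg_def Z_def)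
  moreover have "G c y = v y" if "y \<in> A'" for y
  proof -
    have "y \<notin> A" using that disj by blast
    then show ?thesis using c[of y] that by (simp add: arg_def Z_def)
  qed
  ultimately show "\<exists>D\<in>Der_over F. (\<forall>x\<in>A. D (exp x) = u x) \<and> (\<forall>y\<in>A'. D y = v y)" using GF by blast
qed

text \<open>A common element, taken with opposite signs, is a witness. Otherwise, if the sum over
  \<open>A\<close> were in \<open>W\<close>, so would be the sum over \<open>A'\<close>, and the
  independence of both sets would annihilate all coefficients.\<close>

lemma dependent_pair:
  assumes A: "finite A" "rat_independent_mod W A" and A': "finite A'" "rat_independent_mod W A'"
    and dep: "\<not> (A \<inter> A' = {} \<and> rat_independent_mod W (A \<union> A'))"
  obtains q s where "(\<Sum>x\<in>A. of_rat (q x) * x) + (\<Sum>y\<in>A'. of_rat (s y) * y) \<in> W"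
    "(\<Sum>x\<in>A. of_rat (q x) * x) \<notin> W"
proof (cases "A \<inter> A' = {}")
  case False
  then obtain z where z: "z \<in> A" "z \<in> A'" by blast
  define q :: "complex \<Rightarrow> rat" where "q x = (if x = z then 1 else 0)" for x
  have sum: "(\<Sum>x\<in>V. of_rat (q x) * x) = z" if "finite V" "z \<in> V" for V
  proof -
    have "(\<Sum>x\<in>V. of_rat (q x) * x) = (\<Sum>x\<in>V. if x = z then x else 0)"
      by (intro sum.cong) (auto simp: q_def)
    then show ?thesis using that by simp
  qed
  have "(\<Sum>x\<in>A. of_rat (q x) * x) \<notin> W"
  proof
    assume "(\<Sum>x\<in>A. of_rat (q x) * x) \<in> W"
    then have "\<forall>x\<in>A. q x = 0" using A(2) unfolding rat_independent_mod_def by blast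
    then have "q z = 0" using z(1) by blast
    then show False by (simp add: q_def)
  qed
  moreover have "(\<Sum>y\<in>A'. of_rat (- q y) * y) = - z"
    using sum[OF A'(1) z(2)] by (simp add: of_rat_minus sum_negf)
  ultimately show ?thesis using that[of q "\<lambda>y. - q y"] sum[OF A(1) z(1)] W_0 by simp
next
  case True
  then obtain c where c: "(\<Sum>x\<in>A \<union> A'. of_rat (c x) * x) \<in> W" "\<exists>x\<in>A \<union> A'. c x \<noteq> 0"
    using dep unfolding rat_independent_mod_def by blast
  have sum: "(\<Sum>x\<in>A. of_rat (c x) * x) + (\<Sum>x\<in>A'. of_rat (c x) * x) \<in> W" (is "?a + ?b \<in> W")
    using c(1) True A(1) A'(1) by (simp add: sum.union_disjoint)
  have "?a \<notin> W"
  proof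
    assume a: "?a \<in> W"
    then have "?b \<in> W" using W_diff[OF sum a] by simp
    then show False using a A(2) A'(2) c(2) unfolding rat_independent_mod_def by blast
  qed
  then show ?thesis using that[of c c] sum by blast
qed

text \<open>Derivations over \<open>F\<close> would have no defect at \<open>x\<close>, against the
  independence of that single defect for \<open>x\<close> outside \<open>W\<close>.\<close>

lemma exp_transcendental_over_F:
  assumes "x \<in> dcl F" "exp x \<in> dcl F"
  shows "x \<in> W"
proof (rule ccontr)
  assume x: "x \<notin> W"
  have "rat_independent_mod W {x}"
    unfolding rat_independent_mod_def
  proof (intro allI impI ballI)
    fix c :: "complex \<Rightarrow> rat" and y assume c: "(\<Sum>z\<in>{x}. of_rat (c z) * z) \<in> W" and y: "y \<in> {x}"
    show "c y = 0"
    proof (rule ccontr)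
      assume "c y \<noteq> 0"
      then have eq: "of_rat (inverse (c x)) * (of_rat (c x) * x) = x" using y by (simp add: of_rat_inverse)
      have "of_rat (inverse (c x)) * (of_rat (c x) * x) \<in> W" by (rule W_scale) (use c in simp)
      then show False using x unfolding eq by simp
    qed
  qed
  moreover have "(\<Sum>z\<in>{x}. 1 * exp_defect D z) = 0" if "D \<in> Der_over F" for D
    using Der_over_dcl[OF that assms(1)] Der_over_dcl[OF that assms(2)] by (simp add: exp_defect_def)
  ultimately have "\<forall>z\<in>{x}. (1::complex) = 0"
    by (intro exp_defect_independent_over_F) auto
  then show False by simp
qed

text \<open>Induction on both lengths is realised by nesting: the outer hypothesis drops the last
  element of \<open>A\<close> and holds for every \<open>A'\<close>, the inner one drops the last
  element of \<open>A'\<close>.\<close>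

theorem chains_free:
  assumes "E_chain A" "L_chain A'"
  shows "free_pair A A'"
  using assms
proof (induction arbitrary: A' rule: E_chain.induct)
  case empty
  show ?case using L_chain_props[OF empty.prems] by (intro independent_free_pair) auto
next
  case (insert A x)
  have Ex: "E_chain (insert x A)" using insert.hyps by (rule E_chain.insert)
  note EP = E_chain_props[OF insert.hyps(1)] and EPx = E_chain_props[OF Ex]
  show ?case using insert.prems
  proof (induction rule: L_chain.induct)
    case empty
    show ?case using EPx by (intro independent_free_pair) auto
  next
    case (insert A' y)
    note IH_L = insert.IH
    have Ly: "L_chain (insert y A')" using insert.hyps by (rule L_chain.insert)
    note LP = L_chain_props[OF insert.hyps(1)] and LPy = L_chain_props[OF Ly]
    let ?A = "insert x A" and ?A' = "insert y A'"
    show ?case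
    proof (cases "?A \<inter> ?A' = {} \<and> rat_independent_mod W (?A \<union> ?A')")
      case True
      then show ?thesis using EPx LPy by (intro independent_free_pair) auto
    next
      case False
      then obtain q s where qs: "(\<Sum>x\<in>?A. of_rat (q x) * x) + (\<Sum>y\<in>?A'. of_rat (s y) * y) \<in> W" (is "?a + ?b \<in> W")
        "(\<Sum>x\<in>?A. of_rat (q x) * x) \<notin> W"
        using dependent_pair[of ?A ?A'] EPx LPy by blast
      define w where "w = ?a + ?b"
      have w: "w \<in> dcl F" "exp w \<in> dcl F" using W_dcl_F[OF qs(1)] unfolding w_def by auto
      have up: "dcl F \<subseteq> dcl (F \<union> V)" for V by (intro dcl_mono) auto
      \<comment> \<open>The last exponent \<open>x\<close> is algebraic over the earlier
        exponentials, so \<open>?a\<close> needs only those of \<open>A\<close>, and the outer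
        hypothesis for \<open>A\<close> and \<open>?A'\<close> applies to it.\<close>
      have "?a \<in> dcl (F \<union> exp ` A)"
        using EP \<open>x \<in> dcl (F \<union> exp ` A)\<close> by (intro lincomb_dcl) auto
      moreover have "?b \<in> dcl (F \<union> ?A')"
        using dcl_superset[of "F \<union> ?A'"] by (intro lincomb_dcl) auto
      then have "w - ?b \<in> dcl (F \<union> ?A')"
        by (rule is_subfield_diff[OF is_subfield_dcl subsetD[OF up w(1)]])
      then have "?a \<in> dcl (F \<union> ?A')" by (simp add: w_def)
      moreover have "free_pair A ?A'" using \<open>\<And>A'. L_chain A' \<Longrightarrow> free_pair A A'\<close> Ly by blast
      ultimately have a: "?a \<in> dcl F" using free_pair_Int EP by blast
      have "exp ?a \<in> dcl (F \<union> exp ` ?A)"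
        using dcl_superset[of "F \<union> exp ` ?A"] by (intro exp_lincomb_dcl) auto
      \<comment> \<open>Dually \<open>exp y\<close> is algebraic over \<open>F\<close> and
        \<open>A'\<close>, so \<open>exp ?b\<close> does not need the last logarithm and the inner
        hypothesis applies.\<close>
      moreover have "exp ?b \<in> dcl (F \<union> A')"
        using LP \<open>exp y \<in> dcl (F \<union> A')\<close> by (intro exp_lincomb_dcl) auto
      then have "exp w / exp ?b \<in> dcl (F \<union> A')"
        by (rule is_subfield_divide[OF is_subfield_dcl subsetD[OF up w(2)]])
      then have "exp ?a \<in> dcl (F \<union> A')" by (simp add: w_def exp_add)
      ultimately have "exp ?a \<in> dcl F" using free_pair_Int[OF IH_L] EPx by blast
      then show ?thesis using exp_transcendental_over_F[OF a] qs(2) by blast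
    qed
  qed
qed

section \<open>Linear disjointness\<close>

text \<open>The dual derivations kill every \<open>x i\<close>, so applying one to a relation merely
  differentiates the coefficients. Coefficients killed by all of them lie in \<open>dcl F\<close>,
  where independence is assumed.\<close>

lemma free_pair_linearly_disjoint:
  fixes x k :: "nat \<Rightarrow> complex"
  assumes free: "free_pair A A'" "finite A" and I: "finite I"
    and x: "\<And>i. i \<in> I \<Longrightarrow> x i \<in> dcl (F \<union> A')" and k: "\<And>i. i \<in> I \<Longrightarrow> k i \<in> dcl (F \<union> exp ` A)"
    and indep: "\<And>m. (\<And>i. i \<in> I \<Longrightarrow> m i \<in> dcl F) \<Longrightarrow> (\<Sum>i\<in>I. m i * x i) = 0 \<Longrightarrow> \<forall>i\<in>I. m i = 0"
    and rel: "(\<Sum>i\<in>I. k i * x i) = 0"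
  shows "\<forall>i\<in>I. k i = 0"
proof (rule ccontr)
  assume nz: "\<not> ?thesis"
  obtain e where e: "\<And>x. x \<in> A \<Longrightarrow> e x \<in> Der_over (F \<union> A')"
    "\<And>x y. x \<in> A \<Longrightarrow> y \<in> A \<Longrightarrow> e x (exp y) = (if y = x then 1 else 0)"
    "\<And>z. z \<in> dcl (F \<union> exp ` A) \<Longrightarrow> (\<And>x. x \<in> A \<Longrightarrow> e x z = 0) \<Longrightarrow> z \<in> dcl F"
    using free_pair_duals[OF free] by metis
  let ?M = "dcl (F \<union> exp ` A)"
  \<comment> \<open>On the generators \<open>e a\<close> has only the values 0 and 1. Its bracket
    with a derivation over the generators therefore kills them, hence kills
    \<open>m\<close>.\<close>
  have preserve: "e a m \<in> ?M" if a: "a \<in> A" and m: "m \<in> ?M" for a m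
  proof (rule dclI)
    fix D assume D: "derivation D" "\<And>s. s \<in> F \<union> exp ` A \<Longrightarrow> D s = 0"
    note ea = e(1)[OF a]
    have "derivation (\<lambda>z. D (e a z) - e a (D z))" by (intro derivation_bracket D(1) Der_overD(1)[OF ea])
    moreover have "D (e a s) - e a (D s) = 0" if s: "s \<in> F \<union> exp ` A" for s
    proof -
      have "e a s = 0 \<or> e a s = 1" using s Der_overD(2)[OF ea, of s] e(2)[OF a] by auto
      then have "D (e a s) = 0" using D(1) by auto
      then show ?thesis using D(2)[OF s] Der_overD(1)[OF ea] by simp
    qed
    ultimately have "D (e a m) - e a (D m) = 0" using dclD[OF m] by blast
    moreover have "D m = 0" using dclD[OF m D] .
    ultimately show "D (e a m) = 0" using Der_overD(1)[OF ea] by simp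
  qed
  have "\<exists>m. (\<Sum>i\<in>I. m i * x i) = 0 \<and> (\<forall>i\<in>I. m i \<in> ?M \<and> (\<forall>D\<in>e ` A. D (m i) = 0)) \<and> (\<exists>i\<in>I. m i \<noteq> 0)"
  proof (rule relation_with_constant_coefficients[OF I is_subfield_dcl])
    show "(\<Sum>i\<in>I. c * l i * x i) = 0" if "(\<Sum>i\<in>I. l i * x i) = 0" for l c
      using that by (simp add: mult.assoc sum_distrib_left[symmetric])
    show "(\<Sum>i\<in>I. D (l i) * x i) = 0" if l: "(\<Sum>i\<in>I. l i * x i) = 0" and D: "D \<in> e ` A" for l D
    proof -
      have DA: "D \<in> Der_over (F \<union> A')" using D e(1) by blast
      note dD = Der_overD(1)[OF DA]
      have "(\<Sum>i\<in>I. D (l i) * x i) = (\<Sum>i\<in>I. D (l i * x i))"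
        using Der_over_dcl[OF DA x] by (intro sum.cong) (auto simp: derivation_mult[OF dD])
      also have "\<dots> = D (\<Sum>i\<in>I. l i * x i)" by (rule derivation_sum[OF dD, symmetric])
      finally show ?thesis using l dD by simp
    qed
    show "derivation D" if "D \<in> e ` A" for D using that e(1) Der_overD(1) by blast
    show "D m \<in> ?M" if "D \<in> e ` A" "m \<in> ?M" for D m using that preserve by blast
    show "(\<Sum>i\<in>I. k i * x i) = 0" by (rule rel)
  qed (use k nz in auto)
  then obtain m where m: "(\<Sum>i\<in>I. m i * x i) = 0" "\<And>i. i \<in> I \<Longrightarrow> m i \<in> ?M"
    "\<And>i a. i \<in> I \<Longrightarrow> a \<in> A \<Longrightarrow> e a (m i) = 0" "\<exists>i\<in>I. m i \<noteq> 0" by blast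
  have "m i \<in> dcl F" if "i \<in> I" for i using e(3)[OF m(2)[OF that]] m(3)[OF that] by blast
  then show False using indep[OF _ m(1)] m(4) by blast
qed

end

text \<open>\<open>combine\<close> stops at the end of the shorter list, so missing coefficients
  count as zero.\<close>

lemma combine_ring_of_type_algebra:
  "ring.combine \<CC> Ks Us = (\<Sum>i<length Us. (if i < length Ks then Ks ! i else 0) * Us ! i)"
proof -
  interpret field \<CC> by (rule field_from_type_algebra)
  show ?thesis
  proof (induction Ks Us rule: combine.induct)
    case (1 k Ks u Us)
    have "combine (k # Ks) (u # Us) = k * u + combine Ks Us"
      by simp (simp add: ring_of_type_algebra_def)
    then show ?case unfolding 1 by (simp add: sum.lessThan_Suc_shift del: sum.lessThan_Suc combine.simps)
        (intro sum.cong refl, simp)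
  qed (simp, simp add: ring_of_type_algebra_def)+
qed

lemma independent_ring_of_type_algebra:
  assumes K: "is_subfield K"
  shows "ring.independent \<CC> K xs \<longleftrightarrow>
    (\<forall>m. (\<forall>i<length xs. m i \<in> K) \<and> (\<Sum>i<length xs. m i * xs ! i) = 0 \<longrightarrow> (\<forall>i<length xs. m i = 0))"
proof -
  interpret field \<CC> by (rule field_from_type_algebra)
  have z: "\<zero>\<^bsub>\<CC>\<^esub> = 0" and carr: "carrier \<CC> = UNIV" by (auto simp: ring_of_type_algebra_def)
  have KS: "subfield K \<CC>" using K is_subfield_iff by blast
  show ?thesis
  proof (intro iffI allI impI)
    fix m i assume xs: "independent K xs"
      and m: "(\<forall>i<length xs. m i \<in> K) \<and> (\<Sum>i<length xs. m i * xs ! i) = 0" and i: "i < length xs"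
    let ?Ks = "map m [0..<length xs]"
    have "combine ?Ks xs = 0" using m by (simp add: combine_ring_of_type_algebra)
    moreover have "set ?Ks \<subseteq> K" using m by auto
    ultimately have "set (take (length xs) ?Ks) \<subseteq> {0}"
      using independent_imp_trivial_combine[OF KS xs, of ?Ks] by (simp add: z)
    moreover have "m i \<in> set (take (length xs) ?Ks)" using i by simp
    ultimately show "m i = 0" by blast
  next
    assume *: "\<forall>m. (\<forall>i<length xs. m i \<in> K) \<and> (\<Sum>i<length xs. m i * xs ! i) = 0 \<longrightarrow> (\<forall>i<length xs. m i = 0)"
    show "independent K xs"
    proof (rule trivial_combine_imp_independent[OF KS])
      show "set xs \<subseteq> carrier \<CC>" by (simp add: carr)
      fix Ks assume Ks: "set Ks \<subseteq> K" "combine Ks xs = \<zero>\<^bsub>\<CC>\<^esub>"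
      define m where "m i = (if i < length Ks then Ks ! i else 0)" for i
      have "m i \<in> K" for i using Ks(1) is_subfield_0[OF K] by (auto simp: m_def)
      moreover have "(\<Sum>i<length xs. m i * xs ! i) = 0"
        using Ks(2) by (simp add: combine_ring_of_type_algebra z m_def)
      ultimately have "m i = 0" if "i < length xs" for i using spec[OF *, of m] that by blast
      then have "Ks ! i = 0" if "i < length xs" "i < length Ks" for i
        using that unfolding m_def by metis
      then show "set (take (length xs) Ks) \<subseteq> {\<zero>\<^bsub>\<CC>\<^esub>}"
        by (auto simp: z in_set_conv_nth)
    qed
  qed
qed

theorem theorem4p4:
  fixes ts :: "complex list" and F E L :: "complex set"
  assumes "set ts \<subseteq> UNIV - C_exp"
    and F_def: "F = generate_field \<CC> (C_exp \<union> set ts \<union> exp ` set ts)"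
    and "trdeg C_exp F = ldim_rat (set ts) C_exp + edim (set ts) {}"
    and E_def: "E = (\<Union>n\<in>{1..}. E_tower F n)"
    and L_def: "L = (\<Union>n\<in>{1..}. L_tower F n)"
  shows "linearly_disjoint (cx_alg_closure F) E L"
proof -
  define T where "T = set ts"
  have T: "finite T" by (simp add: T_def)
  define \<S> where "\<S> = {S. finite S \<and> S \<subseteq> span_rat T \<and> rat_independent_mod C_exp S}"
  have ldim: "ldim_rat T C_exp = (SUP S\<in>\<S>. enat (card S))"
    unfolding ldim_rat_def \<S>_def by (simp add: span_rat_C_exp)
  \<comment> \<open>Both dimensions are bounded by \<open>card T\<close>, hence finite and attained;
    the hypothesis thereby becomes an equation between natural numbers.\<close>
  have "card S \<le> card T" if "S \<in> \<S>" for S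
    using rat_independent_mod_card[OF T, of S C_exp] that is_subfield_0[OF is_subfield_C_exp]
    unfolding \<S>_def by blast
  then obtain l where l: "(SUP S\<in>\<S>. enat (card S)) = enat l" by (rule SUP_enat_bounded)
  have "{} \<in> \<S>" by (simp add: \<S>_def rat_independent_mod_empty)
  then obtain S where S: "S \<in> \<S>" "card S = l" using SUP_enat_attained[of \<S> card, OF _ l] by blast
  have "n \<le> card T" if "n \<in> {n. edim_at_least n T {}}" for n using edim_at_least_bound[OF T] that by simp
  then obtain r where r: "(SUP n\<in>{n. edim_at_least n T {}}. enat n) = enat r" by (rule SUP_enat_bounded)
  have "edim_at_least 0 T {}" by (simp add: edim_at_least_def)
  then have "edim_at_least r T {}"
    using SUP_enat_attained[of "{n. edim_at_least n T {}}" "\<lambda>n. n", OF _ r] by auto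
  then obtain a d where ad: "\<And>i. i \<in> {1..r} \<Longrightarrow> a i \<in> ecl T" "\<And>i. i \<in> {1..r} \<Longrightarrow> exp_derivation (d i)"
    "\<And>i. i \<in> {1..r} \<Longrightarrow> d i (a i) = 1" "\<And>i k. i \<in> {1..r} \<Longrightarrow> k \<in> {1..r} \<Longrightarrow> i \<noteq> k \<Longrightarrow> d i (a k) = 0"
    unfolding edim_at_least_def by blast
  have "trdeg C_exp F = enat (l + r)"
    using assms(3) ldim l r by (simp add: T_def edim_def)
  then obtain B where B: "finite B" "B \<subseteq> F" "card B = l + r" "F \<subseteq> dcl (C_exp \<union> B)"
    using trdeg_basis is_subfield_0[OF is_subfield_C_exp] by blast
  interpret exponential_base T F S B r a d
    by standard (use F_def B S ad in \<open>auto simp: T_def \<S>_def\<close>)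

  have towers: "is_subfield (E_tower F n)" "is_subfield (L_tower F n)" for n
    by (cases n; simp add: dcl_F cx_alg_closure_generate_field is_subfield_dcl)+
  have inc: "incseq (E_tower F)" "incseq (L_tower F)"
  proof -
    have "V \<subseteq> dcl (V \<union> V')" for V V' using dcl_superset[of "V \<union> V'"] by blast
    then show "incseq (E_tower F)" "incseq (L_tower F)"
      by (simp_all add: incseq_SucI cx_alg_closure_generate_field)
  qed
  have E: "E = (\<Union>n. E_tower F n)" and L: "L = (\<Union>n. L_tower F n)"
  proof -
    \<comment> \<open>The unions start at 1, but the towers increase, so level 0 may be
      included.\<close>
    have *: "(\<Union>n\<in>{1..}. f n) = (\<Union>n. f n)" if "incseq f" for f :: "nat \<Rightarrow> complex set"
      using incseq_SucD[OF that] by (auto intro!: bexI[of _ "Suc _"])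
    show "E = (\<Union>n. E_tower F n)" "L = (\<Union>n. L_tower F n)"
      unfolding E_def L_def by (rule *[OF inc(1)], rule *[OF inc(2)])
  qed
  have sub: "is_subfield E" "is_subfield L"
    unfolding E L using inc towers by (auto intro!: is_subfield_UN_incseq)
  have base: "dcl F \<subseteq> E \<inter> L"
  proof -
    have "E_tower F 0 \<subseteq> E" "L_tower F 0 \<subseteq> L" unfolding E L by blast+
    then show ?thesis by (simp add: dcl_F)
  qed
  have "ring.independent \<CC> E xs" if xs: "set xs \<subseteq> L" "ring.independent \<CC> (dcl F) xs" for xs
    unfolding independent_ring_of_type_algebra[OF sub(1)]
  proof (intro allI impI)
    fix k :: "nat \<Rightarrow> complex" and i0
    assume k: "(\<forall>i<length xs. k i \<in> E) \<and> (\<Sum>i<length xs. k i * xs ! i) = 0" and i0: "i0 < length xs"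
    define I where "I = {..<length xs}"
    \<comment> \<open>A single chain has to carry all coefficients at once, and likewise below for
      the entries of \<open>xs\<close>.\<close>
    have "\<exists>A. {} \<subseteq> A \<and> E_chain A \<and> k ` I \<subseteq> dcl (F \<union> exp ` A)"
    proof (rule finite_chain_extension[where chain = E_chain and h = "\<lambda>A. F \<union> exp ` A"])
      fix t A assume "t \<in> k ` I" and A: "E_chain A"
      then obtain n where "t \<in> E_tower F n" using k unfolding E I_def by auto
      then show "\<exists>A'. A \<subseteq> A' \<and> E_chain A' \<and> t \<in> dcl (F \<union> exp ` A')" using A by (rule E_tower_chain)
    qed (auto simp: I_def E_chain.empty)
    then obtain A where A: "E_chain A" "k ` I \<subseteq> dcl (F \<union> exp ` A)" by blast
    have "\<exists>A. {} \<subseteq> A \<and> L_chain A \<and> set xs \<subseteq> dcl (F \<union> A)"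
    proof (rule finite_chain_extension[where chain = L_chain and h = "\<lambda>A. F \<union> A"])
      fix t A assume "t \<in> set xs" and A: "L_chain A"
      then obtain n where "t \<in> L_tower F n" using xs(1) unfolding L by auto
      then show "\<exists>A'. A \<subseteq> A' \<and> L_chain A' \<and> t \<in> dcl (F \<union> A')" using A by (rule L_tower_chain)
    qed (auto simp: L_chain.empty)
    then obtain A' where A': "L_chain A'" "set xs \<subseteq> dcl (F \<union> A')" by blast
    have "\<forall>i\<in>I. k i = 0"
    proof (rule free_pair_linearly_disjoint[OF chains_free[OF A(1) A'(1)], where x = "\<lambda>i. xs ! i"])
      show "finite A" using E_chain_props[OF A(1)] by blast
      show "xs ! i \<in> dcl (F \<union> A')" if "i \<in> I" for i using A'(2) that by (auto simp: I_def)
      show "k i \<in> dcl (F \<union> exp ` A)" if "i \<in> I" for i using A(2) that by auto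
      show "\<forall>i\<in>I. m i = 0" if "\<And>i. i \<in> I \<Longrightarrow> m i \<in> dcl F" "(\<Sum>i\<in>I. m i * xs ! i) = 0" for m
        using xs(2) that unfolding independent_ring_of_type_algebra[OF is_subfield_dcl] I_def by blast
      show "(\<Sum>i\<in>I. k i * xs ! i) = 0" using k by (simp add: I_def)
    qed (simp add: I_def)
    then show "k i0 = 0" using i0 by (simp add: I_def)
  qed
  then show ?thesis
    unfolding linearly_disjoint_def dcl_F
    using base sub is_subfield_dcl by (simp add: is_subfield_iff)
qed

end
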